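(* Let $s\in(-2,0]$ and let $\beta_0\in\mathbb{R}$, $\beta_0\neq 0$. There exists $\delta>0$, depending only on $s$ and $\beta_0$, such that the following holds. Let $B$ be a real-valued function on $\mathbb{C}\setminus\{0\}$ that is radially homogeneous of degree $s$, i.e. $B(re^{i\psi})=r^sB(e^{i\psi})$ for $r>0$, with $$\frac1{2\pi}\int_0^{2\pi}B(e^{i\psi})\,d\psi=\beta_0 ,$$ and, in the cases $s=0$ and $s=-1$, suppose in addition that $$\int_0^{2\pi}B(e^{i\psi})e^{i(s+2)\psi}\,d\psi=0 .$$ If $$\int_0^{2\pi}|B(e^{i\psi})-\beta_0|^2\,d\psi<\delta ,$$ then the space of zero modes for $B$ is infinite-dimensional.
   Context: Identify $\mathbb{R}^2$ with $\mathbb{C}$ by $z=x_1+ix_2$; $L_2(\mathbb{C})$ is taken with respect to Lebesgue measure. Let $F$ be a real-valued solution of the Poisson equation $\Delta F=B$ in $\mathbb{C}$; under the stated hypotheses one can take $F(re^{i\psi})=\varphi(\psi)r^{s+2}$ with $\varphi$ a $2\pi$-periodic real solution of $\varphi''(\psi)+(s+2)^2\varphi(\psi)=B(e^{i\psi})$. The space of zero modes (of the Pauli operator with magnetic field $B$) consists of the entire analytic functions $u$ with $u e^{-F}\in L_2(\mathbb{C})$ (one spin component) together with the entire anti-analytic functions $u$ (i.e. $\bar u$ entire analytic) with $ue^{F}\in L_2(\mathbb{C})$ (the other spin component); that is, it is the direct sum of these two vector spaces. Its dimension does not depend on the choice of the solution $F$. *)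

theory Defs
  imports "HOL-Analysis.Analysis" "HOL-Library.Function_Algebras"
begin

definition radially_homogeneous :: "real \<Rightarrow> (complex \<Rightarrow> real) \<Rightarrow> bool" where
  "radially_homogeneous s B \<longleftrightarrow>
     (\<forall>r>0. \<forall>\<psi>. B (complex_of_real r * cis \<psi>) = r powr s * B (cis \<psi>))"

definition square_integrable :: "'a measure \<Rightarrow> ('a \<Rightarrow> 'b::{banach, second_countable_topology}) \<Rightarrow> bool" where
  "square_integrable M f \<longleftrightarrow> f \<in> borel_measurable M \<and> integrable M (\<lambda>x. (norm (f x))\<^sup>2)"

definition locally_integrable :: "(complex \<Rightarrow> real) \<Rightarrow> bool" where
  "locally_integrable f \<longleftrightarrow> (\<forall>K. compact K \<longrightarrow> set_integrable lebesgue K f)"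


section \<open>The Poisson equation in the sense of distributions\<close>

text \<open>
  The function \<open>D i j\<close> is the partial derivative of \<open>f\<close> of order \<open>i\<close> in the real
  direction and order \<open>j\<close> in the imaginary direction.
\<close>
definition smooth :: "(complex \<Rightarrow> real) \<Rightarrow> bool" where
  "smooth f \<longleftrightarrow>
     (\<exists>D :: nat \<Rightarrow> nat \<Rightarrow> complex \<Rightarrow> real. D 0 0 = f \<and>
        (\<forall>i j z. (D i j has_derivative
                    (\<lambda>h. Re h * D (Suc i) j z + Im h * D i (Suc j) z)) (at z)))"

definition test_function :: "(complex \<Rightarrow> real) \<Rightarrow> bool" where
  "test_function \<eta> \<longleftrightarrow> smooth \<eta> \<and> compact (closure {z. \<eta> z \<noteq> 0})"

definition laplacian :: "(complex \<Rightarrow> real) \<Rightarrow> complex \<Rightarrow> real" where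
  "laplacian f z =
     (deriv ^^ 2) (\<lambda>t. f (z + complex_of_real t)) 0 +
     (deriv ^^ 2) (\<lambda>t. f (z + \<i> * complex_of_real t)) 0"

text \<open>
  The field is in general unbounded or discontinuous (it is homogeneous and only square
  integrable on the unit circle), so the equation is understood weakly.
  The value of \<open>B\<close> at the origin is irrelevant.
\<close>
definition poisson_solution :: "(complex \<Rightarrow> real) \<Rightarrow> (complex \<Rightarrow> real) \<Rightarrow> bool" where
  "poisson_solution B F \<longleftrightarrow>
     locally_integrable B \<and> locally_integrable F \<and>
     (\<forall>\<eta>. test_function \<eta> \<longrightarrow>
        (LINT z|lebesgue. F z * laplacian \<eta> z) = (LINT z|lebesgue. B z * \<eta> z))"


section \<open>Zero modes\<close>

type_synonym spinor = "(complex \<Rightarrow> complex) \<times> (complex \<Rightarrow> complex)"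

definition spinor_scale :: "complex \<Rightarrow> spinor \<Rightarrow> spinor" where
  "spinor_scale c w = ((\<lambda>z. c * fst w z), (\<lambda>z. c * snd w z))"

interpretation spinor: vector_space spinor_scale
  by unfold_locales (auto simp: spinor_scale_def fun_eq_iff algebra_simps prod_eq_iff)

definition analytic_zero_modes :: "(complex \<Rightarrow> real) \<Rightarrow> (complex \<Rightarrow> complex) set" where
  "analytic_zero_modes F =
     {u. u holomorphic_on UNIV \<and>
         square_integrable lebesgue (\<lambda>z. u z * complex_of_real (exp (- F z)))}"

definition antianalytic_zero_modes :: "(complex \<Rightarrow> real) \<Rightarrow> (complex \<Rightarrow> complex) set" where
  "antianalytic_zero_modes F =
     {u. (\<lambda>z. cnj (u z)) holomorphic_on UNIV \<and>
         square_integrable lebesgue (\<lambda>z. u z * complex_of_real (exp (F z)))}"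

text \<open>The (external) direct sum of the two spaces.\<close>
definition zero_modes :: "(complex \<Rightarrow> real) \<Rightarrow> spinor set" where
  "zero_modes F = analytic_zero_modes F \<times> antianalytic_zero_modes F"

definition infinite_dimensional :: "spinor set \<Rightarrow> bool" where
  "infinite_dimensional V \<longleftrightarrow> \<not> (\<exists>S. finite S \<and> spinor.span S = V)"

text \<open>
  The notion of dimension above is meant for linear subspaces; \<open>zero_modes F\<close> is one.
\<close>

lemma square_integrable_add:
  fixes f g :: "'a \<Rightarrow> complex"
  assumes "square_integrable M f" "square_integrable M g"
  shows "square_integrable M (\<lambda>x. f x + g x)"
proof -
  have m: "f \<in> borel_measurable M" "g \<in> borel_measurable M"
    using assms by (auto simp: square_integrable_def)
  have i: "integrable M (\<lambda>x. 2 * (norm (f x))\<^sup>2 + 2 * (norm (g x))\<^sup>2)"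
    using assms by (auto simp: square_integrable_def)
  have "(norm (a + b))\<^sup>2 \<le> 2 * (norm a)\<^sup>2 + 2 * (norm b)\<^sup>2" for a b :: complex
  proof -
    have "(norm (a + b))\<^sup>2 \<le> (norm a + norm b)\<^sup>2"
      by (intro power_mono norm_triangle_ineq) auto
    also have "\<dots> \<le> 2 * (norm a)\<^sup>2 + 2 * (norm b)\<^sup>2"
      using zero_le_power2[of "norm a - norm b"] by (simp add: power2_eq_square algebra_simps)
    finally show ?thesis .
  qed
  then have "integrable M (\<lambda>x. (norm (f x + g x))\<^sup>2)"
    using m by (intro Bochner_Integration.integrable_bound[OF i]) auto
  then show ?thesis
    using m by (auto simp: square_integrable_def)
qed

lemma square_integrable_cmult:
  fixes f :: "'a \<Rightarrow> complex"
  assumes "square_integrable M f"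
  shows "square_integrable M (\<lambda>x. c * f x)"
  using assms by (auto simp: square_integrable_def norm_mult power_mult_distrib)

lemma zero_modes_add:
  assumes "x \<in> zero_modes F" "y \<in> zero_modes F"
  shows "x + y \<in> zero_modes F"
  using assms
  by (auto simp: zero_modes_def analytic_zero_modes_def antianalytic_zero_modes_def
        distrib_right plus_fun_def intro!: holomorphic_intros square_integrable_add)

lemma zero_modes_scale:
  assumes "x \<in> zero_modes F"
  shows "spinor_scale c x \<in> zero_modes F"
  using assms
  by (auto simp: zero_modes_def analytic_zero_modes_def antianalytic_zero_modes_def
        spinor_scale_def mult.assoc intro!: holomorphic_intros square_integrable_cmult)

lemma zero_in_zero_modes: "0 \<in> zero_modes F"
  by (auto simp: zero_modes_def analytic_zero_modes_def antianalytic_zero_modes_def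
        square_integrable_def zero_prod_def zero_fun_def)

lemma subspace_zero_modes: "spinor.subspace (zero_modes F)"
  by (auto simp: spinor.subspace_def zero_in_zero_modes zero_modes_add zero_modes_scale)

end

theory Submission
  imports Defs "HOL-Complex_Analysis.Cauchy_Integral_Theorem"
begin

text \<open>
  With \<open>a = s + 2\<close>, a solution of the Poisson equation is \<open>r\<^sup>a \<phi>(\<psi>)\<close>, where \<open>\<phi>\<close> is
  \<open>\<beta>\<^sub>0 / a\<^sup>2\<close> plus the convolution of \<open>B - \<beta>\<^sub>0\<close> with a bounded periodic Green function. If
  \<open>B - \<beta>\<^sub>0\<close> is small in \<open>L\<^sub>2\<close>, then \<open>\<phi>\<close> is bounded away from zero and has the sign of \<open>\<beta>\<^sub>0\<close>, so all
  polynomials are zero modes of one of the two spin components. By Weyl's lemma any other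
  solution differs from this one by \<open>Re g\<close> with \<open>g\<close> entire, and multiplication by \<open>exp g\<close>
  carries the zero modes over.

  Weyl's lemma rests on one explicit function: the smoothed logarithm
  \<open>ln (|z|\<^sup>2 + bump z) / 2\<close>, equal to \<open>ln |z|\<close> outside the unit disc. Its rescalings differ by test functions
  and constants, so the mollifications of a weakly harmonic function by its Laplacian do not depend on
  the scale. The Poisson equation itself is checked in the coordinates \<open>z = exp (t + i\<psi>)\<close>, in which
  \<open>r\<^sup>2\<Delta> = \<partial>\<^sub>t\<^sup>2 + \<partial>\<^sub>\<psi>\<^sup>2\<close> and the two variables separate.
\<close>

section \<open>Smooth functions of a complex variable\<close>

text \<open>Resonance is the first obstacle. For \<open>a = 1\<close> and \<open>a = 2\<close>, that
  is s = -1 and s = 0, cos(a psi) and sin(a psi) are periodic solutions of the homogeneous equation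
  on the circle, so a periodic \<phi> exists only if the field is orthogonal to both; this is the
  extra hypothesis. In every case the kernel is bounded by K = (|cot(a pi)| + 1) / (2a), with cot
  read as 0 at resonance. As K depends on \<open>a\<close> alone, \<delta> can be chosen from s and
  the mean only: by Cauchy-Schwarz it forces the oscillating part of \<phi> below half of |mean| /
  a^2. What remains is a lower bound k r^a with k = |mean| / (2 a^2), and exp(-k r^a) beats every
  power of r.

  The second obstacle is regularity. The field is only square integrable in the angle and may blow
  up at the origin, so \<phi> need not have a classical second derivative everywhere. All
  derivatives are therefore moved onto the test function: in t by an integration by parts with
  weight e^(at), in psi by Green's identity for the kernel. For the same reason uniqueness has to
  start from a function that is merely locally integrable.\<close>

definition has_partials ::
  "(complex \<Rightarrow> real) \<Rightarrow> (complex \<Rightarrow> real) \<Rightarrow> (complex \<Rightarrow> real) \<Rightarrow> bool" where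
  "has_partials f fx fy \<longleftrightarrow>
     (\<forall>z. (f has_derivative (\<lambda>h. Re h * fx z + Im h * fy z)) (at z))"

lemma has_partialsD:
  "has_partials f fx fy \<Longrightarrow> (f has_derivative (\<lambda>h. Re h * fx z + Im h * fy z)) (at z within S)"
  unfolding has_partials_def by (blast intro: has_derivative_at_withinI)

lemma has_partials_continuous: "has_partials f fx fy \<Longrightarrow> continuous_on S f"
  by (rule has_derivative_continuous_on) (erule has_partialsD)

lemma has_partials_const: "has_partials (\<lambda>_. c) (\<lambda>_. 0) (\<lambda>_. 0)"
  unfolding has_partials_def by simp

lemma has_partials_add:
  assumes "has_partials f fx fy" "has_partials g gx gy"
  shows "has_partials (\<lambda>z. f z + g z) (\<lambda>z. fx z + gx z) (\<lambda>z. fy z + gy z)"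
  unfolding has_partials_def
  by (auto intro!: derivative_eq_intros has_partialsD[OF assms(1)] has_partialsD[OF assms(2)] simp: algebra_simps)

lemma has_partials_mult:
  assumes "has_partials f fx fy" "has_partials g gx gy"
  shows "has_partials (\<lambda>z. f z * g z) (\<lambda>z. fx z * g z + f z * gx z) (\<lambda>z. fy z * g z + f z * gy z)"
  unfolding has_partials_def
  by (auto intro!: derivative_eq_intros has_partialsD[OF assms(1)] has_partialsD[OF assms(2)] simp: algebra_simps)

lemma has_partials_chain:
  assumes "has_partials f fx fy" "\<And>z. (g has_real_derivative g' z) (at (f z))"
  shows "has_partials (\<lambda>z. g (f z)) (\<lambda>z. g' z * fx z) (\<lambda>z. g' z * fy z)"
  unfolding has_partials_def
proof
  fix z
  have "((\<lambda>z. g (f z)) has_derivative (\<lambda>h. g' z * (Re h * fx z + Im h * fy z))) (at z)"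
    by (rule has_derivative_compose[OF has_partialsD[OF assms(1)] assms(2)[of z, unfolded has_field_derivative_def]])
  then show "((\<lambda>z. g (f z)) has_derivative (\<lambda>h. Re h * (g' z * fx z) + Im h * (g' z * fy z))) (at z)"
    by (simp add: algebra_simps)
qed

lemma has_partials_Re: "has_partials Re (\<lambda>_. 1) (\<lambda>_. 0)"
  and has_partials_Im: "has_partials Im (\<lambda>_. 0) (\<lambda>_. 1)"
  unfolding has_partials_def by (auto intro!: derivative_eq_intros)

lemma has_partials_affine:
  assumes "has_partials f fx fy"
  shows "has_partials (\<lambda>w. f (of_real k * w + c)) (\<lambda>w. k * fx (of_real k * w + c)) (\<lambda>w. k * fy (of_real k * w + c))"
  unfolding has_partials_def
proof
  fix z
  have "((\<lambda>w. f (of_real k * w + c)) has_derivative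
      (\<lambda>h. Re (of_real k * h) * fx (of_real k * z + c) + Im (of_real k * h) * fy (of_real k * z + c))) (at z)"
    by (rule has_derivative_compose[of "\<lambda>w. of_real k * w + c" "\<lambda>h. of_real k * h", OF _ has_partialsD[OF assms]])
       (auto intro!: derivative_eq_intros)
  then show "((\<lambda>w. f (of_real k * w + c)) has_derivative
      (\<lambda>h. Re h * (k * fx (of_real k * z + c)) + Im h * (k * fy (of_real k * z + c)))) (at z)"
    by (simp add: algebra_simps)
qed

lemma has_partials_DERIV_x:
  assumes "has_partials f fx fy"
  shows "((\<lambda>t. f (z + of_real t)) has_real_derivative fx (z + of_real t)) (at t within S)"
proof -
  have "((\<lambda>t. f (z + of_real t)) has_derivative
      (\<lambda>h. Re (of_real h) * fx (z + of_real t) + Im (of_real h) * fy (z + of_real t))) (at t within S)"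
    by (rule has_derivative_compose[of "\<lambda>t. z + of_real t" "\<lambda>h. of_real h", OF _ has_partialsD[OF assms]])
       (auto intro!: derivative_eq_intros)
  then show ?thesis
    by (simp add: has_field_derivative_def mult.commute[of _ "fx _"])
qed

lemma has_partials_DERIV_y:
  assumes "has_partials f fx fy"
  shows "((\<lambda>t. f (z + \<i> * of_real t)) has_real_derivative fy (z + \<i> * of_real t)) (at t within S)"
proof -
  have "((\<lambda>t. f (z + \<i> * of_real t)) has_derivative
      (\<lambda>h. Re (\<i> * of_real h) * fx (z + \<i> * of_real t) + Im (\<i> * of_real h) * fy (z + \<i> * of_real t))) (at t within S)"
    by (rule has_derivative_compose[of "\<lambda>t. z + \<i> * of_real t" "\<lambda>h. \<i> * of_real h", OF _ has_partialsD[OF assms]])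
       (auto intro!: derivative_eq_intros)
  then show ?thesis
    by (simp add: has_field_derivative_def mult.commute[of _ "fy _"])
qed

section \<open>Symmetry of mixed partial derivatives\<close>

lemma second_difference:
  assumes f: "has_partials f fx fy" "has_partials fx fxx fxy" and "h > 0"
  shows "\<exists>w. dist w z \<le> 2 * h \<and>
    f (z + of_real h + \<i> * of_real h) - f (z + of_real h) - f (z + \<i> * of_real h) + f z = h\<^sup>2 * fxy w"
proof -
  \<comment> \<open>The mean value theorem is used twice: in x for the difference \<open>g\<close>
    of two horizontal slices, which replaces \<open>f\<close> by \<open>fx\<close>, then in y for
    \<open>fx\<close> along one vertical segment. Both intermediate offsets lie below
    \<open>h\<close>, which gives the distance 2h.\<close>
  define g where "g t = f (z + \<i> * of_real h + of_real t) - f (z + of_real t)" for t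
  have "(g has_real_derivative (fx (z + \<i> * of_real h + of_real t) - fx (z + of_real t))) (at t)" for t
    unfolding g_def by (intro DERIV_diff has_partials_DERIV_x[OF f(1)])
  then obtain t where t: "0 < t" "t < h"
      "g h - g 0 = (h - 0) * (fx (z + \<i> * of_real h + of_real t) - fx (z + of_real t))"
    using MVT2[of 0 h g "\<lambda>t. fx (z + \<i> * of_real h + of_real t) - fx (z + of_real t)"] \<open>h > 0\<close> by auto
  have "((\<lambda>u. fx (z + of_real t + \<i> * of_real u)) has_real_derivative fxy (z + of_real t + \<i> * of_real u)) (at u)" for u
    by (rule has_partials_DERIV_y[OF f(2)])
  then obtain u where u: "0 < u" "u < h"
      "fx (z + of_real t + \<i> * of_real h) - fx (z + of_real t + \<i> * of_real 0)
        = (h - 0) * fxy (z + of_real t + \<i> * of_real u)"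
    using MVT2[of 0 h "\<lambda>u. fx (z + of_real t + \<i> * of_real u)" "\<lambda>u. fxy (z + of_real t + \<i> * of_real u)"] \<open>h > 0\<close> by auto
  have "dist (z + of_real t + \<i> * of_real u) z \<le> norm (of_real t :: complex) + norm (\<i> * of_real u)"
    unfolding dist_norm using norm_triangle_ineq[of "of_real t :: complex" "\<i> * of_real u"] by (simp add: add.assoc)
  also have "\<dots> \<le> 2 * h" using t u by (simp add: norm_mult)
  finally show ?thesis
    using t(3) u(3) by (intro exI[of _ "z + of_real t + \<i> * of_real u"])
      (simp add: g_def power2_eq_square algebra_simps)
qed

text \<open>\<open>\<i> * cnj z\<close> is the reflection of x + iy to y + ix. It exchanges the two
  partials, so a result for x-then-y yields the one for y-then-x.\<close>

lemma has_partials_swap: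
  assumes "has_partials f fx fy"
  shows "has_partials (\<lambda>z. f (\<i> * cnj z)) (\<lambda>z. fy (\<i> * cnj z)) (\<lambda>z. fx (\<i> * cnj z))"
  unfolding has_partials_def
proof
  fix z
  have "((\<lambda>w. f (\<i> * cnj w)) has_derivative
      (\<lambda>h. Re (\<i> * cnj h) * fx (\<i> * cnj z) + Im (\<i> * cnj h) * fy (\<i> * cnj z))) (at z)"
    by (rule has_derivative_compose[of "\<lambda>w. \<i> * cnj w" "\<lambda>h. \<i> * cnj h", OF _ has_partialsD[OF assms]])
       (auto intro!: derivative_eq_intros)
  then show "((\<lambda>w. f (\<i> * cnj w)) has_derivative
      (\<lambda>h. Re h * fy (\<i> * cnj z) + Im h * fx (\<i> * cnj z))) (at z)"
    by (simp add: algebra_simps)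
qed

text \<open>The second difference of \<open>f\<close> over a square of side h is the same in either
  order of the directions. Hence it is \<open>h\<^sup>2\<close> times \<open>fxy\<close> at one
  point near z and \<open>h\<^sup>2\<close> times \<open>fyx\<close> at another; as h shrinks,
  continuity identifies the two values at z.\<close>

lemma mixed_partials:
  assumes f: "has_partials f fx fy" and fx: "has_partials fx fxx fxy" and fy: "has_partials fy fyx fyy"
    and c: "continuous_on UNIV fxy" "continuous_on UNIV fyx"
  shows "fxy = fyx"
proof
  fix z
  define w' where "w' = \<i> * cnj z"
  have [simp]: "\<i> * cnj w' = z" by (simp add: w'_def)
  have e1: "\<exists>u v. dist u z \<le> 2 * h \<and> dist v z \<le> 2 * h \<and> fxy u = fyx v" if h: "h > 0" for h
  proof -
    obtain u where u: "dist u z \<le> 2 * h"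
      "f (z + of_real h + \<i> * of_real h) - f (z + of_real h) - f (z + \<i> * of_real h) + f z = h\<^sup>2 * fxy u"
      using second_difference[OF f fx h] by blast
    obtain v where v: "dist v w' \<le> 2 * h"
      "f (\<i> * cnj (w' + of_real h + \<i> * of_real h)) - f (\<i> * cnj (w' + of_real h)) -
       f (\<i> * cnj (w' + \<i> * of_real h)) + f (\<i> * cnj w') = h\<^sup>2 * fyx (\<i> * cnj v)"
      using second_difference[OF has_partials_swap[OF f] has_partials_swap[OF fy] h] by blast
    have "dist (\<i> * cnj v) z = dist (\<i> * cnj v) (\<i> * cnj w')" by simp
    also have "\<dots> = norm (\<i> * cnj (v - w'))"
      unfolding dist_norm by (simp add: algebra_simps)
    also have "\<dots> = dist v w'" by (simp only: norm_mult complex_mod_cnj dist_norm) simp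
    finally have "dist (\<i> * cnj v) z \<le> 2 * h" using v by simp
    moreover have "fxy u = fyx (\<i> * cnj v)"
    proof -
      have r: "\<i> * cnj (w' + of_real h + \<i> * of_real h) = z + of_real h + \<i> * of_real h"
        "\<i> * cnj (w' + of_real h) = z + \<i> * of_real h" "\<i> * cnj (w' + \<i> * of_real h) = z + of_real h"
        by (simp_all add: w'_def algebra_simps)
      show ?thesis using u(2) v(2) h unfolding r by (simp add: algebra_simps)
    qed
    ultimately show ?thesis using u by blast
  qed
  show "fxy z = fyx z"
  proof (rule ccontr)
    assume ne: "fxy z \<noteq> fyx z"
    define e where "e = \<bar>fxy z - fyx z\<bar> / 2"
    have "e > 0" using ne by (simp add: e_def)
    obtain d1 where d1: "d1 > 0" "\<And>u. dist u z < d1 \<Longrightarrow> dist (fxy u) (fxy z) < e"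
      using c(1) \<open>e > 0\<close> unfolding continuous_on_iff by (metis UNIV_I)
    obtain d2 where d2: "d2 > 0" "\<And>u. dist u z < d2 \<Longrightarrow> dist (fyx u) (fyx z) < e"
      using c(2) \<open>e > 0\<close> unfolding continuous_on_iff by (metis UNIV_I)
    obtain u v where "dist u z \<le> 2 * (min d1 d2 / 4)" "dist v z \<le> 2 * (min d1 d2 / 4)" "fxy u = fyx v"
      using e1[of "min d1 d2 / 4"] d1 d2 by auto
    moreover from this d1 d2 have "dist u z < d1" "dist v z < d2" by auto
    ultimately have "dist (fxy u) (fxy z) < e" "dist (fxy u) (fyx z) < e" using d1(2) d2(2) by metis+
    then show False unfolding dist_real_def e_def by (auto simp: abs_if field_simps split: if_splits)
  qed
qed

section \<open>A coinductive criterion for smoothness and its closure properties\<close>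

lemma smooth_coinduct:
  assumes step: "\<And>f. f \<in> S \<Longrightarrow> \<exists>fx\<in>S. \<exists>fy\<in>S. has_partials f fx fy" and "f \<in> S"
  shows "smooth f"
proof -
  obtain px py where p: "\<And>f. f \<in> S \<Longrightarrow> px f \<in> S \<and> py f \<in> S \<and> has_partials f (px f) (py f)"
    using step by metis
  \<comment> \<open>\<open>smooth\<close> asks for one family indexed by both orders. Here the
    x-derivatives are applied before the y-derivatives, so the x-derivative of \<open>D i j\<close>
    has to be moved past \<open>py ^^ j\<close>; this requires the chosen partials to commute on
    \<open>S\<close>.\<close>
  have comm: "px (py g) = py (px g)" if "g \<in> S" for g
    using mixed_partials[of g "px g" "py g" "px (px g)" "py (px g)" "px (py g)" "py (py g)"] p that
    by (metis has_partials_continuous)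
  define D where "D i j = (py ^^ j) ((px ^^ i) f)" for i j :: nat
  have S1: "(py ^^ j) g \<in> S" "(px ^^ j) g \<in> S" if "g \<in> S" for j g
    using that p by (induction j) auto
  have c2: "px ((py ^^ j) g) = (py ^^ j) (px g)" if "g \<in> S" for j g
    using that S1 comm by (induction j) auto
  have "has_partials (D i j) (D (Suc i) j) (D i (Suc j))" for i j
  proof -
    have "D i j \<in> S" unfolding D_def using S1 \<open>f \<in> S\<close> by simp
    then have "has_partials (D i j) (px (D i j)) (py (D i j))" using p by blast
    moreover have "px (D i j) = D (Suc i) j"
      unfolding D_def using c2[of "(px ^^ i) f" j] S1 \<open>f \<in> S\<close> by simp
    ultimately show ?thesis by (simp add: D_def)
  qed
  then show ?thesis
    unfolding smooth_def has_partials_def by (intro exI[of _ D]) (simp add: D_def)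
qed

text \<open>The members of the jet \<open>D\<close> form a set closed under partials, so each of
  them is smooth in its own right.\<close>

lemma smooth_partials:
  assumes "smooth f"
  obtains fx fy where "has_partials f fx fy" "smooth fx" "smooth fy"
proof -
  obtain D where D: "D 0 0 = f" "\<And>i j. has_partials (D i j) (D (Suc i) j) (D i (Suc j))"
    using assms unfolding smooth_def has_partials_def by blast
  have "smooth (D i j)" for i j
    by (rule smooth_coinduct[of "range (\<lambda>(i, j). D i j)"]) (use D(2) in force)+
  then show ?thesis using that D by metis
qed

inductive_set ring_closure :: "(complex \<Rightarrow> real) set \<Rightarrow> (complex \<Rightarrow> real) set" for A where
  base: "f \<in> A \<Longrightarrow> f \<in> ring_closure A"
| const: "(\<lambda>_. c) \<in> ring_closure A"
| add: "f \<in> ring_closure A \<Longrightarrow> g \<in> ring_closure A \<Longrightarrow> (\<lambda>z. f z + g z) \<in> ring_closure A"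
| mult: "f \<in> ring_closure A \<Longrightarrow> g \<in> ring_closure A \<Longrightarrow> (\<lambda>z. f z * g z) \<in> ring_closure A"

lemma partials_inI:
  "has_partials f fx fy \<Longrightarrow> fx \<in> S \<Longrightarrow> fy \<in> S \<Longrightarrow> \<exists>fx\<in>S. \<exists>fy\<in>S. has_partials f fx fy"
  by blast

text \<open>The partials of a generator are usually polynomial expressions in the generators, not
  generators. By the Leibniz rule the generated ring is closed under partials as soon as the
  generators have theirs in it, and then coinduction applies.\<close>

lemma smooth_ring_closure:
  assumes "\<And>f. f \<in> A \<Longrightarrow> \<exists>fx\<in>ring_closure A. \<exists>fy\<in>ring_closure A. has_partials f fx fy"
    and "f \<in> ring_closure A"
  shows "smooth f"
proof (rule smooth_coinduct[OF _ assms(2)])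
  fix f assume "f \<in> ring_closure A"
  then show "\<exists>fx\<in>ring_closure A. \<exists>fy\<in>ring_closure A. has_partials f fx fy"
  proof induction
    case (base f) then show ?case using assms(1) by blast
  next
    case (const c) show ?case using has_partials_const ring_closure.const by blast
  next
    case (add f g)
    then obtain fx fy gx gy where "has_partials f fx fy" "has_partials g gx gy"
      and r: "fx \<in> ring_closure A" "fy \<in> ring_closure A" "gx \<in> ring_closure A" "gy \<in> ring_closure A" by blast
    show ?case
      by (rule partials_inI[OF has_partials_add[OF \<open>has_partials f fx fy\<close> \<open>has_partials g gx gy\<close>]])
         (intro ring_closure.add r)+
  next
    case (mult f g)
    then obtain fx fy gx gy where "has_partials f fx fy" "has_partials g gx gy"
      and r: "fx \<in> ring_closure A" "fy \<in> ring_closure A" "gx \<in> ring_closure A" "gy \<in> ring_closure A" by blast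
    show ?case
      by (rule partials_inI[OF has_partials_mult[OF \<open>has_partials f fx fy\<close> \<open>has_partials g gx gy\<close>]])
         (intro ring_closure.add ring_closure.mult r mult.hyps)+
  qed
qed

lemma smooth_ring_closure_smooth: "f \<in> ring_closure (Collect smooth) \<Longrightarrow> smooth f"
  by (rule smooth_ring_closure[of "Collect smooth"]) (metis mem_Collect_eq ring_closure.base smooth_partials)

lemma smooth_const: "smooth (\<lambda>_. c)"
  by (intro smooth_ring_closure_smooth ring_closure.intros)

lemma smooth_add: "smooth f \<Longrightarrow> smooth g \<Longrightarrow> smooth (\<lambda>z. f z + g z)"
  by (intro smooth_ring_closure_smooth ring_closure.add) (auto intro: ring_closure.base)

lemma smooth_mult: "smooth f \<Longrightarrow> smooth g \<Longrightarrow> smooth (\<lambda>z. f z * g z)"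
  by (intro smooth_ring_closure_smooth ring_closure.mult) (auto intro: ring_closure.base)

lemma smooth_diff: "smooth f \<Longrightarrow> smooth g \<Longrightarrow> smooth (\<lambda>z. f z - g z)"
  using smooth_add[OF _ smooth_mult[OF smooth_const[of "-1"]], of f g] by simp

lemma smooth_Re: "smooth Re" and smooth_Im: "smooth Im"
proof -
  have "smooth f" if "f \<in> {Re, Im}" for f
  proof (rule smooth_ring_closure[of "{Re, Im}"])
    fix g assume "g \<in> {Re, Im}"
    then have "has_partials g (\<lambda>_. 1) (\<lambda>_. 0) \<or> has_partials g (\<lambda>_. 0) (\<lambda>_. 1)"
      using has_partials_Re has_partials_Im by blast
    then show "\<exists>fx\<in>ring_closure {Re, Im}. \<exists>fy\<in>ring_closure {Re, Im}. has_partials g fx fy"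
      using ring_closure.const by meson
  qed (use that in \<open>rule ring_closure.base\<close>)
  then show "smooth Re" "smooth Im" by simp_all
qed

lemma smooth_affine:
  assumes "smooth f"
  shows "smooth (\<lambda>w. f (of_real k * w + c))"
proof (rule smooth_ring_closure[of "(\<lambda>f w. f (of_real k * w + c)) ` Collect smooth"])
  fix g assume "g \<in> (\<lambda>f w. f (of_real k * w + c)) ` Collect smooth"
  then obtain f where f: "smooth f" "g = (\<lambda>w. f (of_real k * w + c))" by auto
  obtain fx fy where "has_partials f fx fy" "smooth fx" "smooth fy" using f smooth_partials by blast
  then show "\<exists>fx\<in>ring_closure ((\<lambda>f w. f (of_real k * w + c)) ` Collect smooth).
             \<exists>fy\<in>ring_closure ((\<lambda>f w. f (of_real k * w + c)) ` Collect smooth). has_partials g fx fy"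
    unfolding f(2)
    by (intro partials_inI[OF has_partials_affine[of f fx fy k c]] ring_closure.mult[OF ring_closure.const]
          ring_closure.base imageI) auto
qed (use assms in \<open>blast intro: ring_closure.base\<close>)

text \<open>Adjoining 1/v and ln v to the smooth functions gives a family to which the ring
  criterion applies: their partials are -(1/v)^2 and 1/v times the partials of v.\<close>

lemma smooth_ln:
  assumes v: "smooth v" "\<And>z. v z > 0"
  shows "smooth (\<lambda>z. ln (v z))"
proof (rule smooth_ring_closure[of "Collect smooth \<union> {\<lambda>z. inverse (v z), \<lambda>z. ln (v z)}"])
  obtain vx vy where vp: "has_partials v vx vy" "smooth vx" "smooth vy" using v(1) by (rule smooth_partials)
  let ?A = "Collect smooth \<union> {\<lambda>z. inverse (v z), \<lambda>z. ln (v z)}"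
  have i: "has_partials (\<lambda>z. inverse (v z)) (\<lambda>z. - (inverse (v z))\<^sup>2 * vx z) (\<lambda>z. - (inverse (v z))\<^sup>2 * vy z)"
    by (rule has_partials_chain[OF vp(1)]) (use v(2) in \<open>auto intro!: derivative_eq_intros simp: power2_eq_square less_imp_neq[symmetric] field_simps\<close>)
  have l: "has_partials (\<lambda>z. ln (v z)) (\<lambda>z. inverse (v z) * vx z) (\<lambda>z. inverse (v z) * vy z)"
    by (rule has_partials_chain[OF vp(1)]) (use v(2) in \<open>auto intro!: derivative_eq_intros simp: field_simps\<close>)
  have b: "(\<lambda>z. inverse (v z)) \<in> ring_closure ?A" "vx \<in> ring_closure ?A" "vy \<in> ring_closure ?A"
    using vp by (auto intro: ring_closure.base)
  have b2: "(\<lambda>z. - (inverse (v z))\<^sup>2 * w z) \<in> ring_closure ?A" if "w \<in> ring_closure ?A" for w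
  proof -
    have "(\<lambda>z. (-1 * (inverse (v z) * inverse (v z))) * w z) \<in> ring_closure ?A"
      by (intro ring_closure.mult[OF _ that] ring_closure.mult[OF ring_closure.const] ring_closure.mult b(1))
    then show ?thesis by (simp add: power2_eq_square)
  qed
  fix f assume "f \<in> ?A"
  then consider "smooth f" | "f = (\<lambda>z. inverse (v z))" | "f = (\<lambda>z. ln (v z))" by blast
  then show "\<exists>fx\<in>ring_closure ?A. \<exists>fy\<in>ring_closure ?A. has_partials f fx fy"
  proof cases
    case 1
    then obtain fx fy where "has_partials f fx fy" "smooth fx" "smooth fy" by (rule smooth_partials)
    then show ?thesis by (blast intro: ring_closure.base)
  next
    case 2 then show ?thesis using i b2[OF b(2)] b2[OF b(3)] by blast
  next
    case 3 then show ?thesis using l ring_closure.mult[OF b(1) b(2)] ring_closure.mult[OF b(1) b(3)] by blast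
  qed
qed (blast intro: ring_closure.base)

section \<open>The flat exponential, a bump function and the smoothed logarithm\<close>

definition exp_bump :: "real poly \<Rightarrow> real \<Rightarrow> real" where
  "exp_bump p x = (if x > 0 then poly p (1 / x) * exp (- (1 / x)) else 0)"

text \<open>The free power \<open>y ^ k\<close> makes the induction on the polynomial go through,
  since \<open>pCons\<close> multiplies the remaining polynomial by y.\<close>

lemma poly_exp_decay:
  fixes p :: "real poly"
  shows "((\<lambda>y. y ^ k * poly p y * exp (- y)) \<longlongrightarrow> 0) at_top"
proof (induction p arbitrary: k)
  case 0 then show ?case by simp
next
  case (pCons a p)
  have "((\<lambda>y::real. y ^ k * exp (- y)) \<longlongrightarrow> 0) at_top"
    using tendsto_power_div_exp_0[of k] by (simp add: exp_minus divide_inverse)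
  then have "((\<lambda>y. a * (y ^ k * exp (- y)) + y ^ Suc k * poly p y * exp (- y)) \<longlongrightarrow> a * 0 + 0) at_top"
    by (intro tendsto_intros pCons.IH)
  then show ?case by (simp add: algebra_simps)
qed

text \<open>With y = 1/x one has d/dx = -y^2 d/dy, and p(y) e^(-y) goes to y^2 (p - p')(y) e^(-y);
  \<open>[:0, 0, 1:]\<close> is y^2. The polynomial parameter thus makes the family closed under
  differentiation, across the gluing point 0 as well.\<close>

lemma exp_bump_DERIV:
  "(exp_bump p has_real_derivative exp_bump ([:0, 0, 1:] * (p - pderiv p)) x) (at x)"
proof -
  consider "x < 0" | "x = 0" | "x > 0" by linarith
  then show ?thesis
  proof cases
    case 1
    have "((\<lambda>_. 0) has_real_derivative 0) (at x)" by simp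
    then have "(exp_bump p has_real_derivative 0) (at x)"
      by (rule has_field_derivative_transform_within_open[of _ _ _ "{..<0}"]) (use 1 in \<open>auto simp: exp_bump_def\<close>)
    then show ?thesis using 1 by (simp add: exp_bump_def)
  next
    case 3
    have "((\<lambda>x. poly p (1 / x) * exp (- (1 / x))) has_real_derivative
        exp_bump ([:0, 0, 1:] * (p - pderiv p)) x) (at x)"
      unfolding exp_bump_def using 3
      by (auto intro!: derivative_eq_intros DERIV_chain2[OF poly_DERIV] simp: field_simps power2_eq_square)
    then show ?thesis
      by (rule has_field_derivative_transform_within_open[of _ _ _ "{0<..}"]) (use 3 in \<open>auto simp: exp_bump_def\<close>)
  next
    case 2
    \<comment> \<open>The right difference quotient at 0 is y p(y) e^(-y) with y = 1/h, which
      accounts for the exponent 1.\<close>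
    have "((\<lambda>h. (1 / h) ^ 1 * poly p (1 / h) * exp (- (1 / h))) \<longlongrightarrow> 0) (at_right 0)"
      using poly_exp_decay[of 1 p] by (rule filterlim_compose) (simp add: filterlim_inverse_at_top_right divide_inverse)
    then have "((\<lambda>h. (exp_bump p (0 + h) - exp_bump p 0) / h) \<longlongrightarrow> 0) (at_right 0)"
      by (rule Lim_transform_eventually)
         (auto simp: eventually_at_filter exp_bump_def)
    moreover have "((\<lambda>h. (exp_bump p (0 + h) - exp_bump p 0) / h) \<longlongrightarrow> 0) (at_left 0)"
      by (rule Lim_transform_eventually[OF tendsto_const]) (auto simp: eventually_at_filter exp_bump_def)
    ultimately have "((\<lambda>h. (exp_bump p (0 + h) - exp_bump p 0) / h) \<longlongrightarrow> 0) (at 0)"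
      by (rule filterlim_split_at[rotated])
    then show ?thesis using 2 by (simp add: DERIV_def exp_bump_def)
  qed
qed

definition bump :: "complex \<Rightarrow> real" where
  "bump z = exp_bump 1 (1 - (norm z)\<^sup>2)"

lemma smooth_norm2: "smooth (\<lambda>z. (norm z)\<^sup>2)"
  unfolding cmod_power2 unfolding power2_eq_square by (intro smooth_add smooth_mult smooth_Re smooth_Im)

lemma smooth_bump: "smooth bump"
proof -
  define A where "A = Collect smooth \<union> range (\<lambda>p z. exp_bump p (1 - (norm z)\<^sup>2))"
  have "smooth (\<lambda>z. 1 - (norm z)\<^sup>2)" by (intro smooth_diff smooth_const smooth_norm2)
  then obtain vx vy where v: "has_partials (\<lambda>z. 1 - (norm z)\<^sup>2) vx vy" "smooth vx" "smooth vy"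
    by (rule smooth_partials)
  have "\<exists>fx\<in>ring_closure A. \<exists>fy\<in>ring_closure A. has_partials f fx fy" if "f \<in> A" for f
  proof -
    consider "smooth f" | p where "f = (\<lambda>z. exp_bump p (1 - (norm z)\<^sup>2))" using \<open>f \<in> A\<close> by (auto simp: A_def)
    then show ?thesis
    proof cases
      case 1
      then obtain fx fy where "has_partials f fx fy" "smooth fx" "smooth fy" by (rule smooth_partials)
      then show ?thesis by (auto intro!: bexI ring_closure.base simp: A_def)
    next
      case 2
      have m: "(\<lambda>z. exp_bump q (1 - (norm z)\<^sup>2) * w z) \<in> ring_closure A" if "smooth w" for w q
        by (rule ring_closure.mult) (use that in \<open>auto intro!: ring_closure.base simp: A_def\<close>)
      from has_partials_chain[OF v(1) exp_bump_DERIV[of p]] show ?thesis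
        unfolding 2 using m[OF v(2)] m[OF v(3)] by blast
    qed
  qed
  moreover have "bump \<in> ring_closure A"
    by (rule ring_closure.base) (auto simp: A_def bump_def[abs_def])
  ultimately show ?thesis using smooth_ring_closure by blast
qed

definition log_smoothed :: "complex \<Rightarrow> real" where
  "log_smoothed z = ln ((norm z)\<^sup>2 + bump z) / 2"

text \<open>At the origin the bump has the value e^(-1), elsewhere |z|^2 is already positive; so
  adding the bump removes the logarithmic singularity.\<close>

lemma norm2_bump_pos: "(norm z)\<^sup>2 + bump z > 0"
  by (cases "z = 0") (auto simp: bump_def exp_bump_def add_pos_nonneg)

lemma smooth_log_smoothed: "smooth log_smoothed"
  unfolding log_smoothed_def[abs_def] divide_inverse
  by (intro smooth_mult smooth_const smooth_ln smooth_add smooth_norm2 smooth_bump norm2_bump_pos)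

lemma log_smoothed_outside: "norm z \<ge> 1 \<Longrightarrow> log_smoothed z = ln (norm z)"
proof -
  assume "norm z \<ge> 1"
  then have "\<not> 1 - (norm z)\<^sup>2 > 0" using one_le_power[of "norm z" 2] by linarith
  with \<open>norm z \<ge> 1\<close> show ?thesis
    unfolding log_smoothed_def bump_def exp_bump_def by (simp add: ln_realpow)
qed

section \<open>Logarithmic polar coordinates\<close>

text \<open>A linear bijection of the bases pulls boxes back to boxes with the same side lengths,
  and boxes determine Lebesgue measure. This serves to move between \<open>real^2\<close>, where the
  change of variables by a Jacobian determinant takes place, and the types \<open>complex\<close>
  and \<open>real \<times> real\<close>.\<close>

lemma lborel_distr_basis_iso:
  fixes j :: "'a::euclidean_space \<Rightarrow> 'b::euclidean_space"
  assumes j: "linear j" and bij: "bij_betw j Basis Basis"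
  shows "distr lborel borel j = lborel"
proof (rule lborel_eqI[symmetric])
  have [measurable]: "j \<in> borel_measurable borel"
    using linear_continuous_on[OF j[unfolded linear_conv_bounded_linear]] by (rule borel_measurable_continuous_onI)
  have inj: "inj_on j Basis" and im: "j ` Basis = Basis" using bij by (auto simp: bij_betw_def)
  have inn: "j x \<bullet> j b = x \<bullet> b" if b: "b \<in> Basis" for x b
  proof -
    have "j x = j (\<Sum>c\<in>Basis. (x \<bullet> c) *\<^sub>R c)" by (simp add: euclidean_representation)
    also have "\<dots> = (\<Sum>c\<in>Basis. (x \<bullet> c) *\<^sub>R j c)" using j by (simp add: linear_sum linear_scale)
    finally have "j x \<bullet> j b = (\<Sum>c\<in>Basis. (x \<bullet> c) * (j c \<bullet> j b))" by (simp add: inner_sum_left)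
    also have "\<dots> = (\<Sum>c\<in>Basis. if c = b then x \<bullet> c else 0)"
    proof (rule sum.cong)
      fix c :: 'a assume c: "c \<in> Basis"
      then have "j c \<in> Basis" "j b \<in> Basis" using b im by blast+
      then show "(x \<bullet> c) * (j c \<bullet> j b) = (if c = b then x \<bullet> c else 0)"
        using inj_on_eq_iff[OF inj c b] by (simp add: inner_Basis)
    qed simp
    finally show ?thesis using b by simp
  qed
  fix l u :: 'b assume le: "\<And>b. b \<in> Basis \<Longrightarrow> l \<bullet> b \<le> u \<bullet> b"
  define l' u' where "l' = (\<Sum>b\<in>Basis. (l \<bullet> j b) *\<^sub>R b)" and "u' = (\<Sum>b\<in>Basis. (u \<bullet> j b) *\<^sub>R b)"
  have l': "l' \<bullet> b = l \<bullet> j b" "u' \<bullet> b = u \<bullet> j b" if "b \<in> Basis" for b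
    using that by (simp_all add: l'_def u'_def)
  have "j -` box l u = box l' u'"
    unfolding box_def using l' inn im by (auto simp flip: im)
  then have "emeasure (distr lborel borel j) (box l u) = emeasure lborel (box l' u')"
    by (simp add: emeasure_distr)
  also have "\<dots> = (\<Prod>b\<in>Basis. (u' - l') \<bullet> b)"
  proof (rule emeasure_lborel_box)
    fix b :: 'a assume b: "b \<in> Basis"
    then have "j b \<in> Basis" using im by blast
    then show "l' \<bullet> b \<le> u' \<bullet> b" using l'[OF b] le by simp
  qed
  also have "(\<Prod>b\<in>Basis. (u' - l') \<bullet> b) = (\<Prod>b\<in>Basis. (u - l) \<bullet> j b)"
    by (rule prod.cong) (auto simp: l' inner_diff_left)
  also have "\<dots> = (\<Prod>b\<in>Basis. (u - l) \<bullet> b)"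
    using prod.reindex_bij_betw[OF bij] by simp
  finally show "emeasure (distr lborel borel j) (box l u) = (\<Prod>b\<in>Basis. (u - l) \<bullet> b)" .
qed simp

lemma Basis_real2: "(Basis :: (real^2) set) = {axis 1 1, axis 2 1}"
  by (auto simp: Basis_vec_def UNIV_2)

lemma lborel_real2_complex: "distr lborel borel (\<lambda>v::real^2. Complex (v$1) (v$2)) = lborel"
proof (rule lborel_distr_basis_iso)
  show "linear (\<lambda>v::real^2. Complex (v$1) (v$2))"
    by (rule linearI) (auto simp: complex_eq_iff)
  show "bij_betw (\<lambda>v::real^2. Complex (v$1) (v$2)) Basis Basis"
    by (auto simp: bij_betw_def inj_on_def Basis_real2 Basis_complex_def axis_def complex_eq_iff vec_eq_iff)
qed

lemma lborel_real2_pair: "distr lborel borel (\<lambda>v::real^2. (v$1, v$2)) = lborel"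
proof (rule lborel_distr_basis_iso)
  show "linear (\<lambda>v::real^2. (v$1, v$2))"
    by (rule linearI) auto
  show "bij_betw (\<lambda>v::real^2. (v$1, v$2)) Basis Basis"
    by (auto simp: bij_betw_def inj_on_def Basis_real2 Basis_prod_def axis_def vec_eq_iff)
qed

section \<open>The change of variables to logarithmic polar coordinates\<close>

abbreviation lborel2 :: "('a::euclidean_space \<times> 'b::euclidean_space) measure" where
  "lborel2 \<equiv> lborel \<Otimes>\<^sub>M lborel"

abbreviation arc :: "real \<Rightarrow> real" where
  "arc \<equiv> indicator {0<..<2*pi}"

definition log_polar :: "real \<times> real \<Rightarrow> complex" where
  "log_polar p = of_real (exp (fst p)) * cis (snd p)"

lemma Re_log_polar [simp]: "Re (log_polar p) = exp (fst p) * cos (snd p)"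
  and Im_log_polar [simp]: "Im (log_polar p) = exp (fst p) * sin (snd p)"
  and norm_log_polar [simp]: "norm (log_polar p) = exp (fst p)"
  by (auto simp: log_polar_def norm_mult)

lemma Arg2pi_log_polar: "0 \<le> snd p \<Longrightarrow> snd p < 2 * pi \<Longrightarrow> Arg2pi (log_polar p) = snd p"
  by (rule Arg2pi_unique[of "exp (fst p)"]) (auto simp: log_polar_def cis_conv_exp)

lemma log_polar_surj: "z \<noteq> 0 \<Longrightarrow> z = log_polar (ln (norm z), Arg2pi z)"
  using Arg2pi_eq[of z] by (simp add: log_polar_def cis_conv_exp)

lemma log_polar_measurable [measurable]: "log_polar \<in> borel_measurable borel"
  unfolding log_polar_def[abs_def] cis_conv_exp
  by (intro borel_measurable_continuous_onI continuous_intros)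

text \<open>Change of variables in \<open>real^2\<close> for (t, psi) to e^t (cos psi, sin psi),
  with Jacobian e^(2t). The open angle interval makes the map injective at the price of a missing
  half-line.\<close>

lemma emeasure_log_polar_box:
  fixes l u :: complex
  shows "(\<integral>\<^sup>+p. ennreal (exp (2 * fst p)) * indicator {p. snd p \<in> {0<..<2*pi} \<and> log_polar p \<in> box l u} p \<partial>(lborel :: (real \<times> real) measure))
    = emeasure lborel (box l u)"
proof -
  define S where "S = {p::real \<times> real. snd p \<in> {0<..<2*pi} \<and> log_polar p \<in> box l u}"
  have Sb [measurable]: "S \<in> sets borel"
  proof -
    have "S = snd -` {0<..<2*pi} \<inter> log_polar -` box l u" by (auto simp: S_def)
    moreover have "open (snd -` {0<..<2*pi::real} :: (real \<times> real) set)"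
      by (intro open_vimage_snd open_greaterThanLessThan)
    moreover have "log_polar -` box l u \<in> sets borel"
      using measurable_sets[OF log_polar_measurable, of "box l u"] by simp
    ultimately show ?thesis by auto
  qed
  define P where "P = (\<lambda>v::real^2. (v$1, v$2))"
  define C where "C = (\<lambda>v::real^2. Complex (v$1) (v$2))"
  have [measurable]: "P \<in> borel_measurable borel" "C \<in> borel_measurable borel"
    unfolding P_def C_def Complex_eq by (intro borel_measurable_continuous_onI continuous_intros)+
  define g where "g = (\<lambda>v::real^2. vector [exp (v$1) * cos (v$2), exp (v$1) * sin (v$2)] :: real^2)"
  define g' where "g' = (\<lambda>(v::real^2) (h::real^2).
     vector [exp (v$1) * cos (v$2) * h$1 - exp (v$1) * sin (v$2) * h$2,
             exp (v$1) * sin (v$2) * h$1 + exp (v$1) * cos (v$2) * h$2] :: real^2)"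
  have Cg: "C (g v) = log_polar (P v)" for v
    by (simp add: C_def g_def P_def complex_eq_iff)
  have der: "(g has_derivative g' v) (at v within X)" for v X
  proof -
    have "((\<lambda>v. g v $ i) has_derivative (\<lambda>h. g' v h $ i)) (at v within X)" for i
      using exhaust_2[of i] unfolding g_def g'_def
      by (auto intro!: derivative_eq_intros bounded_linear_imp_has_derivative bounded_linear_vec_nth simp: algebra_simps)
    then show ?thesis by (subst has_derivative_componentwise_within) (auto simp: Basis_real2 inner_axis)
  qed
  have det: "\<bar>det (matrix (g' v))\<bar> = exp (2 * v$1)" for v
  proof -
    have "det (matrix (g' v)) = (exp (v$1))\<^sup>2 * (cos (v$2))\<^sup>2 + (exp (v$1))\<^sup>2 * (sin (v$2))\<^sup>2"
      unfolding det_2 matrix_def g'_def by (simp add: axis_def power2_eq_square algebra_simps)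
    then show ?thesis by (simp add: distrib_left[symmetric] exp_double)
  qed
  have inj: "inj_on g (P -` S)"
  proof (rule inj_onI)
    fix v w assume v: "v \<in> P -` S" "w \<in> P -` S" "g v = g w"
    then have e: "log_polar (P v) = log_polar (P w)" by (metis Cg)
    have "Arg2pi (log_polar (P v)) = snd (P v)" "Arg2pi (log_polar (P w)) = snd (P w)"
      using v by (auto intro!: Arg2pi_log_polar simp: S_def)
    moreover have "norm (log_polar (P v)) = exp (fst (P v))" "norm (log_polar (P w)) = exp (fst (P w))" by simp_all
    ultimately have "P v = P w" using e by (auto simp: prod_eq_iff)
    then show "v = w" by (auto simp: P_def vec_eq_iff forall_2)
  qed
  have PS: "P -` S \<in> sets borel" using measurable_sets[OF _ Sb, of P borel] by simp
  \<comment> \<open>Angles strictly between 0 and 2 pi reach every point off the nonnegative real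
    axis. The missing half-line contains the origin and lies in a hyperplane, so it is null.\<close>
  have im: "g ` (P -` S) = C -` box l u - {v. v$2 = 0 \<and> v$1 \<ge> 0}" (is "?L = ?R")
  proof (intro set_eqI iffI)
    fix v assume "v \<in> ?L"
    then obtain w where "w \<in> P -` S" "v = g w" by blast
    then have w: "P w \<in> S" "v = g w" by simp_all
    have "C v \<in> box l u" using w Cg by (simp add: S_def)
    moreover have "\<not> (v$2 = 0 \<and> v$1 \<ge> 0)"
    proof
      assume "v$2 = 0 \<and> v$1 \<ge> 0"
      then have "Arg2pi (C v) = 0" by (simp add: Arg2pi_eq_0 C_def complex_is_Real_iff)
      then show False using Arg2pi_log_polar[of "P w"] w Cg by (auto simp: S_def)
    qed
    ultimately show "v \<in> ?R" by simp
  next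
    fix v assume v: "v \<in> ?R"
    define z where "z = C v"
    have nz: "z \<noteq> 0" "Arg2pi z \<noteq> 0" using v by (auto simp: z_def C_def complex_eq_iff Arg2pi_eq_0 complex_is_Real_iff)
    define w where "w = (vector [ln (norm z), Arg2pi z] :: real^2)"
    have "log_polar (P w) = z" using log_polar_surj[OF nz(1)] by (simp add: P_def w_def)
    then have "C (g w) = C v" using Cg z_def by simp
    then have "g w = v" by (simp add: C_def complex_eq_iff vec_eq_iff forall_2)
    moreover have "P w \<in> S"
      using v nz Arg2pi_ge_0[of z] Arg2pi_lt_2pi[of z] \<open>log_polar (P w) = z\<close>
      by (auto simp: S_def P_def w_def z_def)
    ultimately show "v \<in> ?L" by blast
  qed
  have Cdist: "emeasure lborel (C -` box l u) = emeasure lborel (box l u)"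
    using emeasure_distr[of C lborel borel "box l u"] lborel_real2_complex[folded C_def] by simp
  have CB: "C -` box l u \<in> sets borel" using measurable_sets[of C borel borel "box l u"] by simp
  have neg: "{v::real^2. v$2 = 0 \<and> v$1 \<ge> 0} \<in> null_sets lebesgue"
    unfolding negligible_iff_null_sets[symmetric]
    by (rule negligible_subset[OF negligible_standard_hyperplane_cart[of 2]]) auto
  have em: "emeasure lebesgue (g ` (P -` S)) = emeasure lborel (box l u)"
    unfolding im using CB by (subst emeasure_Diff_null_set[OF neg]) (auto simp: Cdist)
  have "g ` (P -` S) \<in> lmeasurable"
    unfolding fmeasurable_def
  proof (intro CollectI conjI)
    show "g ` (P -` S) \<in> sets lebesgue" unfolding im using CB neg by (auto simp: null_sets_def)
    show "emeasure lebesgue (g ` (P -` S)) < \<infinity>" unfolding em using emeasure_lborel_box_finite by auto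
  qed
  then have "((\<lambda>v. \<bar>det (matrix (g' v))\<bar>) has_integral measure lebesgue (g ` (P -` S))) (P -` S)"
    using has_measure_differentiable_image[OF _ der inj, of "measure lebesgue (g ` (P -` S))"] PS by auto
  from nn_integral_has_integral_lebesgue'[OF _ this]
  have "(\<integral>\<^sup>+v. ennreal (exp (2 * v$1)) * indicator (P -` S) v \<partial>lborel) = ennreal (measure lebesgue (g ` (P -` S)))"
    by (simp add: det)
  also have "\<dots> = emeasure lborel (box l u)"
    using \<open>g ` (P -` S) \<in> lmeasurable\<close> by (simp add: em[symmetric] emeasure_eq_measure2 fmeasurableD2 emeasure_eq_ennreal_measure)
  also have "(\<integral>\<^sup>+v. ennreal (exp (2 * v$1)) * indicator (P -` S) v \<partial>lborel) =
      (\<integral>\<^sup>+p. ennreal (exp (2 * fst p)) * indicator S p \<partial>distr lborel borel P)"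
  proof -
    have [measurable]: "fst \<in> borel_measurable (borel :: (real \<times> real) measure)"
      by (intro borel_measurable_continuous_onI continuous_intros)
    have "(\<integral>\<^sup>+p. ennreal (exp (2 * fst p)) * indicator S p \<partial>distr lborel borel P)
      = (\<integral>\<^sup>+v. ennreal (exp (2 * fst (P v))) * indicator S (P v) \<partial>lborel)"
      by (rule nn_integral_distr) measurable
    also have "\<dots> = (\<integral>\<^sup>+v. ennreal (exp (2 * v$1)) * indicator (P -` S) v \<partial>lborel)"
      by (simp add: P_def indicator_def)
    finally show ?thesis ..
  qed
  also have "distr lborel borel P = lborel" unfolding P_def by (rule lborel_real2_pair)
  finally show ?thesis unfolding S_def .
qed

lemma log_polar_weight_measurable [measurable]:
  "(\<lambda>p. exp (2 * fst p) * arc (snd p) :: real) \<in> borel_measurable borel"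
  by (subst borel_prod[symmetric]) measurable

definition log_polar_measure :: "(real \<times> real) measure" where
  "log_polar_measure = density lborel2 (\<lambda>p. ennreal (exp (2 * fst p) * arc (snd p)))"

text \<open>Agreement on boxes suffices. In this push-forward form, integrals of nonnegative
  functions, integrability and Bochner integrals all transfer by the rules for \<open>distr\<close>
  and \<open>density\<close>.\<close>

lemma lborel_log_polar: "lborel = distr log_polar_measure borel log_polar"
proof (rule lborel_eqI)
  fix l u :: complex assume le: "\<And>b. b \<in> Basis \<Longrightarrow> l \<bullet> b \<le> u \<bullet> b"
  have m: "log_polar \<in> borel_measurable log_polar_measure"
    by (simp add: log_polar_measure_def lborel_prod cong: measurable_cong_sets)
  have "emeasure (distr log_polar_measure borel log_polar) (box l u) = emeasure log_polar_measure (log_polar -` box l u)"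
    by (subst emeasure_distr[OF m]) (auto simp: log_polar_measure_def lborel_prod space_pair_measure)
  also have "\<dots> = (\<integral>\<^sup>+p. ennreal (exp (2 * fst p) * arc (snd p)) * indicator (log_polar -` box l u) p \<partial>lborel)"
    unfolding log_polar_measure_def lborel_prod
    by (rule emeasure_density) (use measurable_sets[OF log_polar_measurable, of "box l u"] in \<open>auto intro: log_polar_weight_measurable\<close>)
  also have "\<dots> = (\<integral>\<^sup>+p. ennreal (exp (2 * fst p)) * indicator {p. snd p \<in> {0<..<2*pi} \<and> log_polar p \<in> box l u} p \<partial>lborel)"
    by (rule nn_integral_cong) (auto simp: indicator_def)
  finally show "emeasure (distr log_polar_measure borel log_polar) (box l u) = (\<Prod>b\<in>Basis. (u - l) \<bullet> b)"
    unfolding emeasure_log_polar_box using emeasure_lborel_box[OF le] by simp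
qed simp

lemma log_polar_measurable' [measurable]: "log_polar \<in> log_polar_measure \<rightarrow>\<^sub>M borel"
  by (simp add: log_polar_measure_def lborel_prod cong: measurable_cong_sets)

lemma nn_integral_log_polar:
  fixes f :: "complex \<Rightarrow> ennreal"
  assumes [measurable]: "f \<in> borel_measurable borel"
  shows "(\<integral>\<^sup>+z. f z \<partial>lborel) =
    (\<integral>\<^sup>+p. ennreal (exp (2 * fst p) * arc (snd p)) * f (log_polar p) \<partial>lborel2)"
  by (subst lborel_log_polar, subst nn_integral_distr, simp_all add: log_polar_measure_def lborel_prod)
     (subst nn_integral_density, simp_all)

lemma
  fixes f :: "complex \<Rightarrow> 'b::{banach, second_countable_topology}"
  assumes [measurable]: "f \<in> borel_measurable borel"
  shows integrable_log_polar: "integrable lborel f \<longleftrightarrow>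
    integrable lborel2 (\<lambda>p. (exp (2 * fst p) * arc (snd p)) *\<^sub>R f (log_polar p))"
  and integral_log_polar: "(LBINT z. f z) =
    (LINT p|lborel2. (exp (2 * fst p) * arc (snd p)) *\<^sub>R f (log_polar p))"
proof -
  show "integrable lborel f \<longleftrightarrow>
    integrable lborel2 (\<lambda>p. (exp (2 * fst p) * arc (snd p)) *\<^sub>R f (log_polar p))"
    by (subst lborel_log_polar, subst integrable_distr_eq, simp_all add: log_polar_measure_def lborel_prod)
       (subst integrable_density, simp_all)
  show "(LBINT z. f z) =
    (LINT p|lborel2. (exp (2 * fst p) * arc (snd p)) *\<^sub>R f (log_polar p))"
    by (subst lborel_log_polar, subst integral_distr, simp_all add: log_polar_measure_def lborel_prod)
       (subst integral_density, simp_all)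
qed

section \<open>The angle function: measurability and null sets\<close>

lemma Arg2pi_measurable [measurable]: "Arg2pi \<in> borel_measurable borel"
proof -
  \<comment> \<open>\<open>Arg2pi\<close> is continuous off the closed half-line of nonnegative
    reals and constantly 0 on it.\<close>
  have "(\<lambda>z. if z \<in> \<real>\<^sub>\<ge>\<^sub>0 then 0 else Arg2pi z) \<in> borel_measurable borel"
    by (intro borel_measurable_continuous_on_if borel_closed closed_nonneg_Reals_complex continuous_on_const
          continuous_at_imp_continuous_on ballI continuous_at_Arg2pi) auto
  also have "(\<lambda>z. if z \<in> \<real>\<^sub>\<ge>\<^sub>0 then 0 else Arg2pi z) = Arg2pi"
    by (auto simp: fun_eq_iff Arg2pi_eq_0 complex_nonneg_Reals_iff complex_is_Real_iff)
  finally show ?thesis .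
qed

text \<open>A null set of angles sweeps out a null cone, by integrating its indicator in polar
  coordinates. It turns a statement about almost every direction on the circle into one about almost
  every point of the plane.\<close>

lemma AE_Arg2pi:
  assumes "AE \<psi> in lborel. 0 < \<psi> \<longrightarrow> \<psi> < 2 * pi \<longrightarrow> P \<psi>"
  shows "AE z in lborel. P (Arg2pi z)"
proof -
  \<comment> \<open>\<open>Arg2pi\<close> does take the value 0, so this endpoint must be included;
    a single angle costs nothing.\<close>
  have "AE \<psi> in lborel. 0 \<le> \<psi> \<longrightarrow> \<psi> < 2 * pi \<longrightarrow> P \<psi>"
    using assms AE_lborel_singleton[of "0::real"] by eventually_elim auto
  then obtain N where N: "{\<psi>. \<not> (0 \<le> \<psi> \<longrightarrow> \<psi> < 2 * pi \<longrightarrow> P \<psi>)} \<subseteq> N" "N \<in> sets borel" "emeasure lborel N = 0"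
    by (auto elim!: AE_E)
  have [measurable]: "N \<in> sets borel" by fact
  have ae: "AE \<psi> in lborel. \<psi> \<notin> N" using N by (intro AE_I[of _ _ N]) auto
  have "(\<integral>\<^sup>+z. indicator N (Arg2pi z) \<partial>lborel) =
    (\<integral>\<^sup>+p. ennreal (exp (2 * fst p) * arc (snd p)) * indicator N (Arg2pi (log_polar p)) \<partial>lborel2)"
    by (rule nn_integral_log_polar) measurable
  also have "\<dots> = (\<integral>\<^sup>+p. ennreal (exp (2 * fst p) * arc (snd p)) * indicator N (snd p) \<partial>lborel2)"
    by (rule nn_integral_cong) (auto simp: indicator_def Arg2pi_log_polar)
  also have "\<dots> = (\<integral>\<^sup>+t. \<integral>\<^sup>+\<psi>. ennreal (exp (2 * t) * arc \<psi>) * indicator N \<psi> \<partial>lborel \<partial>lborel)"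
    by (subst lborel.nn_integral_fst[symmetric]) (auto simp: case_prod_unfold)
  also have "\<dots> = nn_integral lborel (\<lambda>_::real. 0)"
  proof (rule nn_integral_cong)
    fix t :: real
    have "AE \<psi> in lborel. ennreal (exp (2 * t) * arc \<psi>) * indicator N \<psi> = 0"
      using ae by eventually_elim auto
    then show "(\<integral>\<^sup>+\<psi>. ennreal (exp (2 * t) * arc \<psi>) * indicator N \<psi> \<partial>lborel) = 0"
      by (subst nn_integral_0_iff_AE) auto
  qed
  finally have "(\<integral>\<^sup>+z. indicator N (Arg2pi z) \<partial>lborel) = 0" by simp
  then have "AE z in lborel. indicator N (Arg2pi z) = (0::ennreal)"
    by (subst (asm) nn_integral_0_iff_AE) auto
  then show ?thesis
  proof eventually_elim
    case (elim z)
    then show ?case using N(1) Arg2pi_ge_0[of z] Arg2pi_lt_2pi[of z] by (auto simp: indicator_def split: if_splits)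
  qed
qed

section \<open>The Laplacian and its radial and angular parts\<close>

text \<open>The relation \<open>has_partials\<close> is replaced by operators because iterated
  expressions, such as the Laplacian, need the partials as functions of \<open>f\<close>.\<close>

definition px :: "(complex \<Rightarrow> real) \<Rightarrow> complex \<Rightarrow> real" where
  "px f z = frechet_derivative f (at z) 1"

definition py :: "(complex \<Rightarrow> real) \<Rightarrow> complex \<Rightarrow> real" where
  "py f z = frechet_derivative f (at z) \<i>"

lemma has_partials_imp:
  assumes "has_partials f fx fy" shows "px f = fx" "py f = fy"
  using frechet_derivative_at[OF has_partialsD[OF assms], symmetric]
  by (simp_all add: fun_eq_iff px_def py_def)

lemma smooth_has_partials: "smooth f \<Longrightarrow> has_partials f (px f) (py f)"
  by (metis smooth_partials has_partials_imp)

lemma smooth_px: "smooth f \<Longrightarrow> smooth (px f)" and smooth_py: "smooth f \<Longrightarrow> smooth (py f)"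
  by (metis smooth_partials has_partials_imp)+

lemma smooth_continuous: "smooth f \<Longrightarrow> continuous_on S f"
  using has_partials_continuous smooth_has_partials by blast

lemma smooth_measurable [measurable_dest]: "smooth f \<Longrightarrow> f \<in> borel_measurable borel"
  by (intro borel_measurable_continuous_onI smooth_continuous)

lemma px_py_commute: "smooth f \<Longrightarrow> px (py f) = py (px f)"
  by (rule mixed_partials[symmetric]) (auto intro!: smooth_has_partials smooth_px smooth_py smooth_continuous)

lemma laplacian_eq:
  assumes "smooth f"
  shows "laplacian f = (\<lambda>z. px (px f) z + py (py f) z)"
proof
  fix z
  have "deriv (\<lambda>t. f (z + of_real t)) = (\<lambda>t. px f (z + of_real t))"
    by (intro ext DERIV_imp_deriv has_partials_DERIV_x[OF smooth_has_partials] assms)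
  moreover have "deriv (\<lambda>t. px f (z + of_real t)) = (\<lambda>t. px (px f) (z + of_real t))"
    by (intro ext DERIV_imp_deriv has_partials_DERIV_x[OF smooth_has_partials] smooth_px assms)
  moreover have "deriv (\<lambda>t. f (z + \<i> * of_real t)) = (\<lambda>t. py f (z + \<i> * of_real t))"
    by (intro ext DERIV_imp_deriv has_partials_DERIV_y[OF smooth_has_partials] assms)
  moreover have "deriv (\<lambda>t. py f (z + \<i> * of_real t)) = (\<lambda>t. py (py f) (z + \<i> * of_real t))"
    by (intro ext DERIV_imp_deriv has_partials_DERIV_y[OF smooth_has_partials] smooth_py assms)
  ultimately show "laplacian f z = px (px f) z + py (py f) z"
    by (simp add: laplacian_def numeral_2_eq_2)
qed

lemma smooth_laplacian: "smooth f \<Longrightarrow> smooth (laplacian f)"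
  by (simp add: laplacian_eq smooth_add smooth_px smooth_py)

lemma has_partials_diff:
  assumes "has_partials f fx fy" "has_partials g gx gy"
  shows "has_partials (\<lambda>z. f z - g z) (\<lambda>z. fx z - gx z) (\<lambda>z. fy z - gy z)"
  unfolding has_partials_def
  by (auto intro!: derivative_eq_intros has_partialsD[OF assms(1)] has_partialsD[OF assms(2)] simp: algebra_simps)

lemma px_add: "smooth f \<Longrightarrow> smooth g \<Longrightarrow> px (\<lambda>z. f z + g z) = (\<lambda>z. px f z + px g z)"
  and py_add: "smooth f \<Longrightarrow> smooth g \<Longrightarrow> py (\<lambda>z. f z + g z) = (\<lambda>z. py f z + py g z)"
  by (auto intro!: has_partials_imp has_partials_add smooth_has_partials)

lemma px_mult: "smooth f \<Longrightarrow> smooth g \<Longrightarrow> px (\<lambda>z. f z * g z) = (\<lambda>z. px f z * g z + f z * px g z)"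
  and py_mult: "smooth f \<Longrightarrow> smooth g \<Longrightarrow> py (\<lambda>z. f z * g z) = (\<lambda>z. py f z * g z + f z * py g z)"
  by (auto intro!: has_partials_imp has_partials_mult smooth_has_partials)

lemma px_diff: "smooth f \<Longrightarrow> smooth g \<Longrightarrow> px (\<lambda>z. f z - g z) = (\<lambda>z. px f z - px g z)"
  and py_diff: "smooth f \<Longrightarrow> smooth g \<Longrightarrow> py (\<lambda>z. f z - g z) = (\<lambda>z. py f z - py g z)"
  by (auto intro!: has_partials_imp has_partials_diff smooth_has_partials)

lemma px_affine: "smooth f \<Longrightarrow> px (\<lambda>w. f (of_real k * w + c)) = (\<lambda>w. k * px f (of_real k * w + c))"
  and py_affine: "smooth f \<Longrightarrow> py (\<lambda>w. f (of_real k * w + c)) = (\<lambda>w. k * py f (of_real k * w + c))"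
  by (auto intro!: has_partials_imp has_partials_affine smooth_has_partials)

lemma px_const [simp]: "px (\<lambda>_. c) = (\<lambda>_. 0)" and py_const [simp]: "py (\<lambda>_. c) = (\<lambda>_. 0)"
  using has_partials_imp[OF has_partials_const] by auto

lemma px_Re [simp]: "px Re = (\<lambda>_. 1)" and py_Re [simp]: "py Re = (\<lambda>_. 0)"
  and px_Im [simp]: "px Im = (\<lambda>_. 0)" and py_Im [simp]: "py Im = (\<lambda>_. 1)"
  using has_partials_imp[OF has_partials_Re] has_partials_imp[OF has_partials_Im] by auto

lemma laplacian_add: "smooth f \<Longrightarrow> smooth g \<Longrightarrow> laplacian (\<lambda>z. f z + g z) = (\<lambda>z. laplacian f z + laplacian g z)"
  by (simp add: laplacian_eq smooth_add px_add py_add smooth_px smooth_py add_ac)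

lemma laplacian_cmult: "smooth f \<Longrightarrow> laplacian (\<lambda>z. c * f z) = (\<lambda>z. c * laplacian f z)"
  by (simp add: laplacian_eq smooth_mult smooth_const px_mult py_mult smooth_px smooth_py distrib_left)

lemma laplacian_const: "laplacian (\<lambda>_. c) = (\<lambda>_. 0)"
  by (simp add: laplacian_eq smooth_const)

lemma laplacian_affine:
  "smooth f \<Longrightarrow> laplacian (\<lambda>w. f (of_real k * w + c)) = (\<lambda>w. k\<^sup>2 * laplacian f (of_real k * w + c))"
  by (simp add: laplacian_eq smooth_affine px_affine py_affine px_mult py_mult smooth_px smooth_py smooth_const
      distrib_left power2_eq_square mult.assoc)

lemma
  assumes "smooth f" "open U" "\<And>z. z \<in> U \<Longrightarrow> f z = 0" "z \<in> U"
  shows px_zero: "px f z = 0" and py_zero: "py f z = 0"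
proof -
  have "(f has_derivative (\<lambda>_. 0)) (at z)"
    by (rule has_derivative_transform_within_open[OF has_derivative_const[of 0] assms(2,4)]) (use assms(3) in auto)
  then have e: "frechet_derivative f (at z) = (\<lambda>_. 0)"
    using frechet_derivative_at by metis
  show "px f z = 0" "py f z = 0" unfolding px_def py_def e by simp_all
qed

lemma laplacian_zero:
  assumes "smooth f" "open U" "\<And>z. z \<in> U \<Longrightarrow> f z = 0" "z \<in> U"
  shows "laplacian f z = 0"
  using px_zero[of "px f" U z] py_zero[of "py f" U z] px_zero[of f U] py_zero[of f U] assms
  by (simp add: laplacian_eq smooth_px smooth_py)

section \<open>Test functions, and derivatives in the radial and angular directions\<close>

lemma open_norm_gt: "open {z::complex. norm z > r}"
  by (intro open_Collect_less continuous_intros)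

lemma test_functionI:
  assumes "smooth \<eta>" "\<And>z. norm z > R \<Longrightarrow> \<eta> z = 0"
  shows "test_function \<eta>"
proof -
  have "closure {z. \<eta> z \<noteq> 0} \<subseteq> cball 0 R"
    by (rule closure_minimal) (use assms(2) in \<open>force simp: not_le[symmetric]\<close>, simp)
  then have "compact (closure {z. \<eta> z \<noteq> 0})"
    by (meson bounded_cball bounded_subset closed_closure compact_eq_bounded_closed)
  then show ?thesis using assms(1) by (simp add: test_function_def)
qed

lemma test_functionD:
  assumes "test_function \<eta>"
  obtains R where "smooth \<eta>" "\<And>z. norm z > R \<Longrightarrow> \<eta> z = 0"
proof -
  have "bounded (closure {z. \<eta> z \<noteq> 0})"
    using assms by (simp add: test_function_def compact_imp_bounded)
  then obtain R where "closure {z. \<eta> z \<noteq> 0} \<subseteq> cball 0 R"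
    unfolding bounded_iff by (auto simp: subset_iff)
  moreover have "{z. \<eta> z \<noteq> 0} \<subseteq> closure {z. \<eta> z \<noteq> 0}" by (rule closure_subset)
  ultimately have "\<eta> z = 0" if "norm z > R" for z using that by (auto simp: subset_iff not_le[symmetric])
  then show ?thesis using that assms by (auto simp: test_function_def)
qed

text \<open>For z = exp(t + i psi), \<open>rad\<close> is d/dt, that is r d/dr, and
  \<open>ang\<close> below is d/dpsi. The Cartesian form makes both smooth at the origin too, so
  they can be iterated without excluding it.\<close>

definition rad :: "(complex \<Rightarrow> real) \<Rightarrow> complex \<Rightarrow> real" where
  "rad f z = Re z * px f z + Im z * py f z"

definition ang :: "(complex \<Rightarrow> real) \<Rightarrow> complex \<Rightarrow> real" where
  "ang f z = Re z * py f z - Im z * px f z"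

lemma smooth_rad: "smooth f \<Longrightarrow> smooth (rad f)" and smooth_ang: "smooth f \<Longrightarrow> smooth (ang f)"
  unfolding rad_def[abs_def] ang_def[abs_def]
  by (auto intro!: smooth_add smooth_diff smooth_mult smooth_Re smooth_Im smooth_px smooth_py)

text \<open>This is r^2 \<Delta> = d^2/dt^2 + d^2/dpsi^2. The first-order terms x f_x + y f_y enter
  with opposite signs from the two squares, and so do the mixed second derivatives, once their order
  is immaterial.\<close>

lemma rad_rad_ang_ang:
  assumes f: "smooth f"
  shows "rad (rad f) z + ang (ang f) z = (norm z)\<^sup>2 * laplacian f z"
proof -
  have r: "rad f = (\<lambda>z. Re z * px f z + Im z * py f z)" by (simp add: rad_def fun_eq_iff)
  have a: "ang f = (\<lambda>z. Re z * py f z - Im z * px f z)" by (simp add: ang_def fun_eq_iff)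
  note s = smooth_Re smooth_Im smooth_const smooth_px[OF f] smooth_py[OF f] smooth_mult
  have e1: "px (rad f) z = px f z + Re z * px (px f) z + Im z * px (py f) z"
    "py (rad f) z = Re z * py (px f) z + py f z + Im z * py (py f) z"
    unfolding r by (simp_all add: px_add py_add px_mult py_mult s)
  have e2: "px (ang f) z = py f z + Re z * px (py f) z - Im z * px (px f) z"
    "py (ang f) z = Re z * py (py f) z - px f z - Im z * py (px f) z"
    unfolding a by (simp_all add: px_diff py_diff px_mult py_mult s)
  show ?thesis
    unfolding rad_def[of "rad f"] ang_def[of "ang f"] e1 e2 laplacian_eq[OF f] px_py_commute[OF f] cmod_power2
    by (simp add: algebra_simps power2_eq_square)
qed

lemma has_derivative_log_polar_aux:
  assumes f: "smooth f" and g: "(g has_vector_derivative g') (at t within S)"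
  shows "((\<lambda>t. f (g t)) has_real_derivative Re g' * px f (g t) + Im g' * py f (g t)) (at t within S)"
proof -
  have "((\<lambda>t. f (g t)) has_derivative (\<lambda>h. Re (h *\<^sub>R g') * px f (g t) + Im (h *\<^sub>R g') * py f (g t))) (at t within S)"
    by (rule has_derivative_compose[OF g[unfolded has_vector_derivative_def] has_partialsD[OF smooth_has_partials[OF f]]])
  then show ?thesis
    unfolding has_field_derivative_def
    by (rule has_derivative_eq_rhs) (simp add: fun_eq_iff algebra_simps)
qed

lemma DERIV_log_polar_t:
  assumes f: "smooth f"
  shows "((\<lambda>t. f (log_polar (t, \<psi>))) has_real_derivative rad f (log_polar (t, \<psi>))) (at t within S)"
proof -
  have "((\<lambda>t. log_polar (t, \<psi>)) has_vector_derivative log_polar (t, \<psi>)) (at t within S)"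
    unfolding log_polar_def by (auto intro!: derivative_eq_intros simp: has_vector_derivative_complex_iff)
  from has_derivative_log_polar_aux[OF f this] show ?thesis by (simp add: rad_def)
qed

lemma DERIV_log_polar_psi:
  assumes f: "smooth f"
  shows "((\<lambda>\<psi>. f (log_polar (t, \<psi>))) has_real_derivative ang f (log_polar (t, \<psi>))) (at \<psi> within S)"
proof -
  have "((\<lambda>\<psi>. log_polar (t, \<psi>)) has_vector_derivative \<i> * log_polar (t, \<psi>)) (at \<psi> within S)"
    unfolding log_polar_def by (auto intro!: derivative_eq_intros simp: has_vector_derivative_complex_iff)
  from has_derivative_log_polar_aux[OF f this] show ?thesis by (simp add: ang_def algebra_simps)
qed

section \<open>Mollifiers from a smoothed logarithm\<close>

lemma smooth_bounded:
  assumes "smooth \<eta>" "\<And>z. norm z > R \<Longrightarrow> \<eta> z = 0"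
  obtains M where "M \<ge> 0" "\<And>z. \<bar>\<eta> z\<bar> \<le> M"
proof -
  have "compact (\<eta> ` cball 0 R)"
    by (intro compact_continuous_image smooth_continuous assms) simp
  then have "bounded (\<eta> ` cball 0 R)" by (rule compact_imp_bounded)
  then obtain M where M: "\<forall>y\<in>\<eta> ` cball 0 R. norm y \<le> M" unfolding bounded_iff ..
  have "\<bar>\<eta> z\<bar> \<le> max M 0" for z
  proof (cases "norm z \<le> R")
    case True
    then have "\<eta> z \<in> \<eta> ` cball 0 R" by simp
    from M[rule_format, OF this] show ?thesis by (simp add: le_max_iff_disj)
  qed (use assms(2)[of z] in simp)
  then show ?thesis using that[of "max M 0"] by simp
qed

section \<open>Convolution of a locally integrable function with a smooth kernel\<close>

definition conv :: "(complex \<Rightarrow> real) \<Rightarrow> (complex \<Rightarrow> real) \<Rightarrow> complex \<Rightarrow> real" where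
  "conv f \<eta> z = (LBINT w. f w * \<eta> (z - w))"

lemma norm_diff_gt:
  fixes z w :: complex
  shows "norm w > norm z + r \<Longrightarrow> norm (z - w) > r"
  using norm_triangle_ineq2[of w z] by (simp add: norm_minus_commute)

lemma smooth_reflect: "smooth \<eta> \<Longrightarrow> smooth (\<lambda>w. \<eta> (z - w))"
  using smooth_affine[of \<eta> "-1" z] by (simp add: algebra_simps)

lemma integrable_mult_compact_support:
  fixes f \<eta> :: "complex \<Rightarrow> real"
  assumes [measurable]: "f \<in> borel_measurable borel" and f: "\<And>R. set_integrable lborel (cball 0 R) f"
    and \<eta>: "smooth \<eta>" "\<And>z. norm z > R \<Longrightarrow> \<eta> z = 0"
  shows "integrable lborel (\<lambda>w. f w * \<eta> w)"
proof -
  obtain M where M: "M \<ge> 0" "\<And>z. \<bar>\<eta> z\<bar> \<le> M" using smooth_bounded[OF \<eta>] by blast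
  have [measurable]: "\<eta> \<in> borel_measurable borel" using \<eta>(1) by (rule smooth_measurable)
  have "integrable lborel (\<lambda>w. M * (indicator (cball 0 R) w * f w))"
    using f[of R] by (simp add: set_integrable_def)
  then show ?thesis
  proof (rule Bochner_Integration.integrable_bound)
    show "AE w in lborel. norm (f w * \<eta> w) \<le> norm (M * (indicator (cball 0 R) w * f w))"
    proof (rule AE_I2)
      fix w
      have "\<bar>f w\<bar> * \<bar>\<eta> w\<bar> \<le> \<bar>f w\<bar> * M" using M(2) by (rule mult_left_mono) simp
      then show "norm (f w * \<eta> w) \<le> norm (M * (indicator (cball 0 R) w * f w))"
        using M(1) \<eta>(2)[of w] by (cases "norm w \<le> R") (auto simp: abs_mult mult.commute)
    qed
  qed measurable
qed

lemma conv_integrable: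
  assumes f: "f \<in> borel_measurable borel" "\<And>R. set_integrable lborel (cball 0 R) f"
    and \<eta>: "smooth \<eta>" "\<And>z. norm z > 1 \<Longrightarrow> \<eta> z = 0"
  shows "integrable lborel (\<lambda>w. f w * \<eta> (z - w))"
proof (rule integrable_mult_compact_support[OF f smooth_reflect[OF \<eta>(1)], of "norm z + 1"])
  fix w :: complex assume "norm w > norm z + 1"
  then have "norm (z - w) > 1" by (rule norm_diff_gt)
  then show "\<eta> (z - w) = 0" by (rule \<eta>(2))
qed

text \<open>Differentiation under the integral through a uniform remainder estimate: by uniform
  continuity of the partials, the linearization error of \<eta> at every point is at most a small
  multiple of the norm of h. Integrated against |f| over the disc of radius |z| + 2 it stays small
  relative to h.\<close>

lemma conv_has_partials:
  assumes f: "f \<in> borel_measurable borel" "\<And>R. set_integrable lborel (cball 0 R) f"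
    and \<eta>: "smooth \<eta>" "\<And>z. norm z > 1 \<Longrightarrow> \<eta> z = 0"
  shows "has_partials (conv f \<eta>) (conv f (px \<eta>)) (conv f (py \<eta>))"
  unfolding has_partials_def has_derivative_at_alt
proof (intro allI conjI impI)
  fix z
  show "bounded_linear (\<lambda>h. Re h * conv f (px \<eta>) z + Im h * conv f (py \<eta>) z)"
    by (intro bounded_linear_add bounded_linear_mult_left bounded_linear_compose[OF bounded_linear_mult_left]
          bounded_linear_Re bounded_linear_Im)
  fix e :: real assume "e > 0"
  have supp: "px \<eta> w = 0" "py \<eta> w = 0" if "norm w > 1" for w
    using px_zero[OF \<eta>(1) open_norm_gt, where z = w] py_zero[OF \<eta>(1) open_norm_gt, where z = w] \<eta>(2) that by auto
  define I where "I = (LBINT w. \<bar>indicator (cball 0 (norm z + 2)) w * f w\<bar>)"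
  have Iint: "integrable lborel (\<lambda>w. \<bar>indicator (cball 0 (norm z + 2)) w * f w\<bar>)"
    using f(2)[of "norm z + 2"] by (simp add: set_integrable_def)
  have "I \<ge> 0" unfolding I_def by (rule integral_nonneg_AE) simp
  \<comment> \<open>Each of the two partials contributes an error \<open>e'\<close>, hence the
    factor 2. Adding 1 to \<open>I\<close> avoids a division by zero, and I / (I + 1) is at most
    1.\<close>
  define e' where "e' = e / (2 * (I + 1))"
  have "e' > 0" using \<open>e > 0\<close> \<open>I \<ge> 0\<close> by (simp add: e'_def)
  \<comment> \<open>Radius 3 suffices: points of norm at most 2 are moved by less than 1. Beyond
    norm 2 such a move does not re-enter the unit disc, and the remainder vanishes.\<close>
  have uc: "uniformly_continuous_on (cball 0 3) (px \<eta>)" "uniformly_continuous_on (cball 0 3) (py \<eta>)"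
    by (intro compact_uniformly_continuous smooth_continuous smooth_px smooth_py \<eta>; simp)+
  obtain d1 where d1: "d1 > 0" "\<And>u v. u \<in> cball 0 3 \<Longrightarrow> v \<in> cball 0 3 \<Longrightarrow> dist u v < d1 \<Longrightarrow> dist (px \<eta> u) (px \<eta> v) < e'"
    using uc(1) \<open>e' > 0\<close> unfolding uniformly_continuous_on_def by metis
  obtain d2 where d2: "d2 > 0" "\<And>u v. u \<in> cball 0 3 \<Longrightarrow> v \<in> cball 0 3 \<Longrightarrow> dist u v < d2 \<Longrightarrow> dist (py \<eta> u) (py \<eta> v) < e'"
    using uc(2) \<open>e' > 0\<close> unfolding uniformly_continuous_on_def by metis
  define d where "d = min 1 (min d1 d2)"
  have "d > 0" using d1 d2 by (simp add: d_def)
  have rem: "\<bar>\<eta> (u + h) - \<eta> u - (Re h * px \<eta> u + Im h * py \<eta> u)\<bar> \<le> norm h * (2 * e')" if h: "norm h < d" for u h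
  proof (cases "norm u \<le> 2")
    case False
    have "norm (u + h) > 1" using h norm_triangle_ineq2[of u "-h"] False by (simp add: d_def)
    then show ?thesis using False \<eta>(2) supp \<open>e' > 0\<close> by simp
  next
    case True
    have "norm (\<eta> (u + h) - \<eta> u - (\<lambda>v k. Re k * px \<eta> v + Im k * py \<eta> v) u (u + h - u)) \<le> norm (u + h - u) * (2 * e')"
    proof (rule differentiable_bound_linearization[where S = "cball u (norm h)"])
      fix t :: real assume "t \<in> {0..1}"
      then show "u + t *\<^sub>R (u + h - u) \<in> cball u (norm h)"
        by (auto simp: dist_norm mult_left_le_one_le)
    next
      fix v assume "v \<in> cball u (norm h)"
      then have uv: "dist u v \<le> norm h" by simp
      have v: "norm v \<le> 3" "norm u \<le> 3" using uv h True norm_triangle_ineq2[of v u] by (auto simp: d_def dist_norm norm_minus_commute)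
      have "\<bar>px \<eta> v - px \<eta> u\<bar> \<le> e'" "\<bar>py \<eta> v - py \<eta> u\<bar> \<le> e'"
        using d1(2)[of v u] d2(2)[of v u] v uv h by (auto simp: d_def dist_commute dist_real_def)
      then have b: "norm (Re k * (px \<eta> v - px \<eta> u) + Im k * (py \<eta> v - py \<eta> u)) \<le> norm k * (2 * e')" for k
      proof -
        have "\<bar>Re k\<bar> * \<bar>px \<eta> v - px \<eta> u\<bar> \<le> norm k * e'" "\<bar>Im k\<bar> * \<bar>py \<eta> v - py \<eta> u\<bar> \<le> norm k * e'"
          using \<open>\<bar>px \<eta> v - px \<eta> u\<bar> \<le> e'\<close> \<open>\<bar>py \<eta> v - py \<eta> u\<bar> \<le> e'\<close> by (auto intro!: mult_mono abs_Re_le_cmod abs_Im_le_cmod)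
        then show ?thesis
          using abs_triangle_ineq[of "Re k * (px \<eta> v - px \<eta> u)" "Im k * (py \<eta> v - py \<eta> u)"] by (simp add: abs_mult)
      qed
      show "onorm ((\<lambda>k. Re k * px \<eta> v + Im k * py \<eta> v) - (\<lambda>k. Re k * px \<eta> u + Im k * py \<eta> u)) \<le> 2 * e'"
        by (rule onorm_le) (use b in \<open>simp add: algebra_simps fun_diff_def\<close>)
    qed (use smooth_has_partials[OF \<eta>(1)] in \<open>auto intro: has_partialsD\<close>)
    then show ?thesis by simp
  qed
  show "\<exists>d>0. \<forall>y. norm (y - z) < d \<longrightarrow>
      norm (conv f \<eta> y - conv f \<eta> z - (Re (y - z) * conv f (px \<eta>) z + Im (y - z) * conv f (py \<eta>) z)) \<le> e * norm (y - z)"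
  proof (intro exI[of _ d] conjI allI impI)
    fix y assume y: "norm (y - z) < d"
    define h where "h = y - z"
    define Rm where "Rm w = \<eta> (y - w) - \<eta> (z - w) - (Re h * px \<eta> (z - w) + Im h * py \<eta> (z - w))" for w
    note ci = conv_integrable[OF f \<eta>, of y] conv_integrable[OF f \<eta>, of z]
      conv_integrable[OF f smooth_px[OF \<eta>(1)] supp(1), of z] conv_integrable[OF f smooth_py[OF \<eta>(1)] supp(2), of z]
    have "f w * Rm w = f w * \<eta> (y - w) - f w * \<eta> (z - w) - (Re h * (f w * px \<eta> (z - w)) + Im h * (f w * py \<eta> (z - w)))" for w
      by (simp add: Rm_def algebra_simps)
    then have "conv f \<eta> y - conv f \<eta> z - (Re h * conv f (px \<eta>) z + Im h * conv f (py \<eta>) z) = (LBINT w. f w * Rm w)"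
      unfolding conv_def using ci by simp
    also have "norm \<dots> \<le> (LBINT w. norm h * (2 * e') * \<bar>indicator (cball 0 (norm z + 2)) w * f w\<bar>)"
    proof (rule Bochner_Integration.integral_norm_bound_integral)
      show "integrable lborel (\<lambda>w. f w * Rm w)"
        unfolding \<open>\<And>w. f w * Rm w = _\<close> using ci by simp
      fix w
      have "\<bar>Rm w\<bar> \<le> norm h * (2 * e')"
        using rem[of h "z - w"] y by (simp add: Rm_def h_def algebra_simps)
      moreover have "Rm w = 0" if "norm w > norm z + 2"
      proof -
        have "norm (z - w) > 2" using that by (rule norm_diff_gt)
        moreover from this have "norm (y - w) > 1"
          using y norm_triangle_ineq2[of "z - w" "z - y"] by (simp add: norm_minus_commute d_def)
        ultimately show ?thesis using \<eta>(2) supp by (simp add: Rm_def)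
      qed
      ultimately show "norm (f w * Rm w) \<le> norm h * (2 * e') * \<bar>indicator (cball 0 (norm z + 2)) w * f w\<bar>"
        by (cases "norm w \<le> norm z + 2") (auto simp: abs_mult mult.commute[of "\<bar>f w\<bar>"] mult_right_mono)
    qed (use Iint in simp)
    also have "\<dots> = norm h * (2 * e') * I" by (simp add: I_def)
    also have "2 * e' = e / (I + 1)" using \<open>I \<ge> 0\<close> by (simp add: e'_def field_simps)
    also have "norm h * (e / (I + 1)) * I = norm h * (e * (I / (I + 1)))" by simp
    also have "\<dots> \<le> norm h * (e * 1)"
      using \<open>I \<ge> 0\<close> \<open>e > 0\<close> by (intro mult_left_mono) auto
    finally show "norm (conv f \<eta> y - conv f \<eta> z - (Re (y - z) * conv f (px \<eta>) z + Im (y - z) * conv f (py \<eta>) z)) \<le> e * norm (y - z)"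
      by (simp add: h_def mult.commute)
  qed (use \<open>d > 0\<close> in simp)
qed

section \<open>The mollifier: support and total mass\<close>

definition mollifier :: "complex \<Rightarrow> real" where
  "mollifier = laplacian log_smoothed"

lemma smooth_mollifier: "smooth mollifier"
  unfolding mollifier_def by (intro smooth_laplacian smooth_log_smoothed)

lemma log_smoothed_polar: "log_smoothed (log_polar (t, \<psi>)) = log_smoothed (log_polar (t, 0))"
  by (simp add: log_smoothed_def bump_def)

lemma ang_log_smoothed: "ang log_smoothed = (\<lambda>_. 0)"
proof
  fix z
  show "ang log_smoothed z = 0"
  proof (cases "z = 0")
    case False
    define t \<psi> where "t = ln (norm z)" and "\<psi> = Arg2pi z"
    have z: "z = log_polar (t, \<psi>)" unfolding t_def \<psi>_def by (rule log_polar_surj[OF False])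
    have "((\<lambda>\<psi>. log_smoothed (log_polar (t, \<psi>))) has_real_derivative 0) (at \<psi>)"
      by (subst log_smoothed_polar) simp
    then show ?thesis
      unfolding z using DERIV_unique[OF DERIV_log_polar_psi[OF smooth_log_smoothed]] by blast
  qed (simp add: ang_def)
qed

text \<open>The smoothed logarithm is radial, so only the radial half of the polar Laplacian
  survives: |z|^2 times the mollifier is a second derivative in t. Where the smoothed logarithm
  equals t, this derivative is 0, which gives the support.\<close>

lemma mollifier_eq: "(norm z)\<^sup>2 * mollifier z = rad (rad log_smoothed) z"
proof -
  have "ang (\<lambda>_. 0) = (\<lambda>_. 0)" by (simp add: ang_def fun_eq_iff)
  then show ?thesis
    using rad_rad_ang_ang[OF smooth_log_smoothed, of z] by (simp add: ang_log_smoothed mollifier_def)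
qed

lemma rad_log_smoothed: "t > 0 \<Longrightarrow> rad log_smoothed (log_polar (t, \<psi>)) = 1"
proof -
  assume "t > 0"
  have "((\<lambda>t. t) has_real_derivative 1) (at t)" by simp
  then have "((\<lambda>t. log_smoothed (log_polar (t, \<psi>))) has_real_derivative 1) (at t)"
    by (rule has_field_derivative_transform_within_open[of _ _ _ "{0<..}"])
       (use \<open>t > 0\<close> in \<open>auto simp: log_smoothed_outside\<close>)
  then show ?thesis using DERIV_unique[OF DERIV_log_polar_t[OF smooth_log_smoothed]] by blast
qed

lemma rad_rad_log_smoothed: "t > 0 \<Longrightarrow> rad (rad log_smoothed) (log_polar (t, \<psi>)) = 0"
proof -
  assume "t > 0"
  have "((\<lambda>t. 1) has_real_derivative 0) (at t)" by simp
  then have "((\<lambda>t. rad log_smoothed (log_polar (t, \<psi>))) has_real_derivative 0) (at t)"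
    by (rule has_field_derivative_transform_within_open[of _ _ _ "{0<..}"])
       (use \<open>t > 0\<close> in \<open>auto simp: rad_log_smoothed\<close>)
  then show ?thesis using DERIV_unique[OF DERIV_log_polar_t[OF smooth_rad[OF smooth_log_smoothed]]] by blast
qed

lemma mollifier_zero:
  assumes "norm z > 1" shows "mollifier z = 0"
proof -
  have "z \<noteq> 0" "ln (norm z) > 0" using assms by (auto intro!: ln_gt_zero)
  then have "rad (rad log_smoothed) z = 0"
    using rad_rad_log_smoothed[of "ln (norm z)" "Arg2pi z"] log_polar_surj[of z] by simp
  then show ?thesis using mollifier_eq[of z] \<open>z \<noteq> 0\<close> by simp
qed

lemma rad_polar_radial:
  assumes "smooth f" "\<And>t \<psi>. f (log_polar (t, \<psi>)) = f (log_polar (t, 0))"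
  shows "rad f (log_polar (t, \<psi>)) = rad f (log_polar (t, 0))"
  using DERIV_log_polar_t[OF assms(1), of \<psi> t UNIV] DERIV_log_polar_t[OF assms(1), of 0 t UNIV]
  by (subst (asm) assms(2)) (rule DERIV_unique)

lemma mollifier_integrable: "integrable lborel mollifier"
proof -
  have "integrable lborel (indicator (cball (0::complex) R) :: _ \<Rightarrow> real)" for R
    by (rule integrable_real_indicator[OF _ emeasure_bounded_finite[OF bounded_cball]]) simp
  then show ?thesis
    using integrable_mult_compact_support[of "\<lambda>_. 1" mollifier 1] smooth_mollifier mollifier_zero
    by (simp add: set_integrable_def)
qed

text \<open>The polar weight e^(2t) cancels |z|^2, leaving the exact derivative of \<open>k\<close>,
  the slope of the smoothed logarithm in t. It runs from 0 at minus infinity to 1, and the angle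
  contributes 2 pi. This is the smoothed form of the identity that the Laplacian of ln |z| is 2 pi
  times the Dirac mass at 0.\<close>

lemma integral_mollifier: "(LBINT z. mollifier z) = 2 * pi"
proof -
  define k where "k t = rad log_smoothed (log_polar (t, 0))" for t
  define m where "m t = rad (rad log_smoothed) (log_polar (t, 0))" for t
  have rr: "rad (rad log_smoothed) (log_polar (t, \<psi>)) = m t" for t \<psi>
    unfolding m_def
    by (intro rad_polar_radial smooth_rad smooth_log_smoothed log_smoothed_polar)
  have mm: "mollifier \<in> borel_measurable borel" using smooth_mollifier by (rule smooth_measurable)
  have e: "(exp (2 * fst p) * arc (snd p)) *\<^sub>R mollifier (log_polar p) = arc (snd p) * m (fst p)" for p
  proof -
    have "exp (2 * fst p) = (norm (log_polar p))\<^sup>2" by (simp add: exp_double)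
    then have "exp (2 * fst p) * mollifier (log_polar p) = m (fst p)"
      using mollifier_eq[of "log_polar p"] rr[of "fst p" "snd p"] by simp
    then show ?thesis by (simp add: mult_ac)
  qed
  have int: "integrable lborel2 (\<lambda>p::real \<times> real. arc (snd p) * m (fst p))"
    using integrable_log_polar[OF mm] mollifier_integrable unfolding e by simp
  have inner: "(LBINT \<psi>. arc \<psi> * m t) = 2 * pi * m t" for t by simp
  have "(LBINT z. mollifier z) = (LINT p|lborel2. arc (snd p) * m (fst p))"
    using integral_log_polar[OF mm] unfolding e by simp
  also have "\<dots> = (LBINT t. LBINT \<psi>. arc \<psi> * m t)"
    using lborel_pair.integral_fst'[OF int] by simp
  also have "\<dots> = 2 * pi * (LBINT t. m t)" unfolding inner by simp
  also have "(LBINT t. m t) = 1"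
  proof -
    have "integrable lborel (\<lambda>t. 2 * pi * m t)"
      using lborel_pair.integrable_fst'[OF int] inner by simp
    then have mi: "integrable lborel m" by simp
    have dk: "(k has_real_derivative m t) (at t)" for t
      unfolding k_def m_def by (rule DERIV_log_polar_t[OF smooth_rad[OF smooth_log_smoothed]])
    have dm: "isCont m t" for t
      unfolding m_def using DERIV_log_polar_t[OF smooth_rad[OF smooth_rad[OF smooth_log_smoothed]], of 0 t UNIV]
      by (rule DERIV_isCont)
    have "(LBINT t=-\<infinity>..\<infinity>. m t) = 1 - 0"
    proof (rule interval_integral_FTC_integrable)
      show "(k has_vector_derivative m x) (at x)" for x
        using dk has_real_derivative_iff_has_vector_derivative by blast
      show "set_integrable lborel (einterval (-\<infinity>) \<infinity>) m" using mi by (simp add: set_integrable_def einterval_def)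
      have "eventually (\<lambda>t. k t = 1) at_top"
        using eventually_gt_at_top[of 0] by eventually_elim (simp add: k_def rad_log_smoothed)
      then have "(k \<longlongrightarrow> 1) at_top" by (rule tendsto_eventually)
      then show "((k \<circ> real_of_ereal) \<longlongrightarrow> 1) (at_left \<infinity>)" by (simp add: ereal_tendsto_simps1)
      \<comment> \<open>On the real axis \<open>rad\<close> is x d/dx. The factor e^t tends to 0,
        and the partial derivative stays bounded because it is continuous at the origin.\<close>
      have "k = (\<lambda>t. exp t * px log_smoothed (of_real (exp t)))"
        by (simp add: k_def rad_def log_polar_def fun_eq_iff)
      moreover have "((\<lambda>t. exp t * px log_smoothed (of_real (exp t))) \<longlongrightarrow> 0 * px log_smoothed (of_real 0)) at_bot"
      proof (intro tendsto_mult exp_at_bot)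
        have "continuous_on UNIV (px log_smoothed)" by (intro smooth_continuous smooth_px smooth_log_smoothed)
        then have "isCont (px log_smoothed) (of_real 0)" by (simp add: continuous_on_eq_continuous_at)
        then show "((\<lambda>t. px log_smoothed (of_real (exp t))) \<longlongrightarrow> px log_smoothed (of_real 0)) at_bot"
          by (rule isCont_tendsto_compose) (intro tendsto_of_real exp_at_bot)
      qed
      ultimately have "(k \<longlongrightarrow> 0) at_bot" by simp
      then show "((k \<circ> real_of_ereal) \<longlongrightarrow> 0) (at_right (-\<infinity>))" by (simp add: ereal_tendsto_simps1)
    qed (use dm in auto)
    then show ?thesis
      by (simp add: interval_lebesgue_integral_def set_lebesgue_integral_def einterval_def)
  qed
  finally show ?thesis by simp
qed

section \<open>Weyl's lemma\<close>

lemma integral_affine_complex: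
  fixes f :: "complex \<Rightarrow> real"
  assumes [measurable]: "f \<in> borel_measurable borel" and "c \<noteq> 0"
  shows "(LBINT w. f w) = c\<^sup>2 * (LBINT v. f (z + c *\<^sub>R v))"
proof -
  have "(LBINT w. f w) = (\<integral>w. f w \<partial>density (distr lborel borel (\<lambda>v. z + c *\<^sub>R v)) (\<lambda>_. \<bar>c\<bar> ^ DIM(complex)))"
    using lborel_affine[OF \<open>c \<noteq> 0\<close>, of z] by simp
  also have "\<dots> = (\<integral>w. c\<^sup>2 * f w \<partial>distr lborel borel (\<lambda>v. z + c *\<^sub>R v))"
    by (subst integral_density) auto
  also have "\<dots> = (LBINT v. c\<^sup>2 * f (z + c *\<^sub>R v))"
    by (subst integral_distr) auto
  finally show ?thesis by simp
qed

text \<open>\<open>ennreal\<close> truncates negative values to 0, so the densities given by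
  \<open>g\<close> and \<open>- g\<close> are the positive and the negative part. The hypothesis
  makes the two measures agree on boxes, an intersection-stable generator, hence everywhere; the two
  parts then coincide almost everywhere, and since one of them is 0 at each point, so is
  \<open>g\<close>.\<close>

lemma AE_zero_if_integrals_over_boxes_zero:
  fixes g :: "'a::euclidean_space \<Rightarrow> real"
  assumes [measurable]: "g \<in> borel_measurable borel"
    and int: "\<And>l u. set_integrable lborel (box l u) g"
    and zero: "\<And>l u. (LINT x:box l u|lborel. g x) = 0"
  shows "AE x in lborel. g x = 0"
proof -
  define pos where "pos h l u = (LBINT x. max 0 (indicator (box l u) x * h x))" for h :: "'a \<Rightarrow> real" and l u
  have nn: "(\<integral>\<^sup>+x. ennreal (h x) * indicator (box l u) x \<partial>lborel) = ennreal (pos h l u)"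
    if "integrable lborel (\<lambda>x. indicator (box l u) x * h x)" for h l u
  proof -
    have "(\<integral>\<^sup>+x. ennreal (h x) * indicator (box l u) x \<partial>lborel) = (\<integral>\<^sup>+x. ennreal (max 0 (indicator (box l u) x * h x)) \<partial>lborel)"
      by (rule nn_integral_cong) (auto simp: indicator_def max_def ennreal_neg)
    also have "\<dots> = ennreal (pos h l u)"
      unfolding pos_def by (rule nn_integral_eq_integral) (use that in auto)
    finally show ?thesis .
  qed
  have i: "integrable lborel (\<lambda>x. indicator (box l u) x * g x)" "integrable lborel (\<lambda>x. indicator (box l u) x * - g x)" for l u
    using int[of l u] by (simp_all add: set_integrable_def)
  note fin = nn[OF i(1)] nn[OF i(2)]
  have eq: "pos g l u = pos (\<lambda>x. - g x) l u" for l u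
  proof -
    have "pos g l u - pos (\<lambda>x. - g x) l u
       = (LBINT x. max 0 (indicator (box l u) x * g x) - max 0 (indicator (box l u) x * - g x))"
      unfolding pos_def using i[of l u] by (intro Bochner_Integration.integral_diff[symmetric]) auto
    also have "\<dots> = (LBINT x. indicator (box l u) x * g x)"
      by (rule Bochner_Integration.integral_cong) (auto simp: max_def)
    finally show ?thesis using zero[of l u] by (simp add: set_lebesgue_integral_def)
  qed
  have "density lborel (\<lambda>x. ennreal (g x)) = density lborel (\<lambda>x. ennreal (- g x))"
  proof (rule measure_eqI_generator_eq)
    let ?E = "range (\<lambda>(a, b). box a b::'a set)"
    show "Int_stable ?E" by (auto simp: Int_stable_def box_Int_box)
    show "?E \<subseteq> Pow UNIV" "sets (density lborel (\<lambda>x. ennreal (g x))) = sigma_sets UNIV ?E"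
      "sets (density lborel (\<lambda>x. ennreal (- g x))) = sigma_sets UNIV ?E"
      by (simp_all add: borel_eq_box)
    let ?A = "\<lambda>n::nat. box (- (real n *\<^sub>R One)) (real n *\<^sub>R One) :: 'a set"
    show "range ?A \<subseteq> ?E" "(\<Union>i. ?A i) = UNIV" unfolding UN_box_eq_UNIV by auto
    show "emeasure (density lborel (\<lambda>x. ennreal (g x))) (?A i) \<noteq> \<infinity>" for i
      by (subst emeasure_density) (auto simp: fin)
    show "emeasure (density lborel (\<lambda>x. ennreal (g x))) X = emeasure (density lborel (\<lambda>x. ennreal (- g x))) X" if "X \<in> ?E" for X
      using that by (auto simp: emeasure_density fin eq)
  qed
  then have "AE x in lborel. ennreal (g x) = ennreal (- g x)"
    by (intro sigma_finite_measure.density_unique[OF sigma_finite_lborel]) auto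
  then show ?thesis
  proof eventually_elim
    case (elim x)
    then show ?case by (cases "g x \<ge> 0") (auto simp: ennreal_neg ennreal_eq_0_iff)
  qed
qed

lemma integrable_lborel_bounded_support:
  fixes f :: "complex \<Rightarrow> real"
  assumes f: "\<And>R. set_integrable lborel (cball 0 R) f" and "bounded S" "S \<in> sets borel"
  shows "set_integrable lborel S f"
proof -
  obtain R where "S \<subseteq> cball 0 R" using \<open>bounded S\<close> unfolding bounded_iff by (auto simp: subset_iff)
  then show ?thesis using set_integrable_subset[OF f[of R], of S] assms(3) by simp
qed

text \<open>A Borel representative is taken so that f(z - e v) is jointly measurable in z and v, as
  Fubini requires; the difference of two solutions of the Poisson equation has one.\<close>

locale weakly_harmonic =
  fixes f :: "complex \<Rightarrow> real"
  assumes f_meas [measurable]: "f \<in> borel_measurable borel"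
    and f_int: "\<And>R. set_integrable lborel (cball 0 R) f"
    and harmonic: "\<And>\<eta>. test_function \<eta> \<Longrightarrow> (LBINT w. f w * laplacian \<eta> w) = 0"
begin

text \<open>The rescaled mollifier is the Laplacian of the smoothed logarithm at scale
  \<open>e\<close>. Up to the constant ln e this differs from the one at scale 1 by a compactly
  supported function, and a weakly harmonic \<open>f\<close> annihilates the Laplacian of such a
  function.\<close>

lemma conv_mollifier_scale:
  assumes "0 < e" "e \<le> 1"
  shows "conv f mollifier z = (LBINT v. f (z - e *\<^sub>R v) * mollifier v)"
proof -
  \<comment> \<open>For |z - w| > 1 both logarithms are genuine, and \<open>ln e\<close> offsets
    ln(|z - w| / e) - ln |z - w|. The arguments are written as real multiples of w plus a constant
    to fit \<open>laplacian_affine\<close>.\<close>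
  define \<eta> where "\<eta> w = (log_smoothed (of_real (- (1 / e)) * w + z / of_real e) + ln e) - log_smoothed (of_real (-1) * w + z)" for w
  have s1: "smooth (\<lambda>w. log_smoothed (of_real (- (1 / e)) * w + z / of_real e))"
    and s2: "smooth (\<lambda>w. log_smoothed (of_real (-1) * w + z))"
    by (intro smooth_affine smooth_log_smoothed)+
  have sm: "smooth \<eta>" unfolding \<eta>_def[abs_def] by (intro smooth_diff smooth_add s1 s2 smooth_const)
  have arg: "of_real (- (1 / e)) * w + z / of_real e = (z - w) / of_real e" for w
    using assms by (simp add: field_simps)
  have "test_function \<eta>"
  proof (rule test_functionI[OF sm, of "norm z + 1"])
    fix w :: complex assume "norm w > norm z + 1"
    then have n: "norm (z - w) > 1" by (rule norm_diff_gt)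
    then have "norm ((z - w) / of_real e) \<ge> 1" using assms by (simp add: norm_divide field_simps)
    then have "log_smoothed ((z - w) / of_real e) = ln (norm ((z - w) / of_real e))" by (rule log_smoothed_outside)
    also have "\<dots> = ln (norm (z - w)) - ln e"
    proof -
      have "norm (z - w) \<noteq> 0" using n by linarith
      then show ?thesis using assms by (simp add: norm_divide ln_div)
    qed
    finally show "\<eta> w = 0" using n unfolding \<eta>_def arg by (simp add: log_smoothed_outside)
  qed
  have "laplacian \<eta> = (\<lambda>w. (1 / e)\<^sup>2 * mollifier ((z - w) / of_real e) - mollifier (z - w))"
  proof -
    have "\<eta> = (\<lambda>w. (log_smoothed (of_real (- (1 / e)) * w + z / of_real e) + ln e) + (-1) * log_smoothed (of_real (-1) * w + z))"
      by (simp add: \<eta>_def fun_eq_iff)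
    then have "laplacian \<eta> = (\<lambda>w. ((- (1 / e))\<^sup>2 * laplacian log_smoothed (of_real (- (1 / e)) * w + z / of_real e) + 0) +
       (-1) * ((-1)\<^sup>2 * laplacian log_smoothed (of_real (-1) * w + z)))"
      by (simp only: laplacian_add laplacian_cmult laplacian_affine laplacian_const s1 s2 smooth_add smooth_mult smooth_const smooth_log_smoothed)
    then show ?thesis unfolding arg by (simp add: mollifier_def power_divide)
  qed
  with harmonic[OF \<open>test_function \<eta>\<close>]
  have zero: "(LBINT w. f w * ((1 / e)\<^sup>2 * mollifier ((z - w) / of_real e)) - f w * mollifier (z - w)) = 0"
    by (simp add: right_diff_distrib)
  have sm3: "smooth (\<lambda>w. mollifier ((z - w) / of_real e))"
    using smooth_affine[OF smooth_mollifier, of "- (1 / e)" "z / of_real e"] unfolding arg .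
  have [measurable]: "mollifier \<in> borel_measurable borel" by (rule smooth_measurable[OF smooth_mollifier])
  have i1: "integrable lborel (\<lambda>w. f w * ((1 / e)\<^sup>2 * mollifier ((z - w) / of_real e)))"
  proof (rule integrable_mult_compact_support[OF f_meas f_int smooth_mult[OF smooth_const sm3], of "norm z + 1"])
    fix w :: complex assume "norm w > norm z + 1"
    then have n: "norm (z - w) > 1" by (rule norm_diff_gt)
    then have "norm ((z - w) / of_real e) > 1" using assms by (simp add: norm_divide field_simps)
    then show "(1 / e)\<^sup>2 * mollifier ((z - w) / of_real e) = 0" by (simp add: mollifier_zero)
  qed
  have i2: "integrable lborel (\<lambda>w. f w * mollifier (z - w))"
    by (rule conv_integrable[OF f_meas f_int smooth_mollifier mollifier_zero])
  have "conv f mollifier z = (LBINT w. f w * ((1 / e)\<^sup>2 * mollifier ((z - w) / of_real e)))"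
    using zero i1 i2 by (simp add: conv_def)
  \<comment> \<open>Substitution w = z - e v; the Jacobian e^2 cancels the normalization
    (1/e)^2.\<close>
  also have "\<dots> = (- e)\<^sup>2 * (LBINT v. f (z + (- e) *\<^sub>R v) * ((1 / e)\<^sup>2 * mollifier ((z - (z + (- e) *\<^sub>R v)) / of_real e)))"
    by (rule integral_affine_complex) (use assms in \<open>measurable, simp\<close>)
  also have "\<dots> = (- e)\<^sup>2 * (LBINT v. (1 / e)\<^sup>2 * (f (z - e *\<^sub>R v) * mollifier v))"
    using assms by (simp add: scaleR_conv_of_real mult.left_commute)
  also have "\<dots> = (LBINT v. f (z - e *\<^sub>R v) * mollifier v)"
    using assms by (simp add: power_divide)
  finally show ?thesis .
qed

text \<open>The convolution q is smooth and classically harmonic, so q_x - i q_y is entire. The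
  plane is convex, so this function has a primitive, whose real part has the same gradient as q; a
  real constant remains.\<close>

lemma conv_mollifier_entire: "\<exists>g. g holomorphic_on UNIV \<and> (\<forall>z. conv f mollifier z = Re (g z))"
proof -
  note sm = smooth_mollifier smooth_px smooth_py
  have z0: "mollifier w = 0" "px mollifier w = 0" "py mollifier w = 0" if "norm w > 1" for w
    using px_zero[OF smooth_mollifier open_norm_gt, where z = w] py_zero[OF smooth_mollifier open_norm_gt, where z = w] mollifier_zero that by auto
  have z1: "px (px mollifier) w = 0" "py (py mollifier) w = 0" if "norm w > 1" for w
    using px_zero[OF smooth_px[OF smooth_mollifier] open_norm_gt, where z = w] py_zero[OF smooth_py[OF smooth_mollifier] open_norm_gt, where z = w] z0 that by auto
  define q qx qy qxx qxy qyy where "q = conv f mollifier" and "qx = conv f (px mollifier)" and "qy = conv f (py mollifier)"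
    and "qxx = conv f (px (px mollifier))" and "qxy = conv f (py (px mollifier))" and "qyy = conv f (py (py mollifier))"
  note q_defs = q_def qx_def qy_def qxx_def qxy_def qyy_def
  have d: "has_partials q qx qy" "has_partials qx qxx qxy" "has_partials qy qxy qyy"
    unfolding q_defs
      px_py_commute[OF smooth_mollifier, symmetric]
    using px_py_commute[OF smooth_mollifier]
    by (auto intro!: conv_has_partials f_meas f_int sm z0) (metis conv_has_partials f_meas f_int sm z0)
  \<comment> \<open>Harmonicity at z comes from testing \<open>f\<close> with w mapped to
    mollifier(z - w); the signs from the reflection cancel in second derivatives.\<close>
  have lap: "qyy z = - qxx z" for z
  proof -
    have "test_function (\<lambda>w. mollifier (z - w))"
    proof (rule test_functionI[OF smooth_reflect[OF smooth_mollifier], of "norm z + 1"])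
      fix w :: complex assume "norm w > norm z + 1"
      then have "norm (z - w) > 1" by (rule norm_diff_gt)
      then show "mollifier (z - w) = 0" by (rule mollifier_zero)
    qed
    moreover have "laplacian (\<lambda>w. mollifier (z - w)) = (\<lambda>w. px (px mollifier) (z - w) + py (py mollifier) (z - w))"
      using laplacian_affine[OF smooth_mollifier, of "-1" z] by (simp add: laplacian_eq smooth_mollifier)
    ultimately have "(LBINT w. f w * px (px mollifier) (z - w) + f w * py (py mollifier) (z - w)) = 0"
      using harmonic[of "\<lambda>w. mollifier (z - w)"] by (simp add: distrib_left)
    moreover have "integrable lborel (\<lambda>w. f w * px (px mollifier) (z - w))" "integrable lborel (\<lambda>w. f w * py (py mollifier) (z - w))"
      by (intro conv_integrable f_meas f_int sm z1; simp)+
    ultimately show ?thesis by (simp add: qxx_def qyy_def conv_def)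
  qed
  \<comment> \<open>If q = Re G, then G' = q_x - i q_y. The Cauchy-Riemann equations for it are
    harmonicity of q and symmetry of its mixed partials.\<close>
  define k where "k z = of_real (qx z) - \<i> * of_real (qy z)" for z
  have dk: "(k has_field_derivative (of_real (qxx z) - \<i> * of_real (qxy z))) (at z)" for z
    unfolding k_def has_field_derivative_def
    by (auto intro!: derivative_eq_intros has_partialsD[OF d(2)] has_partialsD[OF d(3)] simp: lap complex_eq_iff fun_eq_iff algebra_simps)
  then have "k holomorphic_on UNIV"
    using holomorphic_on_open field_differentiable_def by blast
  then obtain G where G: "\<And>z. (G has_field_derivative k z) (at z)"
    using holomorphic_convex_primitive'[of UNIV k] by auto
  have "((\<lambda>z. q z - Re (G z)) has_derivative (\<lambda>h. 0)) (at z)" for z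
  proof -
    have "((\<lambda>z. Re (G z)) has_derivative (\<lambda>h. Re (k z * h))) (at z)"
      using G[of z] unfolding has_field_derivative_def by (rule has_derivative_Re)
    then show ?thesis
      by (rule has_derivative_eq_rhs[OF has_derivative_diff[OF has_partialsD[OF d(1)]]])
         (simp add: k_def fun_eq_iff algebra_simps)
  qed
  then obtain c where c: "\<And>z. q z - Re (G z) = c"
    using has_derivative_zero_constant[of UNIV "\<lambda>z. q z - Re (G z)"] by auto
  have "(\<lambda>z. G z + of_real c) holomorphic_on UNIV"
    using G by (intro holomorphic_intros) (use holomorphic_on_open field_differentiable_def in blast)
  moreover have "conv f mollifier z = Re (G z + of_real c)" for z
    using c[of z] by (simp add: q_def)
  ultimately show ?thesis by blast
qed

text \<open>The left side does not depend on the scale of the mollifier, so the scale may tend to 0.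
  Averaging over a box first puts the shift onto the indicator of the box, so dominated convergence
  suffices and no pointwise convergence of the mollified functions is required.\<close>

lemma integral_box_conv_mollifier:
  "(LBINT z. indicator (box l u) z * conv f mollifier z) = 2 * pi * (LBINT z. indicator (box l u) z * f z)"
proof -
  define Q where "Q = box l u"
  have [measurable]: "mollifier \<in> borel_measurable borel" by (rule smooth_measurable[OF smooth_mollifier])
  have [measurable]: "Q \<in> sets borel" by (simp add: Q_def)
  \<comment> \<open>Translates of the box by vectors of norm at most 1 stay in the disc of radius R
    + 1, on which |f| is the common majorant.\<close>
  obtain R where R: "Q \<subseteq> cball 0 R" using bounded_box[of l u] unfolding bounded_iff Q_def by (auto simp: subset_iff)
  define I where "I = (LBINT z. \<bar>indicator (cball 0 (R + 1)) z * f z\<bar>)"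
  have Iint: "integrable lborel (\<lambda>z. \<bar>indicator (cball 0 (R + 1)) z * f z\<bar>)"
    using f_int[of "R + 1"] by (simp add: set_integrable_def)
  have bd: "\<bar>indicator Q (y + v) * f y\<bar> \<le> \<bar>indicator (cball 0 (R + 1)) y * f y\<bar>" if "norm v \<le> 1" for v y
    using R that norm_triangle_ineq2[of y "- v"] by (auto simp: indicator_def subset_iff)
  have Qint: "integrable lborel (\<lambda>y. indicator Q (y + v) * f y)" if "norm v \<le> 1" for v
    by (rule Bochner_Integration.integrable_bound[OF Iint]) (use bd[OF that] in auto)
  have shift: "(LBINT z. indicator Q z * g (z - v)) = (LBINT y. indicator Q (y + v) * g y)"
    if [measurable]: "g \<in> borel_measurable borel" for v and g :: "complex \<Rightarrow> real"
    using integral_affine_complex[of "\<lambda>z. indicator Q z * g (z - v)" 1 v] by (simp add: add.commute)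
  have shifti: "integrable lborel (\<lambda>z. indicator Q z * f (z - v))" if "norm v \<le> 1" for v
  proof -
    have "integrable (distr lborel borel (\<lambda>y. v + 1 *\<^sub>R y)) (\<lambda>z. indicator Q z * f (z - v))"
      using Qint[OF that] by (subst integrable_distr_eq) (auto simp: add.commute)
    then show ?thesis using lborel_affine[of 1 v] by (simp add: density_1)
  qed
  \<comment> \<open>Integral of \<open>f\<close> over the box shifted by -e v; after Fubini the
    mollifier weights these numbers.\<close>
  define A where "A e v = (LBINT y. indicator Q (y + e *\<^sub>R v) * f y)" for e v
  have Abd: "\<bar>A e v\<bar> \<le> I" if "norm (e *\<^sub>R v) \<le> 1" for e v
    unfolding A_def I_def real_norm_def[symmetric]
    by (rule Bochner_Integration.integral_norm_bound_integral) (use Qint[OF that] bd[OF that] Iint in auto)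
  have main: "(LBINT z. indicator Q z * conv f mollifier z) = (LBINT v. mollifier v * A e v)"
    if e: "0 < e" "e \<le> 1" for e
  proof -
    have n1: "norm (e *\<^sub>R v) \<le> 1" if "norm v \<le> 1" for v :: complex
      using e that by (simp add: mult_le_one)
    have Fint: "integrable lborel2 (\<lambda>(v, z). indicator Q z * (f (z - e *\<^sub>R v) * mollifier v))"
    proof (rule lborel_pair.Fubini_integrable)
      show "AE v in lborel. integrable lborel (\<lambda>z. case (v, z) of (v, z) \<Rightarrow> indicator Q z * (f (z - e *\<^sub>R v) * mollifier v))"
      proof (rule AE_I2)
        fix v :: complex
        show "integrable lborel (\<lambda>z. case (v, z) of (v, z) \<Rightarrow> indicator Q z * (f (z - e *\<^sub>R v) * mollifier v))"
        proof (cases "norm v \<le> 1")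
          case True
          from integrable_mult_right[OF shifti[OF n1[OF True]], of "mollifier v"] show ?thesis by (simp add: mult_ac)
        qed (simp add: mollifier_zero)
      qed
      show "integrable lborel (\<lambda>v. \<integral>z. norm (case (v, z) of (v, z) \<Rightarrow> indicator Q z * (f (z - e *\<^sub>R v) * mollifier v)) \<partial>lborel)"
      proof (rule Bochner_Integration.integrable_bound)
        show "integrable lborel (\<lambda>v. I * mollifier v)" using mollifier_integrable by simp
        show "AE v in lborel. norm (LBINT z. norm (case (v, z) of (v, z) \<Rightarrow> indicator Q z * (f (z - e *\<^sub>R v) * mollifier v))) \<le> norm (I * mollifier v)"
        proof (rule AE_I2)
          fix v :: complex
          have "(LBINT z. norm (case (v, z) of (v, z) \<Rightarrow> indicator Q z * (f (z - e *\<^sub>R v) * mollifier v)))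
            = (LBINT z. \<bar>mollifier v\<bar> * (indicator Q z * \<bar>f (z - e *\<^sub>R v)\<bar>))"
            by (simp add: abs_mult mult_ac)
          also have "\<dots> = \<bar>mollifier v\<bar> * (LBINT y. indicator Q (y + e *\<^sub>R v) * \<bar>f y\<bar>)"
            using shift[of "\<lambda>w. \<bar>f w\<bar>" "e *\<^sub>R v"] by simp
          finally have eq: "(LBINT z. norm (case (v, z) of (v, z) \<Rightarrow> indicator Q z * (f (z - e *\<^sub>R v) * mollifier v))) =
            \<bar>mollifier v\<bar> * (LBINT y. indicator Q (y + e *\<^sub>R v) * \<bar>f y\<bar>)" .
          show "norm (LBINT z. norm (case (v, z) of (v, z) \<Rightarrow> indicator Q z * (f (z - e *\<^sub>R v) * mollifier v))) \<le> norm (I * mollifier v)"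
          proof (cases "norm v \<le> 1")
            case True
            have "norm (LBINT y. indicator Q (y + e *\<^sub>R v) * \<bar>f y\<bar>) \<le> I"
              unfolding I_def
            proof (rule Bochner_Integration.integral_norm_bound_integral)
              show "integrable lborel (\<lambda>y. indicator Q (y + e *\<^sub>R v) * \<bar>f y\<bar>)"
                using integrable_abs[OF Qint[OF n1[OF True]]] by (simp add: abs_mult)
              show "norm (indicator Q (y + e *\<^sub>R v) * \<bar>f y\<bar>) \<le> \<bar>indicator (cball 0 (R + 1)) y * f y\<bar>" for y
                using bd[OF n1[OF True], of y] by (simp add: abs_mult)
            qed (rule Iint)
            then show ?thesis unfolding eq by (simp add: abs_mult mult.commute[of "\<bar>mollifier v\<bar>"] mult_right_mono)
          qed (simp add: eq mollifier_zero)
        qed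
      qed measurable
    qed measurable
    have "(LBINT z. indicator Q z * conv f mollifier z) = (LBINT z. LBINT v. indicator Q z * (f (z - e *\<^sub>R v) * mollifier v))"
      by (subst conv_mollifier_scale[OF e]) simp
    also have "\<dots> = (LBINT v. LBINT z. indicator Q z * (f (z - e *\<^sub>R v) * mollifier v))"
      by (rule lborel_pair.Fubini_integral[OF Fint])
    also have "\<dots> = (LBINT v. mollifier v * A e v)"
    proof (rule Bochner_Integration.integral_cong)
      fix v :: complex
      have "(LBINT z. indicator Q z * (f (z - e *\<^sub>R v) * mollifier v)) = (LBINT z. mollifier v * (indicator Q z * f (z - e *\<^sub>R v)))"
        by (simp add: mult_ac)
      then show "(LBINT z. indicator Q z * (f (z - e *\<^sub>R v) * mollifier v)) = mollifier v * A e v"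
        unfolding A_def using shift[of f "e *\<^sub>R v"] by simp
    qed simp
    finally show ?thesis .
  qed
  define en where "en n = 1 / real (Suc n)" for n
  have en: "0 < en n" "en n \<le> 1" for n by (auto simp: en_def)
  have en0: "en \<longlonglongrightarrow> 0" unfolding en_def by (rule LIMSEQ_Suc[OF lim_1_over_n])
  \<comment> \<open>Shifted indicators converge at every point off the boundary of the box, which is
    null because the box is convex.\<close>
  have neg: "AE y in lborel. y \<notin> frontier Q"
  proof -
    have "negligible (frontier Q)" unfolding Q_def by (rule negligible_convex_frontier) simp
    then have "frontier Q \<in> null_sets lebesgue" by (simp add: negligible_iff_null_sets)
    then have "frontier Q \<in> null_sets lborel" by (auto simp: null_sets_def)
    then show ?thesis by (rule AE_not_in)
  qed
  have Alim: "(\<lambda>n. A (en n) v) \<longlonglongrightarrow> (LBINT y. indicator Q y * f y)" if v: "norm v \<le> 1" for v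
    unfolding A_def
  proof (rule integral_dominated_convergence[OF _ _ Iint])
    show "AE y in lborel. (\<lambda>n. indicator Q (y + en n *\<^sub>R v) * f y) \<longlonglongrightarrow> indicator Q y * f y"
      using neg
    proof eventually_elim
      case (elim y)
      have lim: "(\<lambda>n. y + en n *\<^sub>R v) \<longlonglongrightarrow> y"
        using tendsto_add[OF tendsto_const tendsto_scaleR[OF en0 tendsto_const], of y v] by simp
      have "eventually (\<lambda>n. indicator Q (y + en n *\<^sub>R v) = (indicator Q y :: real)) sequentially"
      proof (cases "y \<in> Q")
        case True
        have "open Q" by (simp add: Q_def open_box)
        from topological_tendstoD[OF lim this True] show ?thesis using True by (auto elim!: eventually_mono)
      next
        case False
        then have "y \<in> - closure Q" using elim interior_subset[of Q] by (auto simp: frontier_def)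
        moreover have "open (- closure Q)" by (simp add: open_Compl)
        ultimately have "eventually (\<lambda>n. y + en n *\<^sub>R v \<in> - closure Q) sequentially"
          using topological_tendstoD[OF lim] by blast
        then show ?thesis
          by eventually_elim (use False closure_subset[of Q] in \<open>auto simp: indicator_def\<close>)
      qed
      then have "(\<lambda>n. indicator Q (y + en n *\<^sub>R v) :: real) \<longlonglongrightarrow> indicator Q y" by (rule tendsto_eventually)
      then show ?case by (intro tendsto_mult tendsto_const)
    qed
    have "norm (en n *\<^sub>R v) \<le> 1" for n using en[of n] v by (simp add: mult_le_one)
    from bd[OF this] show "AE y in lborel. norm (indicator Q (y + en n *\<^sub>R v) * f y) \<le> \<bar>indicator (cball 0 (R + 1)) y * f y\<bar>" for n
      by simp
  qed measurable
  have "(\<lambda>n. \<integral>v. mollifier v * A (en n) v \<partial>lborel) \<longlonglongrightarrow> (\<integral>v. mollifier v * (LBINT y. indicator Q y * f y) \<partial>lborel)"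
  proof (rule integral_dominated_convergence)
    show "integrable lborel (\<lambda>v. \<bar>mollifier v\<bar> * I)" using mollifier_integrable by simp
    show "AE v in lborel. (\<lambda>n. mollifier v * A (en n) v) \<longlonglongrightarrow> mollifier v * (LBINT y. indicator Q y * f y)"
    proof (rule AE_I2)
      fix v show "(\<lambda>n. mollifier v * A (en n) v) \<longlonglongrightarrow> mollifier v * (LBINT y. indicator Q y * f y)"
        by (cases "norm v \<le> 1") (auto intro!: tendsto_mult Alim simp: mollifier_zero)
    qed
    show "AE v in lborel. norm (mollifier v * A (en n) v) \<le> \<bar>mollifier v\<bar> * I" for n
    proof (rule AE_I2)
      fix v
      show "norm (mollifier v * A (en n) v) \<le> \<bar>mollifier v\<bar> * I"
      proof (cases "norm v \<le> 1")
        case True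
        then have "norm (en n *\<^sub>R v) \<le> 1" using en[of n] by (simp add: mult_le_one)
        from Abd[OF this] show ?thesis by (simp add: abs_mult mult_left_mono)
      qed (simp add: mollifier_zero)
    qed
    show "(\<lambda>v. mollifier v * A (en n) v) \<in> borel_measurable lborel" for n
      unfolding A_def by measurable
  qed measurable
  \<comment> \<open>Scale invariance makes this a constant sequence, so its value equals the limit
    just computed.\<close>
  moreover have "(\<lambda>n. \<integral>v. mollifier v * A (en n) v \<partial>lborel) = (\<lambda>n. \<integral>z. indicator Q z * conv f mollifier z \<partial>lborel)"
    using main[OF en] by simp
  ultimately have "(LBINT z. indicator Q z * conv f mollifier z) = (\<integral>v. mollifier v * (LBINT y. indicator Q y * f y) \<partial>lborel)"
    by (simp add: LIMSEQ_const_iff)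
  then show ?thesis by (simp add: integral_mollifier Q_def)
qed

text \<open>Weyl's lemma. 2 pi f and the harmonic mollification have equal integrals over all boxes,
  hence agree almost everywhere; 2 pi is the mass of the mollifier and is divided out of the entire
  function.\<close>

lemma AE_eq_Re_entire: "\<exists>g. g holomorphic_on UNIV \<and> (AE z in lborel. f z = Re (g z))"
proof -
  obtain g where g: "g holomorphic_on UNIV" "\<And>z. conv f mollifier z = Re (g z)"
    using conv_mollifier_entire by blast
  have cont: "continuous_on UNIV (\<lambda>z. Re (g z))" using g(1) by (intro continuous_intros holomorphic_on_imp_continuous_on)
  then have [measurable]: "(\<lambda>z. Re (g z)) \<in> borel_measurable borel" by (rule borel_measurable_continuous_onI)
  have gi: "set_integrable lborel (cball 0 R) (\<lambda>z. Re (g z))" for R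
    unfolding set_integrable_def
    by (rule borel_integrable_compact) (auto intro: continuous_on_subset[OF cont])
  define d where "d z = 2 * pi * f z - Re (g z)" for z
  have ii: "integrable lborel (\<lambda>z. indicator (box l u) z * f z)" "integrable lborel (\<lambda>z. indicator (box l u) z * Re (g z))" for l u
    using integrable_lborel_bounded_support[OF f_int, of "box l u"] integrable_lborel_bounded_support[OF gi, of "box l u"]
    by (auto simp: set_integrable_def)
  have d_eq: "indicator (box l u) z * d z = 2 * pi * (indicator (box l u) z * f z) - indicator (box l u) z * Re (g z)" for l u z
    by (simp add: d_def right_diff_distrib mult.left_commute)
  have di: "set_integrable lborel (box l u) d" for l u
    using ii[of l u] by (simp add: set_integrable_def d_eq)
  have "AE z in lborel. d z = 0"
  proof (rule AE_zero_if_integrals_over_boxes_zero)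
    show "d \<in> borel_measurable borel" unfolding d_def by measurable
    fix l u :: complex
    have "(LINT z:box l u|lborel. d z) = 2 * pi * (LBINT z. indicator (box l u) z * f z) - (LBINT z. indicator (box l u) z * Re (g z))"
      using ii[of l u] by (simp add: set_lebesgue_integral_def d_eq)
    then show "(LINT z:box l u|lborel. d z) = 0"
      using integral_box_conv_mollifier[of l u] by (simp add: g(2))
  qed (rule di)
  then have "AE z in lborel. f z = Re (g z / of_real (2 * pi))"
    by eventually_elim (simp add: d_def Re_divide_of_real field_simps del: of_real_mult)
  moreover have "(\<lambda>z. g z / of_real (2 * pi)) holomorphic_on UNIV"
    using g(1) by (intro holomorphic_intros) auto
  ultimately show ?thesis by blast
qed

end

section \<open>The periodic Green function\<close>

lemma integrable_lborel_product:
  fixes g :: "'a::euclidean_space \<Rightarrow> real" and h :: "'b::euclidean_space \<Rightarrow> real"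
  assumes g: "integrable lborel g" and h: "integrable lborel h"
  shows "integrable lborel2 (\<lambda>p. g (fst p) * h (snd p))"
proof (rule lborel_pair.Fubini_integrable)
  have [measurable]: "g \<in> borel_measurable borel" "h \<in> borel_measurable borel"
    using borel_measurable_integrable[OF g] borel_measurable_integrable[OF h] by simp_all
  show "(\<lambda>p. g (fst p) * h (snd p)) \<in> borel_measurable lborel2" by measurable
  show "integrable lborel (\<lambda>x. \<integral>y. norm (g (fst (x, y)) * h (snd (x, y))) \<partial>lborel)"
    using g by (simp add: abs_mult)
  show "AE x in lborel. integrable lborel (\<lambda>y. g (fst (x, y)) * h (snd (x, y)))"
    using h by simp
qed

text \<open>
  The kernel is the periodic Green function of \<open>d\<^sup>2/d\<psi>\<^sup>2 + a\<^sup>2\<close>. In the resonant case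
  \<open>sin (a * pi) = 0\<close> the convention \<open>x / 0 = 0\<close> makes the coefficient \<open>cot (a * pi)\<close> vanish, which
  leaves a fundamental solution that is periodic up to terms killed by the orthogonality condition.
\<close>
definition circle_kernel :: "real \<Rightarrow> real \<Rightarrow> real" where
  "circle_kernel a x = (cot (a * pi) * cos (a * x) + sin (a * x)) / (2 * a)"

definition circle_kernel' :: "real \<Rightarrow> real \<Rightarrow> real" where
  "circle_kernel' a x = (cos (a * x) - cot (a * pi) * sin (a * x)) / 2"

lemma circle_kernel_DERIV:
  assumes "a \<noteq> 0"
  shows "(circle_kernel a has_real_derivative circle_kernel' a x) (at x)"
    and "(circle_kernel' a has_real_derivative (- a\<^sup>2 * circle_kernel a x)) (at x)"
  unfolding circle_kernel_def[abs_def] circle_kernel'_def[abs_def]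
  using assms by (auto intro!: derivative_eq_intros simp: field_simps power2_eq_square)

text \<open>This constant depends on \<open>a\<close> only; it reappears in the choice of
  \<delta>.\<close>

lemma circle_kernel_bound:
  assumes "a > 0"
  shows "\<bar>circle_kernel a x\<bar> \<le> (\<bar>cot (a * pi)\<bar> + 1) / (2 * a)"
proof -
  have "\<bar>cot (a * pi) * cos (a * x) + sin (a * x)\<bar> \<le> \<bar>cot (a * pi) * cos (a * x)\<bar> + \<bar>sin (a * x)\<bar>"
    by (rule abs_triangle_ineq)
  also have "\<bar>cot (a * pi) * cos (a * x)\<bar> \<le> \<bar>cot (a * pi)\<bar> * 1"
    unfolding abs_mult by (rule mult_left_mono) auto
  finally have "\<bar>cot (a * pi) * cos (a * x) + sin (a * x)\<bar> \<le> \<bar>cot (a * pi)\<bar> + 1"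
    using abs_sin_le_one[of "a * x"] by linarith
  then show ?thesis using assms by (simp add: circle_kernel_def divide_right_mono)
qed

lemma continuous_circle_kernel: "continuous_on S (circle_kernel a)"
  unfolding circle_kernel_def[abs_def] divide_inverse by (intro continuous_intros)

lemma circle_kernel_measurable [measurable]: "circle_kernel a \<in> borel_measurable borel"
  by (intro borel_measurable_continuous_onI continuous_circle_kernel)

text \<open>Here the kernel is cos(a (x - pi)) / (2a sin(a pi)), even about pi, and its derivative
  is odd about pi. So the boundary terms at 0 and 2 pi in Green's identity cancel.\<close>

lemma circle_kernel_nonresonant:
  assumes "a \<noteq> 0" "sin (a * pi) \<noteq> 0"
  shows "circle_kernel a (2 * pi - x) = circle_kernel a x"
    and "circle_kernel' a (2 * pi - x) + circle_kernel' a x = 0"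
proof -
  have k: "circle_kernel a x = cos (a * x - a * pi) / (2 * a * sin (a * pi))" for x
    using assms by (simp add: circle_kernel_def cot_def cos_diff field_simps)
  have k': "circle_kernel' a x = - sin (a * x - a * pi) / (2 * sin (a * pi))" for x
    using assms by (simp add: circle_kernel'_def cot_def sin_diff field_simps)
  have e: "a * (2 * pi - x) - a * pi = - (a * x - a * pi)" by (simp add: algebra_simps)
  show "circle_kernel a (2 * pi - x) = circle_kernel a x"
    "circle_kernel' a (2 * pi - x) + circle_kernel' a x = 0"
    unfolding k k' e cos_minus sin_minus by simp_all
qed

text \<open>The failure of periodicity is exactly a multiple of sin(a x) and cos(a x), the solutions
  of the homogeneous equation; orthogonality of the data will remove these terms.\<close>

lemma circle_kernel_resonant:
  assumes "a \<noteq> 0" "sin (a * pi) = 0"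
  shows "circle_kernel a (2 * pi - x) - circle_kernel a x = - sin (a * x) / a"
    and "circle_kernel' a (2 * pi - x) + circle_kernel' a x = cos (a * x)"
proof -
  have c: "cot (a * pi) = 0" using assms by (simp add: cot_def)
  have "sin (2 * (a * pi)) = 0" "cos (2 * (a * pi)) = 1"
    using assms by (simp_all add: sin_double cos_double_sin)
  moreover have "a * (2 * pi - x) = 2 * (a * pi) - a * x" by (simp add: algebra_simps)
  ultimately have "sin (a * (2 * pi - x)) = - sin (a * x)" "cos (a * (2 * pi - x)) = cos (a * x)"
    by (simp_all add: sin_diff cos_diff)
  then show "circle_kernel a (2 * pi - x) - circle_kernel a x = - sin (a * x) / a"
    "circle_kernel' a (2 * pi - x) + circle_kernel' a x = cos (a * x)"
    using assms(1) by (simp_all add: circle_kernel_def circle_kernel'_def c field_simps)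
qed

text \<open>Lagrange's identity on both sides of the diagonal x = y. The kernel in |x - y| is
  continuous there, while its slope jumps by 1, which reproduces \<open>z0 y\<close>; periodicity of
  the test function merges the terms from the two endpoints.\<close>

lemma circle_green_identity:
  assumes a: "a \<noteq> 0"
    and z0: "\<And>x. (z0 has_real_derivative z1 x) (at x)"
    and z1: "\<And>x. (z1 has_real_derivative z2 x) (at x)"
    and z2: "continuous_on UNIV z2"
    and per: "z0 (2 * pi) = z0 0" "z1 (2 * pi) = z1 0"
    and y: "0 < y" "y < 2 * pi"
  shows "has_bochner_integral lborel
    (\<lambda>x. arc x * (circle_kernel a \<bar>x - y\<bar> * (z2 x + a\<^sup>2 * z0 x)))
    (z0 y + (circle_kernel a (2 * pi - y) - circle_kernel a y) * z1 0
      - (circle_kernel' a (2 * pi - y) + circle_kernel' a y) * z0 0)"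
proof -
  \<comment> \<open>Wronskian-type primitives of the integrand on [0, y] and on [y, 2 pi]; their
    derivatives lose the first-order terms because the kernel solves k'' = -a^2 k.\<close>
  define U where "U x = circle_kernel a (y - x) * z1 x + circle_kernel' a (y - x) * z0 x" for x
  define V where "V x = circle_kernel a (x - y) * z1 x - circle_kernel' a (x - y) * z0 x" for x
  define u where "u x = circle_kernel a (y - x) * (z2 x + a\<^sup>2 * z0 x)" for x
  define v where "v x = circle_kernel a (x - y) * (z2 x + a\<^sup>2 * z0 x)" for x
  note dk = DERIV_chain2[OF circle_kernel_DERIV(1)[OF a]] DERIV_chain2[OF circle_kernel_DERIV(2)[OF a]]
  have dU: "(U has_real_derivative u x) (at x within S)" for x S
    unfolding U_def u_def by (rule has_field_derivative_at_within) (auto intro!: derivative_eq_intros dk z0 z1 simp: algebra_simps)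
  have dV: "(V has_real_derivative v x) (at x within S)" for x S
    unfolding V_def v_def by (rule has_field_derivative_at_within) (auto intro!: derivative_eq_intros dk z0 z1 simp: algebra_simps)
  have c0: "continuous_on UNIV z0" using z0 by (intro DERIV_continuous_on) blast
  have ck: "continuous_on S (\<lambda>x. circle_kernel a (g x))" if "continuous_on S g" for S and g :: "real \<Rightarrow> real"
    by (rule continuous_on_compose2[OF continuous_circle_kernel[of UNIV] that]) simp
  have cu: "continuous_on S u" "continuous_on S v" for S
    unfolding u_def v_def by (intro continuous_intros ck continuous_on_subset[OF c0] continuous_on_subset[OF z2]; simp)+
  have 1: "has_bochner_integral lborel (\<lambda>x. indicator {0..y} x *\<^sub>R u x) (U y - U 0)"
    by (rule has_bochner_integral_FTC_Icc) (use y dU cu in \<open>auto simp: has_real_derivative_iff_has_vector_derivative[symmetric]\<close>)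
  have 2: "has_bochner_integral lborel (\<lambda>x. indicator {y..2*pi} x *\<^sub>R v x) (V (2 * pi) - V y)"
    by (rule has_bochner_integral_FTC_Icc) (use y dV cu in \<open>auto simp: has_real_derivative_iff_has_vector_derivative[symmetric]\<close>)
  have m: "(\<lambda>x. arc x * (circle_kernel a \<bar>x - y\<bar> * (z2 x + a\<^sup>2 * z0 x))) \<in> borel_measurable lborel"
  proof -
    have [measurable]: "z2 \<in> borel_measurable borel" "z0 \<in> borel_measurable borel"
      using z2 c0 by (auto intro: borel_measurable_continuous_onI)
    show ?thesis by measurable
  qed
  have "has_bochner_integral lborel
    (\<lambda>x. arc x * (circle_kernel a \<bar>x - y\<bar> * (z2 x + a\<^sup>2 * z0 x)))
    ((U y - U 0) + (V (2 * pi) - V y))"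
  proof (rule has_bochner_integral_cong_AE[THEN iffD1, OF _ m _ has_bochner_integral_add[OF 1 2]])
    show "(\<lambda>x. indicator {0..y} x *\<^sub>R u x + indicator {y..2 * pi} x *\<^sub>R v x) \<in> borel_measurable lborel"
      using has_bochner_integral_add[OF 1 2] by (auto simp: has_bochner_integral_iff)
    show "AE x in lborel. indicator {0..y} x *\<^sub>R u x + indicator {y..2 * pi} x *\<^sub>R v x =
        arc x * (circle_kernel a \<bar>x - y\<bar> * (z2 x + a\<^sup>2 * z0 x))"
      using AE_lborel_singleton[of 0] AE_lborel_singleton[of y] AE_lborel_singleton[of "2 * pi"]
      by eventually_elim (use y in \<open>auto simp: indicator_def u_def v_def abs_if\<close>)
  qed
  \<comment> \<open>The two one-sided slopes contribute 1/2 each to the coefficient of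
    \<open>z0 y\<close>.\<close>
  moreover have "circle_kernel' a 0 = 1 / 2" by (simp add: circle_kernel'_def)
  then have "(U y - U 0) + (V (2 * pi) - V y) = z0 y + (circle_kernel a (2 * pi - y) - circle_kernel a y) * z1 0
      - (circle_kernel' a (2 * pi - y) + circle_kernel' a y) * z0 0"
    unfolding U_def V_def per by (simp add: algebra_simps)
  ultimately show ?thesis by simp
qed

text \<open>\<open>c\<close> stands for the field on the circle minus its mean, extended by 0
  outside the open period. Integrability is enough for the equation; square integrability enters
  only through the size of \<open>c\<close>.\<close>

locale circle_ode =
  fixes a :: real and c :: "real \<Rightarrow> real"
  assumes a_pos: "a > 0"
    and c_int: "integrable lborel c"
    and c_supp: "\<And>y. \<not> (0 < y \<and> y < 2 * pi) \<Longrightarrow> c y = 0"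
    and c_orth: "sin (a * pi) = 0 \<Longrightarrow> (LBINT y. c y * cos (a * y)) = 0"
      "sin (a * pi) = 0 \<Longrightarrow> (LBINT y. c y * sin (a * y)) = 0"
begin

definition P :: "real \<Rightarrow> real" where
  "P \<psi> = (LBINT y. c y * circle_kernel a \<bar>\<psi> - y\<bar>)"

lemma c_meas [measurable]: "c \<in> borel_measurable borel"
  using borel_measurable_integrable[OF c_int] by simp

lemma P_meas [measurable]: "P \<in> borel_measurable borel"
  unfolding P_def[abs_def] by measurable

text \<open>A uniform bound by the first-power norm of \<open>c\<close>; it is the only quantitative
  information about \<open>P\<close> that the sign of the potential requires.\<close>

lemma P_bound: "\<bar>P \<psi>\<bar> \<le> (\<bar>cot (a * pi)\<bar> + 1) / (2 * a) * (LBINT y. \<bar>c y\<bar>)"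
proof -
  let ?K = "(\<bar>cot (a * pi)\<bar> + 1) / (2 * a)"
  have "norm (P \<psi>) \<le> (LBINT y. ?K * \<bar>c y\<bar>)"
    unfolding P_def
  proof (rule Bochner_Integration.integral_norm_bound_integral)
    have b: "norm (c y * circle_kernel a \<bar>\<psi> - y\<bar>) \<le> ?K * \<bar>c y\<bar>" for y
      using mult_right_mono[OF circle_kernel_bound[OF a_pos], of "\<bar>c y\<bar>" "\<bar>\<psi> - y\<bar>"] by (simp add: abs_mult mult.commute)
    show i: "integrable lborel (\<lambda>y. ?K * \<bar>c y\<bar>)" using c_int by simp
    show "integrable lborel (\<lambda>y. c y * circle_kernel a \<bar>\<psi> - y\<bar>)"
    proof (rule Bochner_Integration.integrable_bound[OF i])
      show "AE y in lborel. norm (c y * circle_kernel a \<bar>\<psi> - y\<bar>) \<le> norm (?K * \<bar>c y\<bar>)"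
        using a_pos by (intro AE_I2 order_trans[OF b]) simp
    qed measurable
    show "norm (c y * circle_kernel a \<bar>\<psi> - y\<bar>) \<le> ?K * \<bar>c y\<bar>" for y by (rule b)
  qed
  then show ?thesis by simp
qed

text \<open>\<open>P\<close> solves P'' + a^2 P = c when tested with periodic functions. Fubini
  moves the integration onto the kernel, where Green's identity returns \<open>z0 y\<close> and two
  boundary defects.\<close>

lemma weak_ode:
  assumes z0: "\<And>x. (z0 has_real_derivative z1 x) (at x)"
    and z1: "\<And>x. (z1 has_real_derivative z2 x) (at x)"
    and z2: "continuous_on UNIV z2"
    and per: "z0 (2 * pi) = z0 0" "z1 (2 * pi) = z1 0"
  shows "(LBINT \<psi>. arc \<psi> * (P \<psi> * (z2 \<psi> + a\<^sup>2 * z0 \<psi>))) = (LBINT y. c y * z0 y)"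
proof -
  let ?K = "(\<bar>cot (a * pi)\<bar> + 1) / (2 * a)"
  let ?w = "\<lambda>x. z2 x + a\<^sup>2 * z0 x"
  have c0: "continuous_on UNIV z0" using z0 by (intro DERIV_continuous_on) blast
  have [measurable]: "z2 \<in> borel_measurable borel" "z0 \<in> borel_measurable borel"
    using z2 c0 by (auto intro: borel_measurable_continuous_onI)
  have "set_integrable lborel {0..2*pi} ?w"
    unfolding set_integrable_def by (rule borel_integrable_compact) (auto intro!: continuous_intros continuous_on_subset[OF c0] continuous_on_subset[OF z2])
  then have wi: "integrable lborel (\<lambda>x. arc x * ?w x)"
    using set_integrable_subset[of lborel "{0..2*pi}" ?w "{0<..<2*pi}"] by (force simp: set_integrable_def)
  have cz: "integrable lborel (\<lambda>y. c y * g y)" if g: "continuous_on UNIV g" for g :: "real \<Rightarrow> real"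
  proof -
    have "bounded (g ` {0..2*pi})"
      by (intro compact_imp_bounded compact_continuous_image continuous_on_subset[OF g]) auto
    then obtain M where M: "\<forall>y\<in>g ` {0..2*pi}. norm y \<le> M" unfolding bounded_iff ..
    have [measurable]: "g \<in> borel_measurable borel" using g by (rule borel_measurable_continuous_onI)
    show ?thesis
    proof (rule Bochner_Integration.integrable_bound)
      show "integrable lborel (\<lambda>y. M * c y)" using c_int by simp
      show "AE y in lborel. norm (c y * g y) \<le> norm (M * c y)"
      proof (rule AE_I2)
        fix y
        show "norm (c y * g y) \<le> norm (M * c y)"
        proof (cases "0 < y \<and> y < 2 * pi")
          case True
          then have "g y \<in> g ` {0..2*pi}" by (intro imageI) auto
          from M[rule_format, OF this] have "\<bar>g y\<bar> \<le> \<bar>M\<bar>" by simp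
          then show ?thesis by (simp add: abs_mult mult.commute[of "\<bar>M\<bar>"] mult_left_mono)
        qed (simp add: c_supp)
      qed
    qed measurable
  qed
  have Fint: "integrable lborel2 (\<lambda>(y, \<psi>). arc \<psi> * (c y * circle_kernel a \<bar>\<psi> - y\<bar> * ?w \<psi>))"
  proof (rule Bochner_Integration.integrable_bound)
    show "integrable lborel2 (\<lambda>p. ?K * (c (fst p) * (arc (snd p) * ?w (snd p))))"
      using integrable_lborel_product[OF c_int wi] by simp
    show "AE p in lborel2. norm (case p of (y, \<psi>) \<Rightarrow> arc \<psi> * (c y * circle_kernel a \<bar>\<psi> - y\<bar> * ?w \<psi>))
      \<le> norm (?K * (c (fst p) * (arc (snd p) * ?w (snd p))))"
    proof (rule AE_I2, clarify)
      fix y \<psi> :: real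
      have "\<bar>circle_kernel a \<bar>\<psi> - y\<bar>\<bar> * \<bar>c y * (arc \<psi> * ?w \<psi>)\<bar> \<le> ?K * \<bar>c y * (arc \<psi> * ?w \<psi>)\<bar>"
        by (intro mult_right_mono circle_kernel_bound a_pos) simp
      moreover have "?K \<ge> 0" using a_pos by simp
      ultimately show "norm (arc \<psi> * (c y * circle_kernel a \<bar>\<psi> - y\<bar> * ?w \<psi>))
        \<le> norm (?K * (c (fst (y, \<psi>)) * (arc (snd (y, \<psi>)) * ?w (snd (y, \<psi>)))))"
        by (simp only: real_norm_def abs_mult fst_conv snd_conv abs_of_nonneg[OF \<open>?K \<ge> 0\<close>]) (simp add: mult_ac)
    qed
  qed measurable
  have "(LBINT \<psi>. arc \<psi> * (P \<psi> * ?w \<psi>))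
    = (LBINT \<psi>. LBINT y. arc \<psi> * (c y * circle_kernel a \<bar>\<psi> - y\<bar> * ?w \<psi>))"
    by (simp add: P_def)
  also have "\<dots> = (LBINT y. LBINT \<psi>. arc \<psi> * (c y * circle_kernel a \<bar>\<psi> - y\<bar> * ?w \<psi>))"
    by (rule lborel_pair.Fubini_integral[OF Fint])
  also have "\<dots> = (LBINT y. c y * z0 y + z1 0 * (c y * (circle_kernel a (2 * pi - y) - circle_kernel a y))
      - z0 0 * (c y * (circle_kernel' a (2 * pi - y) + circle_kernel' a y)))"
  proof (rule Bochner_Integration.integral_cong)
    fix y :: real
    show "(LBINT \<psi>. arc \<psi> * (c y * circle_kernel a \<bar>\<psi> - y\<bar> * ?w \<psi>))
      = c y * z0 y + z1 0 * (c y * (circle_kernel a (2 * pi - y) - circle_kernel a y))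
      - z0 0 * (c y * (circle_kernel' a (2 * pi - y) + circle_kernel' a y))"
    proof (cases "0 < y \<and> y < 2 * pi")
      case True
      have "(LBINT \<psi>. arc \<psi> * (c y * circle_kernel a \<bar>\<psi> - y\<bar> * ?w \<psi>))
        = (LBINT \<psi>. c y * (arc \<psi> * (circle_kernel a \<bar>\<psi> - y\<bar> * ?w \<psi>)))"
        by (simp only: mult_ac)
      also have "\<dots> = c y * (LBINT \<psi>. arc \<psi> * (circle_kernel a \<bar>\<psi> - y\<bar> * ?w \<psi>))"
        by (rule integral_mult_right_zero)
      also have "(LBINT \<psi>. arc \<psi> * (circle_kernel a \<bar>\<psi> - y\<bar> * ?w \<psi>))
        = z0 y + (circle_kernel a (2 * pi - y) - circle_kernel a y) * z1 0
          - (circle_kernel' a (2 * pi - y) + circle_kernel' a y) * z0 0"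
        by (rule has_bochner_integral_integral_eq[OF circle_green_identity[OF _ z0 z1 z2 per]]) (use True a_pos in auto)
      finally show ?thesis by (simp only: distrib_left right_diff_distrib mult_ac)
    qed (simp add: c_supp)
  qed simp
  also have "\<dots> = (LBINT y. c y * z0 y)"
  \<comment> \<open>Off resonance the defects vanish pointwise; at resonance they are multiples of
    sin(a y) and cos(a y), and vanish only after integration against \<open>c\<close>.\<close>
  proof (cases "sin (a * pi) = 0")
    case False
    then show ?thesis using circle_kernel_nonresonant[of a] a_pos by simp
  next
    case True
    have i: "integrable lborel (\<lambda>y. c y * z0 y)" "integrable lborel (\<lambda>y. c y * sin (a * y))" "integrable lborel (\<lambda>y. c y * cos (a * y))"
      by (intro cz c0 continuous_intros)+
    have "(LBINT y. c y * z0 y + z1 0 * (c y * (circle_kernel a (2 * pi - y) - circle_kernel a y))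
      - z0 0 * (c y * (circle_kernel' a (2 * pi - y) + circle_kernel' a y)))
      = (LBINT y. c y * z0 y + (- z1 0 / a) * (c y * sin (a * y)) - z0 0 * (c y * cos (a * y)))"
      using a_pos True by (simp add: circle_kernel_resonant)
    also have "\<dots> = (LBINT y. c y * z0 y)"
      using i c_orth[OF True] by simp
    finally show ?thesis .
  qed
  finally show ?thesis .
qed

end

section \<open>The homogeneous potential\<close>

lemma log_polar_measurable_pair [measurable]: "log_polar \<in> borel_measurable (borel \<Otimes>\<^sub>M borel)"
  by (simp add: borel_prod)

lemma tendsto_exp_mult_at_bot: "b > 0 \<Longrightarrow> ((\<lambda>t::real. exp (b * t)) \<longlongrightarrow> 0) at_bot"
  by (rule filterlim_compose[OF exp_at_bot filterlim_tendsto_pos_mult_at_bot[OF tendsto_const _ filterlim_ident]])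

lemma integrable_exp_tail:
  fixes b T :: real
  assumes "b > 0"
  shows "integrable lborel (\<lambda>t. indicator {..T} t * exp (b * t))"
proof -
  have "set_integrable lborel (einterval (-\<infinity>) (ereal (T + 1))) (\<lambda>t. exp (b * t))"
  proof (rule interval_integral_FTC_nonneg(1))
    show "((\<lambda>t. exp (b * t) / b) has_real_derivative exp (b * x)) (at x)" for x
      using assms by (auto intro!: derivative_eq_intros)
    from tendsto_divide[OF tendsto_exp_mult_at_bot[OF assms] tendsto_const[of b]]
    have "((\<lambda>t. exp (b * t) / b) \<longlongrightarrow> 0) at_bot" using assms by simp
    then show "(((\<lambda>t. exp (b * t) / b) \<circ> real_of_ereal) \<longlongrightarrow> 0) (at_right (-\<infinity>))"
      by (simp add: ereal_tendsto_simps1)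
    show "(((\<lambda>t. exp (b * t) / b) \<circ> real_of_ereal) \<longlongrightarrow> exp (b * (T + 1)) / b) (at_left (ereal (T + 1)))"
      unfolding ereal_tendsto_simps1 using assms by (intro tendsto_intros) auto
  qed (auto intro!: continuous_intros)
  moreover have "{..T} \<subseteq> einterval (-\<infinity>) (ereal (T + 1))" by (auto simp: einterval_def)
  ultimately have "set_integrable lborel {..T} (\<lambda>t. exp (b * t))"
    using set_integrable_subset by (metis atMost_borel sets_lborel)
  then show ?thesis by (simp add: set_integrable_def)
qed

text \<open>In log-polar coordinates the radial factor is e^((k + 2) t) on a half-line to the left,
  integrable because k > -2. For the field this is the condition s > -2.\<close>

lemma set_integrable_homogeneous:
  fixes h :: "real \<Rightarrow> real"
  assumes "k > -2" and [measurable]: "h \<in> borel_measurable borel"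
    and h: "integrable lborel (\<lambda>\<psi>. arc \<psi> * h \<psi>)"
  shows "set_integrable lborel (cball 0 R) (\<lambda>z::complex. norm z powr k * h (Arg2pi z))"
proof -
  define R' where "R' = max R 1"
  have "R' > 0" by (simp add: R'_def)
  have [measurable]: "cball (0::complex) R' \<in> sets borel" by simp
  have "integrable lborel (\<lambda>z::complex. indicator (cball 0 R') z * (norm z powr k * h (Arg2pi z)))"
  proof (subst integrable_log_polar)
    have eq: "(exp (2 * fst p) * arc (snd p)) *\<^sub>R (indicator (cball 0 R') (log_polar p) * (norm (log_polar p) powr k * h (Arg2pi (log_polar p))))
      = (indicator {..ln R'} (fst p) * exp ((k + 2) * fst p)) * (arc (snd p) * h (snd p))" for p
    proof (cases "0 < snd p \<and> snd p < 2 * pi")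
      case True
      have "exp (fst p) \<le> R' \<longleftrightarrow> fst p \<le> ln R'" using \<open>R' > 0\<close> by (simp add: ln_ge_iff)
      moreover have "exp (2 * fst p) * exp (fst p) powr k = exp ((k + 2) * fst p)"
        by (simp add: powr_def exp_add[symmetric] algebra_simps)
      ultimately show ?thesis using True Arg2pi_log_polar[of p] by (simp add: indicator_def)
    qed (auto simp: indicator_def)
    show "integrable lborel2 (\<lambda>p. (exp (2 * fst p) * arc (snd p)) *\<^sub>R (indicator (cball 0 R') (log_polar p) * (norm (log_polar p) powr k * h (Arg2pi (log_polar p)))))"
      unfolding eq by (rule integrable_lborel_product[OF integrable_exp_tail h]) (use assms in simp)
  qed measurable
  then have "set_integrable lborel (cball 0 R') (\<lambda>z::complex. norm z powr k * h (Arg2pi z))"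
    by (simp add: set_integrable_def)
  then show ?thesis
    by (rule set_integrable_subset) (auto simp: R'_def)
qed

lemma
  assumes "smooth f" "\<And>z. norm z > R \<Longrightarrow> f z = 0" "norm z > R"
  shows rad_zero: "rad f z = 0" and ang_zero: "ang f z = 0"
proof -
  show "rad f z = 0" "ang f z = 0"
    using px_zero[OF assms(1) open_norm_gt[of R]] py_zero[OF assms(1) open_norm_gt[of R]] assms(2,3) by (auto simp: rad_def ang_def)
qed

lemma exp_gt_if_gt_ln_max: "t > ln (max R 1) \<Longrightarrow> exp t > R" for t R :: real
  by (smt (verit) exp_less_cancel_iff exp_ln)

lemma integrable_polar_test:
  fixes h :: "real \<Rightarrow> real"
  assumes "a > 0" "smooth g" "\<And>z. norm z > R \<Longrightarrow> g z = 0" and [measurable]: "h \<in> borel_measurable borel"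
    and h: "integrable lborel (\<lambda>\<psi>. arc \<psi> * h \<psi>)"
  shows "integrable lborel2 (\<lambda>p. (exp (a * fst p) * g (log_polar p)) * (arc (snd p) * h (snd p)))"
proof -
  obtain M where M: "M \<ge> 0" "\<And>z. \<bar>g z\<bar> \<le> M" using smooth_bounded[of g R] assms(2,3) by metis
  have [measurable]: "g \<in> borel_measurable borel" by (rule smooth_measurable) fact
  define T where "T = ln (max R 1)"
  have T: "g (log_polar p) = 0" if "fst p > T" for p
    using that exp_gt_if_gt_ln_max[of R "fst p"] by (intro assms(3)) (simp add: T_def)
  show ?thesis
  proof (rule Bochner_Integration.integrable_bound)
    show "integrable lborel2 (\<lambda>p. M * ((indicator {..T} (fst p) * exp (a * fst p)) * (arc (snd p) * h (snd p))))"
      using integrable_lborel_product[OF integrable_exp_tail[OF assms(1)] h, of T] by simp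
    show "AE p in lborel2. norm ((exp (a * fst p) * g (log_polar p)) * (arc (snd p) * h (snd p)))
      \<le> norm (M * ((indicator {..T} (fst p) * exp (a * fst p)) * (arc (snd p) * h (snd p))))"
    proof (rule AE_I2)
      fix p :: "real \<times> real"
      have "\<bar>exp (a * fst p) * g (log_polar p)\<bar> \<le> M * (indicator {..T} (fst p) * exp (a * fst p))"
        using M(2)[of "log_polar p"] T[of p] by (cases "fst p \<le> T") (auto simp: abs_mult mult.commute)
      from mult_right_mono[OF this, of "\<bar>arc (snd p) * h (snd p)\<bar>"]
      show "norm ((exp (a * fst p) * g (log_polar p)) * (arc (snd p) * h (snd p)))
      \<le> norm (M * ((indicator {..T} (fst p) * exp (a * fst p)) * (arc (snd p) * h (snd p))))"
        using M(1) by (simp add: abs_mult mult_ac)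
    qed
  qed measurable
qed

text \<open>e^(at) (rad \<eta> - a \<eta>) is a primitive of the difference of the integrands. It
  vanishes for large t by compact support and tends to 0 at minus infinity because a > 0; so the
  singular origin leaves no boundary term.\<close>

lemma radial_integration_by_parts:
  assumes a: "a > 0" and \<eta>: "smooth \<eta>" "\<And>z. norm z > R \<Longrightarrow> \<eta> z = 0"
  shows "(LBINT t. exp (a * t) * rad (rad \<eta>) (log_polar (t, \<psi>))) = (LBINT t. exp (a * t) * (a\<^sup>2 * \<eta> (log_polar (t, \<psi>))))"
proof -
  have s1: "smooth (rad \<eta>)" and s2: "smooth (rad (rad \<eta>))" using \<eta> by (auto intro!: smooth_rad)
  have r1: "rad \<eta> z = 0" if "norm z > R" for z using rad_zero[OF \<eta> that] .
  have r2: "rad (rad \<eta>) z = 0" if "norm z > R" for z using rad_zero[OF s1 r1 that] .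
  define T where "T = ln (max R 1)"
  have T: "norm (log_polar (t, \<psi>)) > R" if "t > T" for t
    using that exp_gt_if_gt_ln_max[of R t] by (simp add: T_def)
  have lpm [measurable]: "(\<lambda>t. log_polar (t, \<psi>)) \<in> borel_measurable borel" by measurable
  have int: "integrable lborel (\<lambda>t. exp (a * t) * g (log_polar (t, \<psi>)))" if g: "smooth g" "\<And>z. norm z > R \<Longrightarrow> g z = 0" for g
  proof -
    obtain M where M: "M \<ge> 0" "\<And>z. \<bar>g z\<bar> \<le> M" using smooth_bounded[of g R] g by metis
    have [measurable]: "g \<in> borel_measurable borel" by (rule smooth_measurable) fact
    show ?thesis
    proof (rule Bochner_Integration.integrable_bound)
      show "integrable lborel (\<lambda>t. M * (indicator {..T} t * exp (a * t)))" using integrable_exp_tail[OF a] by simp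
      show "AE t in lborel. norm (exp (a * t) * g (log_polar (t, \<psi>))) \<le> norm (M * (indicator {..T} t * exp (a * t)))"
      proof (rule AE_I2)
        fix t
        show "norm (exp (a * t) * g (log_polar (t, \<psi>))) \<le> norm (M * (indicator {..T} t * exp (a * t)))"
          using M(1) M(2)[of "log_polar (t, \<psi>)"] g(2)[OF T[of t]] by (cases "t \<le> T") (auto simp: abs_mult mult.commute)
      qed
    qed measurable
  qed
  define F where "F t = exp (a * t) * (rad \<eta> (log_polar (t, \<psi>)) - a * \<eta> (log_polar (t, \<psi>)))" for t
  define f where "f t = exp (a * t) * (rad (rad \<eta>) (log_polar (t, \<psi>)) - a\<^sup>2 * \<eta> (log_polar (t, \<psi>)))" for t
  have int2: "integrable lborel (\<lambda>t. exp (a * t) * (a\<^sup>2 * \<eta> (log_polar (t, \<psi>))))"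
    using int[OF smooth_mult[OF smooth_const[of "a\<^sup>2"] \<eta>(1)]] \<eta>(2) by simp
  have fi: "integrable lborel f"
    unfolding f_def using int[OF s2 r2] int2 by (simp add: right_diff_distrib)
  have "(LBINT t=-\<infinity>..\<infinity>. f t) = 0 - 0"
  proof (rule interval_integral_FTC_integrable)
    fix t
    have "(F has_real_derivative f t) (at t)"
      unfolding F_def f_def
      by (auto intro!: derivative_eq_intros DERIV_log_polar_t \<eta> s1 simp: algebra_simps power2_eq_square)
    then show "(F has_vector_derivative f t) (at t)"
      by (simp add: has_real_derivative_iff_has_vector_derivative)
    have "isCont (\<lambda>t. rad (rad \<eta>) (log_polar (t, \<psi>))) t" "isCont (\<lambda>t. \<eta> (log_polar (t, \<psi>))) t"
      using DERIV_isCont[OF DERIV_log_polar_t[OF s2]] DERIV_isCont[OF DERIV_log_polar_t[OF \<eta>(1)]] by blast+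
    then show "isCont f t" unfolding f_def by (intro continuous_intros)
  next
    show "set_integrable lborel (einterval (-\<infinity>) \<infinity>) f" using fi by (simp add: set_integrable_def einterval_def)
    have "eventually (\<lambda>t. F t = 0) at_top"
      using eventually_gt_at_top[of T] by eventually_elim (use \<eta>(2) r1 T in \<open>simp add: F_def\<close>)
    then have "(F \<longlongrightarrow> 0) at_top" by (rule tendsto_eventually)
    then show "((F \<circ> real_of_ereal) \<longlongrightarrow> 0) (at_left \<infinity>)" by (simp add: ereal_tendsto_simps1)
    obtain M0 where M0: "M0 \<ge> 0" "\<And>z. \<bar>\<eta> z\<bar> \<le> M0" using smooth_bounded[of \<eta> R] \<eta> by metis
    obtain M1 where M1: "M1 \<ge> 0" "\<And>z. \<bar>rad \<eta> z\<bar> \<le> M1" using smooth_bounded[of "rad \<eta>" R] s1 r1 by metis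
    have "\<bar>F t\<bar> \<le> exp (a * t) * (M1 + a * M0)" for t
    proof -
      have "\<bar>rad \<eta> (log_polar (t, \<psi>)) - a * \<eta> (log_polar (t, \<psi>))\<bar> \<le> \<bar>rad \<eta> (log_polar (t, \<psi>))\<bar> + \<bar>a * \<eta> (log_polar (t, \<psi>))\<bar>"
        by (rule abs_triangle_ineq4)
      also have "\<dots> \<le> M1 + a * M0"
        using M1(2) M0(2) a by (intro add_mono) (auto simp: abs_mult intro: mult_left_mono)
      finally show ?thesis by (simp add: F_def abs_mult mult_left_mono)
    qed
    moreover have "((\<lambda>t. exp (a * t) * (M1 + a * M0)) \<longlongrightarrow> 0) at_bot"
      using tendsto_mult_right[OF tendsto_exp_mult_at_bot[OF a], of "M1 + a * M0"] by simp
    ultimately have "(F \<longlongrightarrow> 0) at_bot"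
      by (intro Lim_null_comparison[of F]) auto
    then show "((F \<circ> real_of_ereal) \<longlongrightarrow> 0) (at_right (-\<infinity>))" by (simp add: ereal_tendsto_simps1)
  qed simp
  then have "(LBINT t. f t) = 0"
    by (simp add: interval_lebesgue_integral_def set_lebesgue_integral_def einterval_def)
  then show ?thesis
    unfolding f_def using int[OF s2 r2] int2 by (simp add: right_diff_distrib)
qed

section \<open>The homogeneous potential as a weak solution\<close>

context circle_ode
begin

text \<open>The constant \<beta> / a^2 answers the constant part \<beta> of the field and
  \<open>P\<close> the part \<open>c\<close>; the degree a = s + 2 is two more than that of the
  field.\<close>

definition potential :: "real \<Rightarrow> complex \<Rightarrow> real" where
  "potential \<beta> z = norm z powr a * (\<beta> / a\<^sup>2 + P (Arg2pi z))"

definition field :: "real \<Rightarrow> complex \<Rightarrow> real" where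
  "field \<beta> z = norm z powr (a - 2) * (\<beta> + c (Arg2pi z))"

lemma potential_measurable [measurable]: "potential \<beta> \<in> borel_measurable borel"
  and field_measurable [measurable]: "field \<beta> \<in> borel_measurable borel"
  unfolding potential_def[abs_def] field_def[abs_def] by measurable

lemma angular_integrable:
  "integrable lborel (\<lambda>\<psi>. arc \<psi> * (\<beta> / a\<^sup>2 + P \<psi>))"
  "integrable lborel (\<lambda>\<psi>. arc \<psi> * (\<beta> + c \<psi>))"
proof -
  have i: "integrable lborel (\<lambda>\<psi>. arc \<psi> * C)" for C :: real
    by simp
  obtain K where K: "\<And>\<psi>. \<bar>P \<psi>\<bar> \<le> K" using P_bound by blast
  have "integrable lborel (\<lambda>\<psi>. arc \<psi> * P \<psi>)"
  proof (rule Bochner_Integration.integrable_bound[OF i[of K]])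
    show "AE \<psi> in lborel. norm (arc \<psi> * P \<psi>) \<le> norm (arc \<psi> * K)"
      using K by (auto intro!: AE_I2 simp: indicator_def intro: order_trans[OF _ abs_ge_self])
  qed measurable
  then show "integrable lborel (\<lambda>\<psi>. arc \<psi> * (\<beta> / a\<^sup>2 + P \<psi>))"
    using i[of "\<beta> / a\<^sup>2"] by (simp add: distrib_left)
  have "(\<lambda>\<psi>. arc \<psi> * c \<psi>) = c"
    using c_supp by (auto simp: fun_eq_iff indicator_def)
  then have "integrable lborel (\<lambda>\<psi>. arc \<psi> * c \<psi>)" using c_int by simp
  then show "integrable lborel (\<lambda>\<psi>. arc \<psi> * (\<beta> + c \<psi>))"
    using i[of \<beta>] by (simp add: distrib_left)
qed

lemma potential_integrable: "set_integrable lborel (cball 0 R) (potential \<beta>)"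
  unfolding potential_def[abs_def]
  by (rule set_integrable_homogeneous[OF _ _ angular_integrable(1)]) (use a_pos in auto)

lemma field_integrable: "set_integrable lborel (cball 0 R) (field \<beta>)"
  unfolding field_def[abs_def]
  by (rule set_integrable_homogeneous[OF _ _ angular_integrable(2)]) (use a_pos in auto)

text \<open>The angular equation on a fixed circle. The constant \<beta> / a^2 sees only a^2 \<eta>,
  since the second angular derivative integrates to 0 over a period; the \<open>P\<close> part is
  the weak equation for the kernel.\<close>

lemma angular_weak_equation:
  assumes \<eta>: "smooth \<eta>"
  shows "(LBINT \<psi>. (ang (ang \<eta>) (log_polar (t, \<psi>)) + a\<^sup>2 * \<eta> (log_polar (t, \<psi>))) * (arc \<psi> * (\<beta> / a\<^sup>2 + P \<psi>)))
    = (LBINT \<psi>. \<eta> (log_polar (t, \<psi>)) * (arc \<psi> * (\<beta> + c \<psi>)))"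
proof -
  have s1: "smooth (ang \<eta>)" and s2: "smooth (ang (ang \<eta>))" using \<eta> by (auto intro!: smooth_ang)
  define z0 z1 z2 where "z0 \<psi> = \<eta> (log_polar (t, \<psi>))" and "z1 \<psi> = ang \<eta> (log_polar (t, \<psi>))"
    and "z2 \<psi> = ang (ang \<eta>) (log_polar (t, \<psi>))" for \<psi>
  have d: "(z0 has_real_derivative z1 x) (at x within S)" "(z1 has_real_derivative z2 x) (at x within S)" for x S
    unfolding z0_def z1_def z2_def by (intro DERIV_log_polar_psi \<eta> s1)+
  have c2: "continuous_on UNIV z2" unfolding z2_def
    using DERIV_continuous_on[OF DERIV_log_polar_psi[OF s2]] by blast
  have c0: "continuous_on UNIV z0" using d(1) by (intro DERIV_continuous_on) blast
  have [simp]: "log_polar (t, 2 * pi) = log_polar (t, 0)" by (simp add: log_polar_def)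
  have per: "z0 (2 * pi) = z0 0" "z1 (2 * pi) = z1 0" by (simp_all add: z0_def z1_def)
  have cont_int: "integrable lborel (\<lambda>\<psi>. arc \<psi> * (h \<psi> * g \<psi>))"
    if g: "continuous_on UNIV g" and h: "integrable lborel (\<lambda>\<psi>. arc \<psi> * h \<psi>)" for g h :: "real \<Rightarrow> real"
  proof -
    have "bounded (g ` {0..2*pi})"
      by (intro compact_imp_bounded compact_continuous_image continuous_on_subset[OF g]) auto
    then obtain M where M: "\<forall>y\<in>g ` {0..2*pi}. norm y \<le> M" unfolding bounded_iff ..
    have [measurable]: "g \<in> borel_measurable borel" using g by (rule borel_measurable_continuous_onI)
    have "integrable lborel (\<lambda>\<psi>. (arc \<psi> * h \<psi>) * g \<psi>)"
    proof (rule Bochner_Integration.integrable_bound)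
      show "integrable lborel (\<lambda>\<psi>. M * (arc \<psi> * h \<psi>))" using h by simp
      show "(\<lambda>\<psi>. (arc \<psi> * h \<psi>) * g \<psi>) \<in> borel_measurable lborel"
        by (rule borel_measurable_times[OF borel_measurable_integrable[OF h]]) simp
      show "AE \<psi> in lborel. norm ((arc \<psi> * h \<psi>) * g \<psi>) \<le> norm (M * (arc \<psi> * h \<psi>))"
      proof (rule AE_I2)
        fix \<psi>
        show "norm ((arc \<psi> * h \<psi>) * g \<psi>) \<le> norm (M * (arc \<psi> * h \<psi>))"
        proof (cases "0 < \<psi> \<and> \<psi> < 2 * pi")
          case True
          then have "g \<psi> \<in> g ` {0..2*pi}" by (intro imageI) auto
          from M[rule_format, OF this] have "\<bar>g \<psi>\<bar> \<le> \<bar>M\<bar>" by simp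
          then show ?thesis by (simp add: abs_mult mult.commute[of "\<bar>M\<bar>"] mult_left_mono)
        qed (auto simp: indicator_def)
      qed
    qed
    then show ?thesis by (simp add: mult.assoc)
  qed
  have one: "integrable lborel (\<lambda>\<psi>. arc \<psi> * (1::real))" by simp
  have Pi: "integrable lborel (\<lambda>\<psi>. arc \<psi> * P \<psi>)"
    using angular_integrable(1)[of 0] by simp
  have ci: "integrable lborel (\<lambda>\<psi>. arc \<psi> * c \<psi>)"
    using angular_integrable(2)[of 0] by simp
  have z2_zero: "(LBINT \<psi>. arc \<psi> * z2 \<psi>) = 0"
  proof -
    have "(LBINT \<psi>. indicator {0..2*pi} \<psi> *\<^sub>R z2 \<psi>) = z1 (2 * pi) - z1 0"
      by (rule has_bochner_integral_integral_eq[OF has_bochner_integral_FTC_Icc])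
         (use d(2) continuous_on_subset[OF c2] in \<open>auto simp: has_real_derivative_iff_has_vector_derivative[symmetric]\<close>)
    moreover have "(LBINT \<psi>. indicator {0..2*pi} \<psi> *\<^sub>R z2 \<psi>) = (LBINT \<psi>. arc \<psi> * z2 \<psi>)"
    proof (rule integral_cong_AE)
      have [measurable]: "z2 \<in> borel_measurable borel" using c2 by (rule borel_measurable_continuous_onI)
      show "(\<lambda>\<psi>. indicator {0..2*pi} \<psi> *\<^sub>R z2 \<psi>) \<in> borel_measurable lborel" by measurable
      show "(\<lambda>\<psi>. arc \<psi> * z2 \<psi>) \<in> borel_measurable lborel" by measurable
      show "AE \<psi> in lborel. indicator {0..2*pi} \<psi> *\<^sub>R z2 \<psi> = arc \<psi> * z2 \<psi>"
        using AE_lborel_singleton[of 0] AE_lborel_singleton[of "2 * pi"]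
        by eventually_elim (auto simp: indicator_def)
    qed
    ultimately show ?thesis using per by simp
  qed
  have "(LBINT \<psi>. (z2 \<psi> + a\<^sup>2 * z0 \<psi>) * (arc \<psi> * (\<beta> / a\<^sup>2 + P \<psi>)))
    = (LBINT \<psi>. \<beta> / a\<^sup>2 * (arc \<psi> * (1 * z2 \<psi>)) + \<beta> * (arc \<psi> * (1 * z0 \<psi>))
       + arc \<psi> * (P \<psi> * (z2 \<psi> + a\<^sup>2 * z0 \<psi>)))"
    using a_pos by (intro Bochner_Integration.integral_cong) (auto simp: field_simps)
  also have "\<dots> = \<beta> / a\<^sup>2 * (LBINT \<psi>. arc \<psi> * (1 * z2 \<psi>)) + \<beta> * (LBINT \<psi>. arc \<psi> * (1 * z0 \<psi>))
       + (LBINT \<psi>. arc \<psi> * (P \<psi> * (z2 \<psi> + a\<^sup>2 * z0 \<psi>)))"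
    using cont_int[OF c2 one] cont_int[OF c0 one] cont_int[OF _ Pi, of "\<lambda>\<psi>. z2 \<psi> + a\<^sup>2 * z0 \<psi>"] c0 c2
    by (simp add: continuous_intros)
  also have "\<dots> = \<beta> * (LBINT \<psi>. arc \<psi> * (1 * z0 \<psi>)) + (LBINT y. c y * z0 y)"
    using z2_zero weak_ode[OF d c2 per] by simp
  also have "(LBINT y. c y * z0 y) = (LBINT y. arc y * (c y * z0 y))"
    by (intro Bochner_Integration.integral_cong) (use c_supp in \<open>force simp: indicator_def\<close>)+
  also have "\<beta> * (LBINT \<psi>. arc \<psi> * (1 * z0 \<psi>)) + \<dots>
    = (LBINT \<psi>. \<beta> * (arc \<psi> * (1 * z0 \<psi>)) + arc \<psi> * (c \<psi> * z0 \<psi>))"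
    using cont_int[OF c0 one] cont_int[OF c0 ci] by simp
  also have "\<dots> = (LBINT \<psi>. z0 \<psi> * (arc \<psi> * (\<beta> + c \<psi>)))"
    by (intro Bochner_Integration.integral_cong) (auto simp: algebra_simps)
  finally show ?thesis unfolding z0_def z2_def .
qed

text \<open>In log-polar coordinates the two halves of the Laplacian need opposite orders of
  integration: the radial half is integrated by parts in t for fixed angle and becomes a^2 \<eta>,
  then the sum is integrated in the angle for fixed t.\<close>

lemma potential_weak_poisson:
  assumes "test_function \<eta>"
  shows "(LBINT z. potential \<beta> z * laplacian \<eta> z) = (LBINT z. field \<beta> z * \<eta> z)"
proof -
  obtain R where \<eta>: "smooth \<eta>" "\<And>z. norm z > R \<Longrightarrow> \<eta> z = 0" using test_functionD[OF assms] by blast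
  have s: "smooth (rad \<eta>)" "smooth (rad (rad \<eta>))" "smooth (ang \<eta>)" "smooth (ang (ang \<eta>))"
    using \<eta> by (auto intro!: smooth_rad smooth_ang)
  have r1: "rad \<eta> z = 0" "ang \<eta> z = 0" if "norm z > R" for z using rad_zero[OF \<eta> that] ang_zero[OF \<eta> that] by auto
  have r2: "rad (rad \<eta>) z = 0" "ang (ang \<eta>) z = 0" if "norm z > R" for z
    using rad_zero[OF s(1) r1(1) that] ang_zero[OF s(3) r1(2) that] by auto
  have [measurable]: "\<eta> \<in> borel_measurable borel" "laplacian \<eta> \<in> borel_measurable borel"
    using \<eta>(1) smooth_laplacian smooth_measurable by blast+
  let ?h = "\<lambda>\<psi>. arc \<psi> * (\<beta> / a\<^sup>2 + P \<psi>) :: real"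
  let ?k = "\<lambda>\<psi>. arc \<psi> * (\<beta> + c \<psi>) :: real"
  have int1: "integrable lborel2 (\<lambda>p. (exp (a * fst p) * g (log_polar p)) * ?h (snd p))"
    if "smooth g" "\<And>z. norm z > R \<Longrightarrow> g z = 0" for g
    by (rule integrable_polar_test[OF a_pos that _ angular_integrable(1)]) auto
  have int2: "integrable lborel2 (\<lambda>p. (exp (a * fst p) * \<eta> (log_polar p)) * ?k (snd p))"
    by (rule integrable_polar_test[OF a_pos \<eta> _ angular_integrable(2)]) auto
  have e: "exp (2 * fst p) = (norm (log_polar p))\<^sup>2" for p by (simp add: exp_double)
  have "(LBINT z. potential \<beta> z * laplacian \<eta> z)
    = (LINT p|lborel2. (exp (2 * fst p) * arc (snd p)) *\<^sub>R (potential \<beta> (log_polar p) * laplacian \<eta> (log_polar p)))"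
    by (rule integral_log_polar) measurable
  also have "\<dots> = (LINT p|lborel2. (exp (a * fst p) * rad (rad \<eta>) (log_polar p)) * ?h (snd p) + (exp (a * fst p) * ang (ang \<eta>) (log_polar p)) * ?h (snd p))"
  proof (rule Bochner_Integration.integral_cong)
    fix p :: "real \<times> real"
    show "(exp (2 * fst p) * arc (snd p)) *\<^sub>R (potential \<beta> (log_polar p) * laplacian \<eta> (log_polar p))
      = (exp (a * fst p) * rad (rad \<eta>) (log_polar p)) * ?h (snd p) + (exp (a * fst p) * ang (ang \<eta>) (log_polar p)) * ?h (snd p)"
    proof (cases "0 < snd p \<and> snd p < 2 * pi")
      case True
      have "potential \<beta> (log_polar p) = exp (a * fst p) * (\<beta> / a\<^sup>2 + P (snd p))"
        using True by (simp add: potential_def Arg2pi_log_polar powr_def)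
      moreover have "exp (2 * fst p) * laplacian \<eta> (log_polar p) = rad (rad \<eta>) (log_polar p) + ang (ang \<eta>) (log_polar p)"
        unfolding e using rad_rad_ang_ang[OF \<eta>(1)] by simp
      moreover have "(exp (2 * fst p) * arc (snd p)) *\<^sub>R (potential \<beta> (log_polar p) * laplacian \<eta> (log_polar p))
        = potential \<beta> (log_polar p) * (exp (2 * fst p) * laplacian \<eta> (log_polar p))"
        using True by (simp add: mult_ac)
      ultimately show ?thesis using True by (simp only:) (simp add: algebra_simps add_divide_distrib)
    qed (auto simp: indicator_def)
  qed simp
  also have "\<dots> = (LINT p|lborel2. (exp (a * fst p) * rad (rad \<eta>) (log_polar p)) * ?h (snd p))
    + (LINT p|lborel2. (exp (a * fst p) * ang (ang \<eta>) (log_polar p)) * ?h (snd p))"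
    by (intro Bochner_Integration.integral_add int1 s r2)
  also have "(LINT p|lborel2. (exp (a * fst p) * rad (rad \<eta>) (log_polar p)) * ?h (snd p))
    = (LBINT \<psi>. LBINT t. (exp (a * t) * rad (rad \<eta>) (log_polar (t, \<psi>))) * ?h \<psi>)"
    using lborel_pair.integral_snd[of "\<lambda>t \<psi>. (exp (a * t) * rad (rad \<eta>) (log_polar (t, \<psi>))) * ?h \<psi>"] int1[OF s(2) r2(1)]
    by (simp add: case_prod_unfold)
  also have "\<dots> = (LBINT \<psi>. LBINT t. (exp (a * t) * (a\<^sup>2 * \<eta> (log_polar (t, \<psi>)))) * ?h \<psi>)"
    using radial_integration_by_parts[OF a_pos \<eta>] by (simp only: integral_mult_left_zero)
  also have "\<dots> = (LINT p|lborel2. (exp (a * fst p) * (a\<^sup>2 * \<eta> (log_polar p))) * ?h (snd p))"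
    using lborel_pair.integral_snd[of "\<lambda>t \<psi>. (exp (a * t) * (a\<^sup>2 * \<eta> (log_polar (t, \<psi>)))) * ?h \<psi>"]
      int1[OF smooth_mult[OF smooth_const[of "a\<^sup>2"] \<eta>(1)]] \<eta>(2)
    by (simp add: case_prod_unfold)
  also have "\<dots> + (LINT p|lborel2. (exp (a * fst p) * ang (ang \<eta>) (log_polar p)) * ?h (snd p))
    = (LINT p|lborel2. (exp (a * fst p) * (a\<^sup>2 * \<eta> (log_polar p))) * ?h (snd p) + (exp (a * fst p) * ang (ang \<eta>) (log_polar p)) * ?h (snd p))"
    using \<eta>(2) by (intro Bochner_Integration.integral_add[symmetric] int1 s r2 smooth_mult smooth_const \<eta>) auto
  \<comment> \<open>The order is now reversed: with the radial derivatives gone, each circle t =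
    const carries the angular equation with the weight e^(at) as a mere factor.\<close>
  also have "\<dots> = (LBINT t. LBINT \<psi>. (exp (a * t) * (a\<^sup>2 * \<eta> (log_polar (t, \<psi>)))) * ?h \<psi> + (exp (a * t) * ang (ang \<eta>) (log_polar (t, \<psi>))) * ?h \<psi>)"
  proof -
    have "integrable lborel2 (\<lambda>p. (exp (a * fst p) * (a\<^sup>2 * \<eta> (log_polar p))) * ?h (snd p) + (exp (a * fst p) * ang (ang \<eta>) (log_polar p)) * ?h (snd p))"
      using \<eta>(2) by (intro Bochner_Integration.integrable_add int1 s r2 smooth_mult smooth_const \<eta>) auto
    from lborel_pair.integral_fst'[OF this] show ?thesis by simp
  qed
  also have "\<dots> = (\<integral>t. exp (a * t) * (LBINT \<psi>. (ang (ang \<eta>) (log_polar (t, \<psi>)) + a\<^sup>2 * \<eta> (log_polar (t, \<psi>))) * ?h \<psi>) \<partial>lborel)"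
    unfolding integral_mult_right_zero[symmetric]
    by (intro Bochner_Integration.integral_cong refl) (simp add: algebra_simps)
  also have "\<dots> = (\<integral>t. exp (a * t) * (LBINT \<psi>. \<eta> (log_polar (t, \<psi>)) * ?k \<psi>) \<partial>lborel)"
    unfolding angular_weak_equation[OF \<eta>(1)] ..
  also have "\<dots> = (LBINT t. LBINT \<psi>. (exp (a * t) * \<eta> (log_polar (t, \<psi>))) * ?k \<psi>)"
    unfolding integral_mult_right_zero[symmetric] mult.assoc ..
  also have "\<dots> = (LINT p|lborel2. (exp (a * fst p) * \<eta> (log_polar p)) * ?k (snd p))"
    using lborel_pair.integral_fst'[OF int2] by simp
  also have "\<dots> = (LINT p|lborel2. (exp (2 * fst p) * arc (snd p)) *\<^sub>R (field \<beta> (log_polar p) * \<eta> (log_polar p)))"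
  proof (rule Bochner_Integration.integral_cong)
    fix p :: "real \<times> real"
    show "(exp (a * fst p) * \<eta> (log_polar p)) * ?k (snd p)
      = (exp (2 * fst p) * arc (snd p)) *\<^sub>R (field \<beta> (log_polar p) * \<eta> (log_polar p))"
    proof (cases "0 < snd p \<and> snd p < 2 * pi")
      case True
      have "exp (2 * fst p) * field \<beta> (log_polar p) = exp (a * fst p) * (\<beta> + c (snd p))"
        using True by (simp add: field_def Arg2pi_log_polar powr_def mult.assoc[symmetric] exp_add[symmetric] algebra_simps)
      then show ?thesis using True by (simp add: mult_ac)
    qed (auto simp: indicator_def)
  qed simp
  also have "\<dots> = (LBINT z. field \<beta> z * \<eta> z)"
    by (rule integral_log_polar[symmetric]) measurable
  finally show ?thesis .
qed

end

section \<open>Solutions of the Poisson equation and zero modes\<close>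

lemma lebesgue_measurable_AE_borel:
  fixes f f' :: "'a::euclidean_space \<Rightarrow> 'b::euclidean_space"
  assumes "f' \<in> borel_measurable borel" "AE x in lborel. f x = f' x"
  shows "f \<in> borel_measurable lebesgue"
proof (rule borel_measurable_AE)
  show "f' \<in> borel_measurable lebesgue" using assms(1) by (simp add: measurable_completion)
  show "AE x in lebesgue. f' x = f x" using assms(2) by (intro AE_completion) auto
qed

lemma
  fixes f f' :: "'a::euclidean_space \<Rightarrow> 'b::euclidean_space"
  assumes f': "f' \<in> borel_measurable borel" and ae: "AE x in lborel. f x = f' x"
  shows lebesgue_integrable_AE_borel: "integrable lebesgue f \<longleftrightarrow> integrable lborel f'"
    and lebesgue_integral_AE_borel: "(LINT x|lebesgue. f x) = (LBINT x. f' x)"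
proof -
  have f: "f \<in> borel_measurable lebesgue" by (rule lebesgue_measurable_AE_borel[OF assms])
  have f'm: "f' \<in> borel_measurable lebesgue" using f' by (simp add: measurable_completion)
  have ae': "AE x in lebesgue. f x = f' x" using ae by (rule AE_completion)
  show "integrable lebesgue f \<longleftrightarrow> integrable lborel f'"
    using integrable_cong_AE[OF f f'm ae'] f' by (simp add: integrable_completion)
  show "(LINT x|lebesgue. f x) = (LBINT x. f' x)"
    using integral_cong_AE[OF f f'm ae'] f' by (simp add: integral_completion)
qed

lemma locally_integrable_AE_borel:
  fixes f f' :: "complex \<Rightarrow> real"
  assumes f': "f' \<in> borel_measurable borel" and ae: "AE x in lborel. f x = f' x"
  shows "locally_integrable f \<longleftrightarrow> (\<forall>R. set_integrable lborel (cball 0 R) f')"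
proof -
  have eq: "set_integrable lebesgue K f \<longleftrightarrow> set_integrable lborel K f'" if K: "K \<in> sets borel" for K
    unfolding set_integrable_def
  proof (rule lebesgue_integrable_AE_borel)
    show "(\<lambda>x. indicator K x *\<^sub>R f' x) \<in> borel_measurable borel" using f' K by simp
    show "AE x in lborel. indicator K x *\<^sub>R f x = indicator K x *\<^sub>R f' x" using ae by eventually_elim simp
  qed
  show ?thesis
  proof
    assume "locally_integrable f"
    then show "\<forall>R. set_integrable lborel (cball 0 R) f'"
      using eq[of "cball 0 _"] unfolding locally_integrable_def by (simp add: borel_closed)
  next
    assume l: "\<forall>R. set_integrable lborel (cball 0 R) f'"
    show "locally_integrable f"
      unfolding locally_integrable_def
    proof (intro allI impI)
      fix K :: "complex set" assume K: "compact K"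
      then have "K \<in> sets borel" by (simp add: borel_compact)
      then show "set_integrable lebesgue K f"
        using eq integrable_lborel_bounded_support[of f' K] l compact_imp_bounded[OF K] by blast
    qed
  qed
qed

text \<open>Truncations to the discs of radius n are integrable, hence measurable, and converge
  pointwise to \<open>f\<close>.\<close>

lemma locally_integrable_borel_version:
  assumes "locally_integrable f"
  obtains f' where "f' \<in> borel_measurable borel" "AE x in lborel. f x = f' x"
proof -
  have "(\<lambda>x. indicator (cball 0 (real n)) x *\<^sub>R f x) \<in> borel_measurable lebesgue" for n
    using assms unfolding locally_integrable_def set_integrable_def by (auto dest!: spec[of _ "cball 0 (real n)"])
  moreover have "(\<lambda>n. indicator (cball 0 (real n)) x *\<^sub>R f x) \<longlonglongrightarrow> f x" for x
  proof (rule tendsto_eventually)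
    obtain N where "norm x \<le> real N" using real_arch_simple by blast
    then show "\<forall>\<^sub>F n in sequentially. indicator (cball 0 (real n)) x *\<^sub>R f x = f x"
      by (intro eventually_sequentiallyI[of N]) (auto simp: indicator_def)
  qed
  ultimately have "f \<in> borel_measurable lebesgue"
    by (rule borel_measurable_LIMSEQ_real[rotated])
  then have "\<exists>f'\<in>borel_measurable lborel. AE x in lborel. f x = f' x"
    by (rule completion_ex_borel_measurable_real)
  then show ?thesis using that by auto
qed

lemma integrable_mult_laplacian:
  fixes f :: "complex \<Rightarrow> real"
  assumes "f \<in> borel_measurable borel" "\<And>R. set_integrable lborel (cball 0 R) f" "test_function \<eta>"
  shows "integrable lborel (\<lambda>z. f z * laplacian \<eta> z)"
proof -
  obtain R where \<eta>: "smooth \<eta>" "\<And>z. norm z > R \<Longrightarrow> \<eta> z = 0" using test_functionD[OF assms(3)] by blast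
  show ?thesis
    by (rule integrable_mult_compact_support[OF assms(1,2) smooth_laplacian[OF \<eta>(1)], of R])
       (use laplacian_zero[OF \<eta>(1) open_norm_gt] \<eta>(2) in auto)
qed

text \<open>The difference of two solutions is weakly harmonic, so Weyl's lemma applies to its Borel
  representative. An arbitrary solution is thereby reduced to the explicit potential.\<close>

lemma poisson_solution_unique_mod_Re_entire:
  assumes F: "poisson_solution B F"
    and F0: "F0 \<in> borel_measurable borel" "\<And>R. set_integrable lborel (cball 0 R) F0"
    and eq: "\<And>\<eta>. test_function \<eta> \<Longrightarrow> (LBINT z. F0 z * laplacian \<eta> z) = (LINT z|lebesgue. B z * \<eta> z)"
  shows "\<exists>g. g holomorphic_on UNIV \<and> (AE z in lborel. F z = F0 z + Re (g z))"
proof -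
  have "locally_integrable F" using F by (simp add: poisson_solution_def)
  then obtain F' where F': "F' \<in> borel_measurable borel" "AE z in lborel. F z = F' z"
    by (rule locally_integrable_borel_version)
  have F'i: "set_integrable lborel (cball 0 R) F'" for R
    using locally_integrable_AE_borel[OF F'] \<open>locally_integrable F\<close> by blast
  have "weakly_harmonic (\<lambda>z. F' z - F0 z)"
  proof
    show "(\<lambda>z. F' z - F0 z) \<in> borel_measurable borel" using F' F0 by simp
    show "set_integrable lborel (cball 0 R) (\<lambda>z. F' z - F0 z)" for R
      using F'i F0 by (intro set_integral_diff)
    fix \<eta> assume \<eta>: "test_function \<eta>"
    then have "smooth \<eta>" by (simp add: test_function_def)
    then have [measurable]: "laplacian \<eta> \<in> borel_measurable borel" by (intro smooth_measurable smooth_laplacian)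
    have "(LBINT z. F' z * laplacian \<eta> z) = (LINT z|lebesgue. F z * laplacian \<eta> z)"
      by (rule lebesgue_integral_AE_borel[symmetric]) (use F' in \<open>auto elim: eventually_mono\<close>)
    also have "\<dots> = (LINT z|lebesgue. B z * \<eta> z)" using F \<eta> by (simp add: poisson_solution_def)
    finally have "(LBINT z. F' z * laplacian \<eta> z) = (LBINT z. F0 z * laplacian \<eta> z)"
      using eq[OF \<eta>] by simp
    moreover have "integrable lborel (\<lambda>z. F' z * laplacian \<eta> z)" "integrable lborel (\<lambda>z. F0 z * laplacian \<eta> z)"
      using integrable_mult_laplacian F'(1) F'i F0 \<eta> by blast+
    ultimately show "(LBINT z. (F' z - F0 z) * laplacian \<eta> z) = 0"
      by (simp add: left_diff_distrib)
  qed
  then obtain g where g: "g holomorphic_on UNIV" "AE z in lborel. F' z - F0 z = Re (g z)"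
    using weakly_harmonic.AE_eq_Re_entire by blast
  from F'(2) g(2) have "AE z in lborel. F z = F0 z + Re (g z)" by eventually_elim simp
  with g(1) show ?thesis by blast
qed

text \<open>The radial integrand is e^(bt) exp(-k e^(at)). For t <= 0 the first factor is integrable
  by itself; for t > 0 the double exponential dominates any e^(bt).\<close>

lemma integrable_power_exp_minus_powr:
  fixes a k :: real
  assumes a: "a > 0" and k: "k > 0"
  shows "integrable lborel (\<lambda>z::complex. (norm z ^ n)\<^sup>2 * exp (- (k * norm z powr a)))"
proof -
  \<comment> \<open>2n comes from the squared power, 2 from the Jacobian e^(2t).\<close>
  define b where "b = real (2 * n + 2)"
  have b: "b > 0" by (simp add: b_def)
  \<comment> \<open>A single term of the exponential series gives exp(-x) <= N! / x^N; with a N > b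
    + 1 the product is at most a constant times e^(-t).\<close>
  obtain N :: nat where N: "real N > (b + 1) / a" using reals_Archimedean2 by blast
  then have N': "a * real N > b + 1" using a by (simp add: field_simps)
  define C where "C = fact N / k ^ N"
  have C: "C > 0" using k by (simp add: C_def)
  have ex: "exp (- (k * exp (a * t))) \<le> C * exp (- (a * real N * t))" for t
  proof -
    have x: "k * exp (a * t) > 0" using k by simp
    have "(k * exp (a * t)) ^ N / fact N \<le> exp (k * exp (a * t))"
    proof -
      let ?f = "\<lambda>i. (k * exp (a * t)) ^ i /\<^sub>R fact i"
      have "sum ?f {N} \<le> suminf ?f"
        using x by (intro sum_le_suminf summable_exp_generic) auto
      then show ?thesis by (simp add: exp_def divide_inverse mult.commute)
    qed
    then have "1 / exp (k * exp (a * t)) \<le> 1 / ((k * exp (a * t)) ^ N / fact N)"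
      using x by (intro divide_left_mono) auto
    moreover have "exp (a * t) ^ N = exp (a * real N * t)"
      by (simp add: exp_of_nat_mult[symmetric] mult_ac)
    ultimately show ?thesis
      by (simp add: exp_minus C_def power_mult_distrib field_simps)
  qed
  have tail1: "integrable lborel (\<lambda>t. indicator {..0} t * exp (b * t))" by (rule integrable_exp_tail[OF b])
  have "integrable lborel (\<lambda>t::real. indicator {..0} (0 + (-1) * t) * exp (1 * (0 + (-1) * t)))"
    by (rule lborel_integrable_real_affine[OF integrable_exp_tail]) simp_all
  then have tail2: "integrable lborel (\<lambda>t::real. indicator {0..} t * exp (- t))"
    by (rule back_subst[of "integrable lborel"]) (auto simp: fun_eq_iff indicator_def)
  have G: "integrable lborel (\<lambda>t. exp (b * t) * exp (- (k * exp (a * t))))"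
  proof (rule Bochner_Integration.integrable_bound)
    show "integrable lborel (\<lambda>t. indicator {..0} t * exp (b * t) + C * (indicator {0..} t * exp (- t)))"
      using tail1 tail2 by simp
    show "AE t in lborel. norm (exp (b * t) * exp (- (k * exp (a * t)))) \<le> norm (indicator {..0} t * exp (b * t) + C * (indicator {0..} t * exp (- t)))"
    proof (rule AE_I2)
      fix t :: real
      have nn: "0 \<le> indicator {..0} t * exp (b * t) + C * (indicator {0..} t * exp (- t))" using C by simp
      have "exp (b * t) * exp (- (k * exp (a * t))) \<le> indicator {..0} t * exp (b * t) + C * (indicator {0..} t * exp (- t))"
      proof (cases "t \<le> 0")
        case True
        have "exp (b * t) * exp (- (k * exp (a * t))) \<le> exp (b * t)" using k by (intro mult_left_le) auto
        moreover have "0 \<le> C * (indicator {0..} t * exp (- t))" using C by simp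
        moreover have "indicator {..0} t * exp (b * t) = exp (b * t)" using True by simp
        ultimately show ?thesis by linarith
      next
        case False
        have "exp (b * t) * exp (- (k * exp (a * t))) \<le> exp (b * t) * (C * exp (- (a * real N * t)))"
          by (intro mult_left_mono ex) simp
        also have "\<dots> = C * exp (b * t - a * real N * t)" by (simp add: exp_diff exp_minus field_simps)
        also have "\<dots> \<le> C * exp (- t)"
        proof (intro mult_left_mono)
          have "(b + 1) * t \<le> (a * real N) * t" using N' False by (intro mult_right_mono) auto
          then show "exp (b * t - a * real N * t) \<le> exp (- t)" by (simp add: algebra_simps)
        qed (use C in simp)
        finally show ?thesis using False by simp
      qed
      then show "norm (exp (b * t) * exp (- (k * exp (a * t)))) \<le> norm (indicator {..0} t * exp (b * t) + C * (indicator {0..} t * exp (- t)))"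
        using nn by simp
    qed
  qed measurable
  have [measurable]: "(\<lambda>z::complex. (norm z ^ n)\<^sup>2 * exp (- (k * norm z powr a))) \<in> borel_measurable borel" by measurable
  show ?thesis
  proof (subst integrable_log_polar)
    have eq: "(exp (2 * fst p) * arc (snd p)) *\<^sub>R ((norm (log_polar p) ^ n)\<^sup>2 * exp (- (k * norm (log_polar p) powr a)))
      = (exp (b * fst p) * exp (- (k * exp (a * fst p)))) * arc (snd p)" for p
    proof -
      have "exp (2 * fst p) * (exp (fst p) ^ n)\<^sup>2 = exp (b * fst p)"
        by (simp add: b_def exp_of_nat_mult[symmetric] power_mult[symmetric] exp_add[symmetric] algebra_simps)
      then show ?thesis by (simp add: powr_def mult_ac)
    qed
    show "integrable lborel2 (\<lambda>p. (exp (2 * fst p) * arc (snd p)) *\<^sub>R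
      ((norm (log_polar p) ^ n)\<^sup>2 * exp (- (k * norm (log_polar p) powr a))))"
      unfolding eq using integrable_lborel_product[OF G, of "arc"] by simp
  qed measurable
qed

text \<open>A linear relation among the \<open>w n\<close>, evaluated at z and divided by the
  nonzero factor \<open>k z\<close>, is a polynomial in \<open>h z\<close>. As \<open>h\<close> is
  onto, the polynomial vanishes everywhere. The parameters \<open>ev\<close>, \<open>h\<close>,
  \<open>k\<close> let one argument serve both components, with \<open>h\<close> the identity or the
  conjugation.\<close>

lemma infinite_dimensionalI:
  fixes w :: "nat \<Rightarrow> spinor" and ev :: "complex \<Rightarrow> spinor \<Rightarrow> complex"
  assumes w: "\<And>n. w n \<in> V"
    and add: "\<And>z u v. ev z (u + v) = ev z u + ev z v"
    and scale: "\<And>z c v. ev z (spinor_scale c v) = c * ev z v"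
    and ev: "\<And>z n. ev z (w n) = h z ^ n * k z" and k: "\<And>z. k z \<noteq> 0" and h: "range h = UNIV"
  shows "infinite_dimensional V"
  unfolding infinite_dimensional_def
proof
  assume "\<exists>S. finite S \<and> spinor.span S = V"
  then obtain S where S: "finite S" "spinor.span S = V" by blast
  have ev0: "ev z 0 = 0" for z using add[of z 0 0] by simp
  have ev_sum: "ev z (\<Sum>n\<in>I. v n) = (\<Sum>n\<in>I. ev z (v n))" for z I and v :: "nat \<Rightarrow> spinor"
    by (induction I rule: infinite_finite_induct) (auto simp: ev0 add)
  have indep0: "c n = 0" if I: "finite I" "n \<in> I" and z: "(\<Sum>n\<in>I. spinor_scale (c n) (w n)) = 0" for I c n
  proof -
    obtain N where N: "I \<subseteq> {..N}" using I(1) finite_nat_iff_bounded_le by auto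
    have "(\<Sum>i\<le>N. (if i \<in> I then c i else 0) * x ^ i) = 0" for x
    proof -
      obtain z where x: "x = h z" using h by (metis UNIV_I rangeE)
      have "(\<Sum>n\<in>I. c n * x ^ n) * k z = 0"
        using arg_cong[OF \<open>(\<Sum>n\<in>I. spinor_scale (c n) (w n)) = 0\<close>, of "ev z"]
        by (simp add: ev_sum scale ev ev0 x sum_distrib_right mult.assoc)
      then have "(\<Sum>n\<in>I. c n * x ^ n) = 0" using k by simp
      also have "(\<Sum>n\<in>I. c n * x ^ n) = (\<Sum>i\<le>N. (if i \<in> I then c i else 0) * x ^ i)"
        using N by (intro sum.mono_neutral_cong_left) auto
      finally show ?thesis .
    qed
    then show ?thesis using polyfun_eq_0[of "\<lambda>i. if i \<in> I then c i else 0" N] N \<open>n \<in> I\<close> by auto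
  qed
  \<comment> \<open>Independence concerns the set \<open>range w\<close>; injectivity ensures that
    it is infinite and that relations on it can be indexed by n.\<close>
  have inj: "inj w"
  proof (rule injI, rule ccontr)
    fix m n assume mn: "w m = w n" "m \<noteq> n"
    have "(\<Sum>i\<in>{m, n}. spinor_scale (if i = m then 1 else -1) (w i)) = 0"
      using mn by (simp flip: spinor.scale_left_distrib)
    from indep0[OF _ _ this, of m] show False by simp
  qed
  have "spinor.independent (range w)"
    unfolding spinor.independent_explicit_finite_subsets
  proof (intro allI impI ballI)
    fix T u v assume T: "T \<subseteq> range w" "finite T" "(\<Sum>v\<in>T. spinor_scale (u v) v) = 0" "v \<in> T"
    define I where "I = w -` T"
    have TI: "T = w ` I" using T(1) by (auto simp: I_def)
    have fI: "finite I" unfolding I_def using finite_vimageI[OF T(2) inj] .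
    obtain n where n: "n \<in> I" "v = w n" using T(4) TI by blast
    have "(\<Sum>n\<in>I. spinor_scale (u (w n)) (w n)) = 0"
      using T(3) unfolding TI by (subst (asm) sum.reindex) (auto intro: inj_on_subset[OF inj])
    then show "u v = 0" using indep0[OF fI n(1), of "\<lambda>n. u (w n)"] n by simp
  qed
  moreover have "range w \<subseteq> spinor.span S" using w S by auto
  ultimately have "finite (range w)" using spinor.independent_span_bound[OF S(1)] by blast
  then show False using inj finite_imageD by blast
qed

section \<open>From the field on the unit circle to the data of the angular equation\<close>

lemma lebesgue_on_circle_borel_version:
  fixes f :: "real \<Rightarrow> real"
  assumes "f \<in> borel_measurable (lebesgue_on {0..2*pi})"
  obtains f' where "f' \<in> borel_measurable borel" "AE \<psi> in lborel. 0 < \<psi> \<longrightarrow> \<psi> < 2 * pi \<longrightarrow> f \<psi> = f' \<psi>"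
proof -
  have "(\<lambda>\<psi>. indicator {0..2*pi} \<psi> *\<^sub>R f \<psi>) \<in> borel_measurable lebesgue"
    using assms by (subst (asm) borel_measurable_restrict_space_iff) auto
  then have "\<exists>f'\<in>borel_measurable lborel. AE \<psi> in lborel. indicator {0..2*pi} \<psi> *\<^sub>R f \<psi> = f' \<psi>"
    by (rule completion_ex_borel_measurable_real)
  then obtain f' where "f' \<in> borel_measurable borel" and ae: "AE \<psi> in lborel. indicator {0..2*pi} \<psi> *\<^sub>R f \<psi> = f' \<psi>"
    by auto
  moreover from ae have "AE \<psi> in lborel. 0 < \<psi> \<longrightarrow> \<psi> < 2 * pi \<longrightarrow> f \<psi> = f' \<psi>"
    by eventually_elim (auto simp: indicator_def)
  ultimately show ?thesis using that by blast
qed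

lemma
  fixes f f' :: "real \<Rightarrow> 'b::euclidean_space"
  assumes f': "f' \<in> borel_measurable borel" and ae: "AE \<psi> in lborel. 0 < \<psi> \<longrightarrow> \<psi> < 2 * pi \<longrightarrow> f \<psi> = f' \<psi>"
  shows integrable_circle_borel: "integrable (lebesgue_on {0..2*pi}) f \<longleftrightarrow> integrable lborel (\<lambda>\<psi>. arc \<psi> *\<^sub>R f' \<psi>)"
    and integral_circle_borel: "(LINT \<psi>|lebesgue_on {0..2*pi}. f \<psi>) = (LBINT \<psi>. arc \<psi> *\<^sub>R f' \<psi>)"
proof -
  have ae': "AE \<psi> in lborel. indicator {0..2*pi} \<psi> *\<^sub>R f \<psi> = arc \<psi> *\<^sub>R f' \<psi>"
    using ae AE_lborel_singleton[of 0] AE_lborel_singleton[of "2 * pi"]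
    by eventually_elim (auto simp: indicator_def)
  have m: "(\<lambda>\<psi>. arc \<psi> *\<^sub>R f' \<psi>) \<in> borel_measurable borel" using f' by measurable
  show "integrable (lebesgue_on {0..2*pi}) f \<longleftrightarrow> integrable lborel (\<lambda>\<psi>. arc \<psi> *\<^sub>R f' \<psi>)"
    by (subst integrable_restrict_space) (simp, rule lebesgue_integrable_AE_borel[OF m ae'])
  show "(LINT \<psi>|lebesgue_on {0..2*pi}. f \<psi>) = (LBINT \<psi>. arc \<psi> *\<^sub>R f' \<psi>)"
    by (subst integral_restrict_space) (simp, rule lebesgue_integral_AE_borel[OF m ae'])
qed

text \<open>Constants are orthogonal to the resonant modes, so subtracting the mean preserves the
  orthogonality condition.\<close>

lemma integral_circle_trig:
  assumes "sin (a * pi) = 0" "a \<noteq> 0"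
  shows "(LBINT \<psi>. arc \<psi> * cos (a * \<psi>)) = 0"
    and "(LBINT \<psi>. arc \<psi> * sin (a * \<psi>)) = 0"
proof -
  have s: "sin (a * (2 * pi)) = 0" "cos (a * (2 * pi)) = 1"
    using sin_double[of "a * pi"] cos_double_sin[of "a * pi"] assms by (simp_all add: mult.left_commute)
  have eq: "(LBINT \<psi>. arc \<psi> * g \<psi>) = (LBINT \<psi>. indicator {0..2*pi} \<psi> *\<^sub>R g \<psi>)"
    if [measurable]: "g \<in> borel_measurable borel" for g :: "real \<Rightarrow> real"
  proof (rule integral_cong_AE)
    show "AE \<psi> in lborel. arc \<psi> * g \<psi> = indicator {0..2*pi} \<psi> *\<^sub>R g \<psi>"
      using AE_lborel_singleton[of 0] AE_lborel_singleton[of "2 * pi"] by eventually_elim (auto simp: indicator_def)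
  qed measurable
  have "(LBINT \<psi>. indicator {0..2*pi} \<psi> *\<^sub>R cos (a * \<psi>)) = sin (a * (2 * pi)) / a - sin (a * 0) / a"
    by (rule has_bochner_integral_integral_eq[OF has_bochner_integral_FTC_Icc])
       (use assms(2) in \<open>auto intro!: derivative_eq_intros continuous_intros simp: has_real_derivative_iff_has_vector_derivative[symmetric]\<close>)
  then show "(LBINT \<psi>. arc \<psi> * cos (a * \<psi>)) = 0" using eq[of "\<lambda>\<psi>. cos (a * \<psi>)"] s by simp
  have "(LBINT \<psi>. indicator {0..2*pi} \<psi> *\<^sub>R sin (a * \<psi>)) = - cos (a * (2 * pi)) / a - - cos (a * 0) / a"
    by (rule has_bochner_integral_integral_eq[OF has_bochner_integral_FTC_Icc])
       (use assms(2) in \<open>auto intro!: derivative_eq_intros continuous_intros simp: has_real_derivative_iff_has_vector_derivative[symmetric]\<close>)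
  then show "(LBINT \<psi>. arc \<psi> * sin (a * \<psi>)) = 0" using eq[of "\<lambda>\<psi>. sin (a * \<psi>)"] s by simp
qed

lemma resonant_cases:
  fixes a :: real
  assumes "0 < a" "a \<le> 2" "sin (a * pi) = 0"
  shows "a = 1 \<or> a = 2"
proof -
  obtain i :: int where i: "a * pi = of_int i * pi" using assms(3) by (auto simp: sin_zero_iff_int2)
  then have "a = of_int i" by simp
  then have "0 < i" "i \<le> 2" using assms by simp_all
  then have "i = 1 \<or> i = 2" by linarith
  then show ?thesis using \<open>a = of_int i\<close> by auto
qed

text \<open>\<open>c\<close> is a Borel representative of b - \<beta>, cut off to the open period;
  the angles lost, including the endpoints, form a null set. The complex orthogonality condition
  splits into the cosine and sine conditions because b is real.\<close>

lemma circle_ode_of_square_integrable: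
  fixes b :: "real \<Rightarrow> real" and \<beta> :: real
  assumes a: "0 < a" "a \<le> 2" and sq: "square_integrable (lebesgue_on {0..2*pi}) b"
    and orth: "a = 1 \<or> a = 2 \<Longrightarrow> (LINT \<psi>|lebesgue_on {0..2*pi}. complex_of_real (b \<psi>) * cis (a * \<psi>)) = 0"
  obtains c where "circle_ode a c" "AE \<psi> in lborel. 0 < \<psi> \<longrightarrow> \<psi> < 2 * pi \<longrightarrow> \<beta> + c \<psi> = b \<psi>"
    "integrable lborel (\<lambda>\<psi>. (c \<psi>)\<^sup>2)"
    "(LBINT \<psi>. (c \<psi>)\<^sup>2) = (LINT \<psi>|lebesgue_on {0..2*pi}. \<bar>b \<psi> - \<beta>\<bar>\<^sup>2)"
proof -
  let ?J = "{0<..<2*pi}"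
  have "b \<in> borel_measurable (lebesgue_on {0..2*pi})" using sq by (simp add: square_integrable_def)
  then obtain b' where [measurable]: "b' \<in> borel_measurable borel" and ae: "AE \<psi> in lborel. 0 < \<psi> \<longrightarrow> \<psi> < 2 * pi \<longrightarrow> b \<psi> = b' \<psi>"
    by (rule lebesgue_on_circle_borel_version)
  define c where "c \<psi> = indicator ?J \<psi> * (b' \<psi> - \<beta>)" for \<psi>
  have one: "integrable lborel (\<lambda>\<psi>. indicator ?J \<psi> * C)" for C :: real by simp
  have b2: "integrable lborel (\<lambda>\<psi>. indicator ?J \<psi> * (b' \<psi>)\<^sup>2)"
  proof -
    have "AE \<psi> in lborel. 0 < \<psi> \<longrightarrow> \<psi> < 2 * pi \<longrightarrow> (norm (b \<psi>))\<^sup>2 = (b' \<psi>)\<^sup>2" using ae by eventually_elim simp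
    from integrable_circle_borel[OF _ this] sq show ?thesis by (simp add: square_integrable_def)
  qed
  have b1: "integrable lborel (\<lambda>\<psi>. indicator ?J \<psi> * b' \<psi>)"
  proof (rule Bochner_Integration.integrable_bound)
    show "integrable lborel (\<lambda>\<psi>. indicator ?J \<psi> * 1 + indicator ?J \<psi> * (b' \<psi>)\<^sup>2)" using one[of 1] b2 by simp
    show "AE \<psi> in lborel. norm (indicator ?J \<psi> * b' \<psi>) \<le> norm (indicator ?J \<psi> * 1 + indicator ?J \<psi> * (b' \<psi>)\<^sup>2)"
    proof (rule AE_I2)
      fix \<psi>
      \<comment> \<open>On a set of finite measure, square integrability implies
        integrability.\<close>
      have "\<bar>b' \<psi>\<bar> \<le> 1 + (b' \<psi>)\<^sup>2"
        using zero_le_power2[of "\<bar>b' \<psi>\<bar> - 1"] by (simp add: power2_diff)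
      then show "norm (indicator ?J \<psi> * b' \<psi>) \<le> norm (indicator ?J \<psi> * 1 + indicator ?J \<psi> * (b' \<psi>)\<^sup>2)"
        by (auto simp: indicator_def)
    qed
  qed measurable
  have c_eq: "c = (\<lambda>\<psi>. indicator ?J \<psi> * b' \<psi> - indicator ?J \<psi> * \<beta>)" by (simp add: c_def fun_eq_iff right_diff_distrib)
  have ci: "integrable lborel c" unfolding c_eq using b1 one[of \<beta>] by simp
  have c2_eq: "(\<lambda>\<psi>. (c \<psi>)\<^sup>2) = (\<lambda>\<psi>. indicator ?J \<psi> * (b' \<psi>)\<^sup>2 - 2 * \<beta> * (indicator ?J \<psi> * b' \<psi>) + indicator ?J \<psi> * \<beta>\<^sup>2)"
    by (auto simp: c_def fun_eq_iff indicator_def power2_eq_square algebra_simps)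
  have c2: "integrable lborel (\<lambda>\<psi>. (c \<psi>)\<^sup>2)" unfolding c2_eq using b1 b2 one[of "\<beta>\<^sup>2"] by simp
  have ae2: "AE \<psi> in lborel. 0 < \<psi> \<longrightarrow> \<psi> < 2 * pi \<longrightarrow> \<beta> + c \<psi> = b \<psi>"
    using ae by eventually_elim (simp add: c_def)
  have c2i: "(LBINT \<psi>. (c \<psi>)\<^sup>2) = (LINT \<psi>|lebesgue_on {0..2*pi}. \<bar>b \<psi> - \<beta>\<bar>\<^sup>2)"
  proof -
    have "AE \<psi> in lborel. 0 < \<psi> \<longrightarrow> \<psi> < 2 * pi \<longrightarrow> \<bar>b \<psi> - \<beta>\<bar>\<^sup>2 = (b' \<psi> - \<beta>)\<^sup>2" using ae by eventually_elim simp
    from integral_circle_borel[OF _ this]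
    have "(LINT \<psi>|lebesgue_on {0..2*pi}. \<bar>b \<psi> - \<beta>\<bar>\<^sup>2) = (LBINT \<psi>. indicator ?J \<psi> *\<^sub>R (b' \<psi> - \<beta>)\<^sup>2)" by simp
    also have "\<dots> = (LBINT \<psi>. (c \<psi>)\<^sup>2)"
      by (rule Bochner_Integration.integral_cong) (auto simp: c_def indicator_def)
    finally show ?thesis ..
  qed
  have "circle_ode a c"
  proof
    show "a > 0" "integrable lborel c" by fact+
    show "c y = 0" if "\<not> (0 < y \<and> y < 2 * pi)" for y using that by (auto simp: c_def)
    assume res: "sin (a * pi) = 0"
    have "AE \<psi> in lborel. 0 < \<psi> \<longrightarrow> \<psi> < 2 * pi \<longrightarrow> complex_of_real (b \<psi>) * cis (a * \<psi>) = complex_of_real (b' \<psi>) * cis (a * \<psi>)"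
      using ae by eventually_elim simp
    moreover have [measurable]: "(\<lambda>\<psi>. cis (a * \<psi>)) \<in> borel_measurable borel"
      unfolding cis_conv_exp by (intro borel_measurable_continuous_onI continuous_intros)
    ultimately have "(LBINT \<psi>. indicator ?J \<psi> *\<^sub>R (complex_of_real (b' \<psi>) * cis (a * \<psi>))) = 0"
      using orth[OF resonant_cases[OF a res]]
        integral_circle_borel[of "\<lambda>\<psi>. complex_of_real (b' \<psi>) * cis (a * \<psi>)" "\<lambda>\<psi>. complex_of_real (b \<psi>) * cis (a * \<psi>)"] by simp
    moreover have bint: "integrable lborel (\<lambda>\<psi>. indicator ?J \<psi> *\<^sub>R (complex_of_real (b' \<psi>) * cis (a * \<psi>)))"
      by (rule Bochner_Integration.integrable_bound[OF b1]) (measurable, auto simp: indicator_def norm_mult)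
    ultimately have "(LBINT \<psi>. Re (indicator ?J \<psi> *\<^sub>R (complex_of_real (b' \<psi>) * cis (a * \<psi>)))) = 0"
      "(LBINT \<psi>. Im (indicator ?J \<psi> *\<^sub>R (complex_of_real (b' \<psi>) * cis (a * \<psi>)))) = 0"
      using integral_bounded_linear[OF bounded_linear_Re bint] integral_bounded_linear[OF bounded_linear_Im bint] by simp_all
    then have b0: "(LBINT \<psi>. indicator ?J \<psi> * (b' \<psi> * cos (a * \<psi>))) = 0" "(LBINT \<psi>. indicator ?J \<psi> * (b' \<psi> * sin (a * \<psi>))) = 0"
      by simp_all
    have bi: "integrable lborel (\<lambda>\<psi>. indicator ?J \<psi> * (b' \<psi> * cos (a * \<psi>)))" "integrable lborel (\<lambda>\<psi>. indicator ?J \<psi> * (b' \<psi> * sin (a * \<psi>)))"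
      using integrable_bounded_linear[OF bounded_linear_Re bint] integrable_bounded_linear[OF bounded_linear_Im bint] by simp_all
    have ti: "integrable lborel (\<lambda>\<psi>. indicator ?J \<psi> * cos (a * \<psi>))" "integrable lborel (\<lambda>\<psi>. indicator ?J \<psi> * sin (a * \<psi>))"
      by (rule Bochner_Integration.integrable_bound[OF one[of 1]]; measurable; auto simp: indicator_def)+
    have "(\<lambda>y. c y * cos (a * y)) = (\<lambda>\<psi>. indicator ?J \<psi> * (b' \<psi> * cos (a * \<psi>)) - \<beta> * (indicator ?J \<psi> * cos (a * \<psi>)))"
      "(\<lambda>y. c y * sin (a * y)) = (\<lambda>\<psi>. indicator ?J \<psi> * (b' \<psi> * sin (a * \<psi>)) - \<beta> * (indicator ?J \<psi> * sin (a * \<psi>)))"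
      by (auto simp: c_def fun_eq_iff algebra_simps)
    then show "(LBINT y. c y * cos (a * y)) = 0" "(LBINT y. c y * sin (a * y)) = 0"
      using b0 bi ti integral_circle_trig[OF res] a by simp_all
  qed
  with ae2 c2 c2i show ?thesis using that by blast
qed

section \<open>Sign and size of the potential\<close>

context circle_ode
begin

text \<open>Cauchy-Schwarz in the form |c| <= l/2 + c^2 / (2l) on the period, with the free
  parameter \<open>l\<close> to be optimized later; this avoids square roots.\<close>

lemma c_L1_bound:
  assumes "integrable lborel (\<lambda>\<psi>. (c \<psi>)\<^sup>2)" "l > 0"
  shows "(LBINT \<psi>. \<bar>c \<psi>\<bar>) \<le> (2 * pi * l + (LBINT \<psi>. (c \<psi>)\<^sup>2) / l) / 2"
proof -
  have "(LBINT \<psi>. \<bar>c \<psi>\<bar>) \<le> (LBINT \<psi>. (l / 2) * arc \<psi> + (c \<psi>)\<^sup>2 / (2 * l))"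
  proof (rule integral_mono)
    show "integrable lborel (\<lambda>\<psi>. \<bar>c \<psi>\<bar>)" using c_int by simp
    show "integrable lborel (\<lambda>\<psi>. (l / 2) * arc \<psi> + (c \<psi>)\<^sup>2 / (2 * l))" using assms by simp
    show "\<bar>c \<psi>\<bar> \<le> (l / 2) * arc \<psi> + (c \<psi>)\<^sup>2 / (2 * l)" for \<psi>
    proof (cases "0 < \<psi> \<and> \<psi> < 2 * pi")
      case True
      have "2 * l * \<bar>c \<psi>\<bar> \<le> l\<^sup>2 + (c \<psi>)\<^sup>2"
        using zero_le_power2[of "l - \<bar>c \<psi>\<bar>"] by (simp add: power2_diff)
      then show ?thesis using True \<open>l > 0\<close> by (simp add: field_simps power2_eq_square)
    qed (simp add: c_supp)
  qed
  also have "\<dots> = (2 * pi * l + (LBINT \<psi>. (c \<psi>)\<^sup>2) / l) / 2"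
    using assms by (simp add: field_simps)
  finally show ?thesis .
qed

text \<open>\<open>P\<close> consumes at most half of |\<beta>| / a^2, so the angular factor keeps
  the sign of \<beta> and at least half of its size. The factor \<open>sgn \<beta>\<close> treats
  both signs at once.\<close>

lemma potential_bounds:
  assumes "(\<bar>cot (a * pi)\<bar> + 1) / (2 * a) * (LBINT y. \<bar>c y\<bar>) \<le> \<bar>\<beta>\<bar> / (2 * a\<^sup>2)"
  shows "sgn \<beta> * potential \<beta> z \<ge> \<bar>\<beta>\<bar> / (2 * a\<^sup>2) * norm z powr a"
proof -
  have P: "\<bar>P (Arg2pi z)\<bar> \<le> \<bar>\<beta>\<bar> / (2 * a\<^sup>2)" using P_bound assms order_trans by blast
  have "\<bar>\<beta>\<bar> / (2 * a\<^sup>2) \<le> \<bar>\<beta>\<bar> / a\<^sup>2 - \<bar>\<beta>\<bar> / (2 * a\<^sup>2)" using a_pos by (simp add: field_simps)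
  also have "\<dots> \<le> sgn \<beta> * (\<beta> / a\<^sup>2 + P (Arg2pi z))"
    using P by (auto simp: sgn_if abs_if split: if_splits)
  finally have "\<bar>\<beta>\<bar> / (2 * a\<^sup>2) * norm z powr a \<le> sgn \<beta> * (\<beta> / a\<^sup>2 + P (Arg2pi z)) * norm z powr a"
    by (rule mult_right_mono) simp
  then show ?thesis by (simp add: potential_def mult_ac)
qed

lemma poisson_solution_field:
  assumes "AE z in lborel. B z = field \<beta> z"
  shows "poisson_solution B (potential \<beta>)"
    and "test_function \<eta> \<Longrightarrow> (LBINT z. potential \<beta> z * laplacian \<eta> z) = (LINT z|lebesgue. B z * \<eta> z)"
proof -
  show eq: "(LBINT z. potential \<beta> z * laplacian \<eta> z) = (LINT z|lebesgue. B z * \<eta> z)" if \<eta>: "test_function \<eta>" for \<eta>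
  proof -
    have [measurable]: "\<eta> \<in> borel_measurable borel" using \<eta> by (auto simp: test_function_def intro: smooth_measurable)
    have "(LINT z|lebesgue. B z * \<eta> z) = (LBINT z. field \<beta> z * \<eta> z)"
      by (rule lebesgue_integral_AE_borel) (use assms in \<open>auto elim: eventually_mono\<close>)
    then show ?thesis using potential_weak_poisson[OF \<eta>] by simp
  qed
  have "(LINT z|lebesgue. potential \<beta> z * laplacian \<eta> z) = (LINT z|lebesgue. B z * \<eta> z)" if \<eta>: "test_function \<eta>" for \<eta>
  proof -
    have [measurable]: "laplacian \<eta> \<in> borel_measurable borel"
      using \<eta> by (auto simp: test_function_def intro: smooth_measurable smooth_laplacian)
    have "(LINT z|lebesgue. potential \<beta> z * laplacian \<eta> z) = (LBINT z. potential \<beta> z * laplacian \<eta> z)"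
      by (rule lebesgue_integral_AE_borel) auto
    then show ?thesis using eq[OF \<eta>] by simp
  qed
  moreover have "locally_integrable B"
    using locally_integrable_AE_borel[OF field_measurable assms] field_integrable by blast
  moreover have "locally_integrable (potential \<beta>)"
    by (rule locally_integrable_AE_borel[OF potential_measurable, THEN iffD2]) (auto intro: potential_integrable)
  ultimately show "poisson_solution B (potential \<beta>)" by (simp add: poisson_solution_def)
qed

end

section \<open>Zero modes of an arbitrary solution\<close>

lemma square_integrable_weighted_power:
  fixes u :: "complex \<Rightarrow> complex" and F :: "complex \<Rightarrow> real"
  assumes "a > 0" "k > 0" and [measurable]: "u \<in> borel_measurable borel" and F: "F \<in> borel_measurable lebesgue"
    and bd: "AE z in lborel. norm (u z) * exp (- F z) \<le> norm z ^ n * exp (- (k * norm z powr a))"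
  shows "square_integrable lebesgue (\<lambda>z. u z * complex_of_real (exp (- F z)))"
proof -
  have um: "u \<in> borel_measurable lebesgue" by (simp add: measurable_completion)
  have m: "(\<lambda>z. u z * complex_of_real (exp (- F z))) \<in> borel_measurable lebesgue"
    using um F by measurable
  have "integrable lebesgue (\<lambda>z. (norm (u z * complex_of_real (exp (- F z))))\<^sup>2)"
  proof (rule Bochner_Integration.integrable_bound)
    show "integrable lebesgue (\<lambda>z::complex. (norm z ^ n)\<^sup>2 * exp (- ((2 * k) * norm z powr a)))"
      using integrable_power_exp_minus_powr[of a "2 * k" n] assms(1,2) by (subst integrable_completion) auto
    show "(\<lambda>z. (norm (u z * complex_of_real (exp (- F z))))\<^sup>2) \<in> borel_measurable lebesgue"
      using m by measurable
    have "AE z in lebesgue. norm (u z) * exp (- F z) \<le> norm z ^ n * exp (- (k * norm z powr a))"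
      using bd by (rule AE_completion)
    then show "AE z in lebesgue. norm ((norm (u z * complex_of_real (exp (- F z))))\<^sup>2) \<le> norm ((norm z ^ n)\<^sup>2 * exp (- ((2 * k) * norm z powr a)))"
    proof eventually_elim
      case (elim z)
      have "(norm (u z) * exp (- F z))\<^sup>2 \<le> (norm z ^ n * exp (- (k * norm z powr a)))\<^sup>2"
        by (rule power_mono[OF elim]) simp
      also have "\<dots> = (norm z ^ n)\<^sup>2 * exp (- ((2 * k) * norm z powr a))"
        by (simp add: power_mult_distrib exp_of_nat_mult[symmetric] mult.assoc flip: exp_double)
      finally show ?case by (simp add: norm_mult)
    qed
  qed
  with m show ?thesis by (simp add: square_integrable_def)
qed

text \<open>The modes are z^n e^g: the modulus e^(Re g) cancels the harmonic part of
  \<open>F\<close>, and the weight left over is that of \<open>F0\<close>, bounded by exp(-k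
  r^a).\<close>

lemma zero_modes_infinite_dimensional:
  assumes "a > 0" "k > 0" "\<beta> \<noteq> 0" and F0: "F0 \<in> borel_measurable borel"
    and bd: "\<And>z. sgn \<beta> * F0 z \<ge> k * norm z powr a"
    and g: "g holomorphic_on UNIV" and ae: "AE z in lborel. F z = F0 z + Re (g z)"
  shows "infinite_dimensional (zero_modes F)"
proof -
  have cont: "continuous_on UNIV g" using g by (rule holomorphic_on_imp_continuous_on)
  have [measurable]: "g \<in> borel_measurable borel" using cont by (rule borel_measurable_continuous_onI)
  have Fm: "F \<in> borel_measurable lebesgue"
    by (rule lebesgue_measurable_AE_borel[OF _ ae]) (use F0 in measurable)
  show ?thesis
  proof (cases "\<beta> > 0")
    case True
    define w where "w n = ((\<lambda>z. z ^ n * exp (g z)), (\<lambda>z::complex. 0::complex))" for n :: nat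
    show ?thesis
    proof (rule infinite_dimensionalI[where w = w and ev = "\<lambda>z v. fst v z" and h = "\<lambda>z. z" and k = "\<lambda>z. exp (g z)"])
      fix n
      have "square_integrable lebesgue (\<lambda>z. (z ^ n * exp (g z)) * complex_of_real (exp (- F z)))"
      proof (rule square_integrable_weighted_power[OF assms(1,2) _ Fm])
        show "AE z in lborel. norm (z ^ n * exp (g z)) * exp (- F z) \<le> norm z ^ n * exp (- (k * norm z powr a))"
          using ae
        proof eventually_elim
          case (elim z)
          have "norm (z ^ n * exp (g z)) * exp (- F z) = norm z ^ n * exp (- F0 z)"
            by (simp add: norm_mult norm_power elim mult.assoc exp_add[symmetric])
          also have "\<dots> \<le> norm z ^ n * exp (- (k * norm z powr a))"
            using bd[of z] True by (intro mult_left_mono) auto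
          finally show ?case .
        qed
      qed measurable
      moreover have "(\<lambda>z. z ^ n * exp (g z)) holomorphic_on UNIV" by (intro holomorphic_intros g)
      ultimately show "w n \<in> zero_modes F"
        by (simp add: zero_modes_def w_def analytic_zero_modes_def antianalytic_zero_modes_def square_integrable_def)
    qed (auto simp: w_def spinor_scale_def)
  next
    case False
    then have neg: "\<beta> < 0" using \<open>\<beta> \<noteq> 0\<close> by simp
    \<comment> \<open>For negative \<beta> the weight is e^F, so the harmonic part is cancelled by
      e^(-g), and conjugation makes the modes anti-analytic.\<close>
    define w where "w n = ((\<lambda>z::complex. 0::complex), (\<lambda>z. cnj (z ^ n * exp (- g z))))" for n :: nat
    show ?thesis
    proof (rule infinite_dimensionalI[where w = w and ev = "\<lambda>z v. snd v z" and h = cnj and k = "\<lambda>z. cnj (exp (- g z))"])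
      fix n
      have "square_integrable lebesgue (\<lambda>z. cnj (z ^ n * exp (- g z)) * complex_of_real (exp (- (- F z))))"
      proof (rule square_integrable_weighted_power[OF assms(1,2)])
        show "(\<lambda>z. - F z) \<in> borel_measurable lebesgue" using Fm by measurable
        show "(\<lambda>z. cnj (z ^ n * exp (- g z))) \<in> borel_measurable borel"
          by (intro borel_measurable_continuous_onI continuous_intros continuous_on_cnj cont)
        show "AE z in lborel. norm (cnj (z ^ n * exp (- g z))) * exp (- (- F z)) \<le> norm z ^ n * exp (- (k * norm z powr a))"
          using ae
        proof eventually_elim
          case (elim z)
          have "norm (cnj (z ^ n * exp (- g z))) * exp (- (- F z)) = norm z ^ n * exp (F0 z)"
            unfolding complex_mod_cnj by (simp add: norm_mult norm_power elim mult.assoc exp_add[symmetric])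
          also have "\<dots> \<le> norm z ^ n * exp (- (k * norm z powr a))"
            using bd[of z] neg by (intro mult_left_mono) auto
          finally show ?case .
        qed
      qed
      moreover have "(\<lambda>z. z ^ n * exp (- g z)) holomorphic_on UNIV" by (intro holomorphic_intros g)
      ultimately show "w n \<in> zero_modes F"
        by (simp add: zero_modes_def w_def analytic_zero_modes_def antianalytic_zero_modes_def square_integrable_def del: complex_cnj_mult complex_cnj_power)
    next
      show "range cnj = UNIV" by (metis complex_cnj_cnj surjI)
    qed (auto simp: w_def spinor_scale_def)
  qed
qed

theorem theorem5p1:
  fixes s \<beta>\<^sub>0 :: real
  assumes "-2 < s" and "s \<le> 0" and "\<beta>\<^sub>0 \<noteq> 0"
  shows "\<exists>\<delta>>0. \<forall>B :: complex \<Rightarrow> real.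
    radially_homogeneous s B \<longrightarrow>
    square_integrable (lebesgue_on {0..2*pi}) (\<lambda>\<psi>. B (cis \<psi>)) \<longrightarrow>
    1 / (2*pi) * (LINT \<psi>|lebesgue_on {0..2*pi}. B (cis \<psi>)) = \<beta>\<^sub>0 \<longrightarrow>
    (s = 0 \<or> s = -1 \<longrightarrow>
      (LINT \<psi>|lebesgue_on {0..2*pi}. complex_of_real (B (cis \<psi>)) * cis ((s + 2) * \<psi>)) = 0) \<longrightarrow>
    (LINT \<psi>|lebesgue_on {0..2*pi}. \<bar>B (cis \<psi>) - \<beta>\<^sub>0\<bar>\<^sup>2) < \<delta> \<longrightarrow>
    (\<exists>F. poisson_solution B F) \<and>
    (\<forall>F. poisson_solution B F \<longrightarrow> infinite_dimensional (zero_modes F))"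
proof -
  define a where "a = s + 2"
  have a: "0 < a" "a \<le> 2" using assms by (auto simp: a_def)
  define K where "K = (\<bar>cot (a * pi)\<bar> + 1) / (2 * a)"
  define k where "k = \<bar>\<beta>\<^sub>0\<bar> / (2 * a\<^sup>2)"
  \<comment> \<open>\<open>k / K\<close> is the largest first-power norm of \<open>c\<close> that
    the lower bound tolerates. With \<delta> = 2 pi l^2 below, this \<open>l\<close> minimizes (2 pi
    l + \<delta> / l) / 2, and the minimum 2 pi l is exactly k / K.\<close>
  define l where "l = k / K / (2 * pi)"
  have pos: "K > 0" "k > 0" "l > 0" using a assms(3) by (auto simp: K_def k_def l_def add_nonneg_pos)
  define \<delta> where "\<delta> = 2 * pi * l\<^sup>2"
  show ?thesis
  proof (intro exI[of _ \<delta>] conjI allI impI)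
    show "\<delta> > 0" using pos by (simp add: \<delta>_def)
    fix B :: "complex \<Rightarrow> real"
    assume rh: "radially_homogeneous s B"
      and sq: "square_integrable (lebesgue_on {0..2*pi}) (\<lambda>\<psi>. B (cis \<psi>))"
      and orth: "s = 0 \<or> s = -1 \<longrightarrow> (LINT \<psi>|lebesgue_on {0..2*pi}. complex_of_real (B (cis \<psi>)) * cis ((s + 2) * \<psi>)) = 0"
      and small: "(LINT \<psi>|lebesgue_on {0..2*pi}. \<bar>B (cis \<psi>) - \<beta>\<^sub>0\<bar>\<^sup>2) < \<delta>"
    have orth': "(LINT \<psi>|lebesgue_on {0..2*pi}. complex_of_real (B (cis \<psi>)) * cis (a * \<psi>)) = 0" if "a = 1 \<or> a = 2"
    proof -
      have "s = 0 \<or> s = -1" using that by (auto simp: a_def)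
      with orth show ?thesis unfolding a_def by blast
    qed
    obtain c where c: "circle_ode a c" "AE \<psi> in lborel. 0 < \<psi> \<longrightarrow> \<psi> < 2 * pi \<longrightarrow> \<beta>\<^sub>0 + c \<psi> = B (cis \<psi>)"
      "integrable lborel (\<lambda>\<psi>. (c \<psi>)\<^sup>2)" "(\<integral>\<psi>. (c \<psi>)\<^sup>2 \<partial>lborel) = (LINT \<psi>|lebesgue_on {0..2*pi}. \<bar>B (cis \<psi>) - \<beta>\<^sub>0\<bar>\<^sup>2)"
      by (rule circle_ode_of_square_integrable[OF a sq orth'])
    interpret circle_ode a c by fact
    have "(\<integral>\<psi>. \<bar>c \<psi>\<bar> \<partial>lborel) \<le> (2 * pi * l + (\<integral>\<psi>. (c \<psi>)\<^sup>2 \<partial>lborel) / l) / 2"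
      by (rule c_L1_bound[OF c(3) pos(3)])
    also have "\<dots> \<le> (2 * pi * l + \<delta> / l) / 2"
      using small pos by (simp add: c(4) divide_right_mono)
    also have "\<dots> = k / K" using pos by (simp add: \<delta>_def power2_eq_square) (simp add: l_def)
    finally have "K * (\<integral>\<psi>. \<bar>c \<psi>\<bar> \<partial>lborel) \<le> k" using pos by (simp add: field_simps)
    then have bounds: "sgn \<beta>\<^sub>0 * potential \<beta>\<^sub>0 z \<ge> k * norm z powr a" for z
      unfolding K_def k_def by (rule potential_bounds)
    \<comment> \<open>Homogeneity carries the identity from almost every direction to almost every
      point; the origin, where homogeneity says nothing, is removed as a null set.\<close>
    have field: "AE z in lborel. B z = field \<beta>\<^sub>0 z"
      using AE_Arg2pi[OF c(2)] AE_lborel_singleton[of "0::complex"]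
    proof eventually_elim
      case (elim z)
      have "B z = B (of_real (norm z) * cis (Arg2pi z))" using Arg2pi_eq[of z] by (simp add: cis_conv_exp)
      also have "\<dots> = norm z powr s * B (cis (Arg2pi z))"
        using rh elim(2) unfolding radially_homogeneous_def by simp
      finally show ?case unfolding field_def using elim(1) by (simp add: a_def)
    qed
    show "\<exists>F. poisson_solution B F" using poisson_solution_field(1)[OF field] by blast
    fix F assume "poisson_solution B F"
    \<comment> \<open>From here the argument holds for every solution \<open>F\<close>, whichever
      entire function separates it from the explicit potential.\<close>
    then obtain g where "g holomorphic_on UNIV" "AE z in lborel. F z = potential \<beta>\<^sub>0 z + Re (g z)"
      using poisson_solution_unique_mod_Re_entire[OF _ potential_measurable potential_integrable poisson_solution_field(2)[OF field]]
      by blast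
    then show "infinite_dimensional (zero_modes F)"
      using zero_modes_infinite_dimensional[OF a(1) pos(2) assms(3) potential_measurable bounds] by blast
  qed
qed

end
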